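(* Let $(a,b)\in G\times G$ be a matching pair, i.e. $a(t)a(-t)=b(t)b(-t)$ for all $t\in\mathbb{R}$, with $a$ (and hence $b$) invertible in $G$, and let $c=\widetilde b\,\widetilde a^{-1}$, $d=b\,\widetilde a^{-1}$. Assume $\nu(c)=\nu(d)=0$, put $\kappa_1=\operatorname{ind}W(c)$, $\kappa_2=\operatorname{ind}W(d)$, and let $(\kappa_1,\kappa_2)\in\mathbb{Z}_-\times\mathbb{N}$, $p\in[1,\infty)$. Let $k\in\mathbb{N}$ be the unique number with $1\ge2k+\kappa_1\ge0$, write $v(t)=\frac{t-i}{t+i}$, and let $\varphi_\pm=\varphi_\pm^{(av^{-k},\,bv^{k})}$. Consider $W(a)\pm H(b)$ on $L^p(\mathbb{R}^+)$. Then (upper signs together, lower signs together): (1) If $\kappa_1$ is odd, then $$\ker(W(a)\pm H(b))=W(v^{-k})\left(\left\{\frac{1\mp\boldsymbol{\sigma}(c)}{2}W(c_+^{-1})\{\mathbb{C}\psi_0\}\dotplus\varphi_\pm(\operatorname{im}\mathbf{P}^\pm(d))\right\}\cap\operatorname{im}W(v^k)\right)$$ $$=\Big\{W(v^{-k})u:\ u\in\tfrac{1\mp\boldsymbol{\sigma}(c)}{2}W(c_+^{-1})\{\mathbb{C}\psi_0\}\dotplus\varphi_\pm(\operatorname{im}\mathbf{P}^\pm(d))\ \text{ and }\ \int_0^\infty u(t)e^{-t}t^j\,dt=0\ \text{ for all } j=0,1,\dots,k-1\Big\}.$$ (2) If $\kappa_1$ is even, then $$\ker(W(a)\pm H(b))=W(v^{-k})\left(\varphi_\pm(\operatorname{im}\mathbf{P}^\pm(d))\cap\operatorname{im}W(v^k)\right)$$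 $$=\Big\{W(v^{-k})u:\ u\in\varphi_\pm(\operatorname{im}\mathbf{P}^\pm(d))\ \text{ and }\ \int_0^\infty u(t)e^{-t}t^j\,dt=0\ \text{ for all } j=0,1,\dots,k-1\Big\}.$$
   Context: $\mathbb{N}=\{1,2,\dots\}$, $\mathbb{Z}_-=\{-1,-2,\dots\}$; $\dotplus$ denotes direct sum; $\widetilde f(t)=f(-t)$; $\{\mathbb{C}\psi_0\}$ is the one-dimensional span of $\psi_0$. $\operatorname{ind}A=\dim\ker A-\dim\operatorname{coker}A$. $G$ is the Banach algebra of functions on $\mathbb{R}$ of the form $a(t)=\sum_{j=-\infty}^{\infty}a_je^{i\delta_jt}+\int_{-\infty}^\infty r(s)e^{its}\,ds$ with pairwise distinct $\delta_j\in\mathbb{R}$, $\sum_j|a_j|<\infty$, $r\in L^1(\mathbb{R})$. $G^+$ (resp. $G^-$) is the set of those $a\in G$ for which all $\delta_j\ge0$ (resp. $\le0$) and $r$ vanishes on the negative (resp. positive) half-line. For $a$ invertible in $G$ with almost periodic part $a_{ap}(t)=\sum_ja_je^{i\delta_jt}$ (which is then invertible too), $\nu(a)=\lim_{l\to\infty}\frac1{2l}[\arg a_{ap}(t)]_{-l}^{l}$. If $a$ is invertible in $G$ and $\nu(a)=0$, then $W(a)$ is Fredholm. $L^p(\mathbb{R}^\pm)$ is the subspace of $L^p(\mathbb{R})$ of functions vanishing on $\mathbb{R}^\mp$. $(W^0(a)f)(t)=\sum_ja_jf(t-\delta_j)+\int_{-\infty}^\infty r(t-s)f(s)\,ds$ on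 $L^p(\mathbb{R})$; $P$ is multiplication by the characteristic function of $\mathbb{R}^+$, $Q=I-P$, $(Jf)(t)=f(-t)$. On $L^p(\mathbb{R}^+)$: $W(a)=PW^0(a)$, $H(a)=PW^0(a)QJ$. A matching function is $g\in G$ with $g\widetilde g=1$; $c,d$ are matching functions. For a matching function $g$, $\mathbf{P}(g):=JQW^0(g)P|_{\ker W(g)}$ maps $\ker W(g)$ into itself, $\mathbf{P}(g)^2=I$, and $\mathbf{P}^\pm(g)=\frac12(I\pm\mathbf{P}(g))$ are complementary projections on $\ker W(g)$. The matching function $c$ has the Wiener-Hopf factorization $c=\boldsymbol{\sigma}(c)\,\widetilde c_+^{-1}\,v^{-\kappa_1}c_+$ with $c_+^{\pm1}\in G^+$ and $\boldsymbol{\sigma}(c)=(-1)^{\kappa_1}c(0)\in\{1,-1\}$, normalized so that $c_-:=\boldsymbol{\sigma}(c)\widetilde c_+^{-1}$ satisfies $c_-(0)=1$. $\psi_0(t)=\sqrt2e^{-t}$ for $t>0$, $\psi_0(t)=0$ for $t<0$. For a matching pair $(\alpha,\beta)$ of invertible elements of $G$ put $\gamma=\widetilde\beta\widetilde\alpha^{-1}$, $\delta=\beta\widetilde\alpha^{-1}$ (the subordinated pair $(\gamma,\delta)$). If $W(\gamma)$ is right-invertible with a right inverse $W_r^{-1}(\gamma)$, the maps $\varphi_\pm^{(\alpha,\beta)}$ are defined on $\ker W(\delta)$ by $$2\varphi_\pm^{(\alpha,\beta)}(s)=W_r^{-1}(\gamma)W(\widetilde\alpha^{-1})s\mp JQW^0(\gamma)PW_r^{-1}(\gamma)W(\widetilde\alpha^{-1})s\pm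 JQW^0(\widetilde\alpha^{-1})s.$$ The pair $(av^{-k},bv^k)$ is a matching pair with subordinated pair $(cv^{-2k},d)$, and $W(cv^{-2k})$ is right-invertible with index $2k+\kappa_1\in\{0,1\}$.
   Formalization: In part (1) the coefficient (1∓σ(c))/2 is corrected to (1±σ(c))/2 (upper signs together, lower signs together), since W⁰(v⁻¹)ψ₀ = −Jψ₀; the printed sign fails e.g. for a=v⁻¹f, b=v⁻²f, f=(1+v²/2)(1+v⁻²/2), lower sign. *)

theory Defs
  imports "HOL-Analysis.Analysis"
begin

section \<open>The algebra \<open>G\<close>\<close>

definition G_expansion ::
  "(real \<Rightarrow> complex) \<Rightarrow> (int \<Rightarrow> real) \<Rightarrow> (int \<Rightarrow> complex) \<Rightarrow> (real \<Rightarrow> complex) \<Rightarrow> bool" where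
  "G_expansion a \<delta> \<alpha> r \<longleftrightarrow>
     inj \<delta> \<and> (\<lambda>j. cmod (\<alpha> j)) summable_on UNIV \<and> integrable lborel r \<and>
     (\<forall>t. a t = infsum (\<lambda>j. \<alpha> j * cis (\<delta> j * t)) UNIV + (\<integral>s. r s * cis (s * t) \<partial>lborel))"

definition G :: "(real \<Rightarrow> complex) set" where
  "G = {a. \<exists>\<delta> \<alpha> r. G_expansion a \<delta> \<alpha> r}"

definition Gplus :: "(real \<Rightarrow> complex) set" where
  "Gplus = {a. \<exists>\<delta> \<alpha> r. G_expansion a \<delta> \<alpha> r \<and> (\<forall>j. \<delta> j \<ge> 0) \<and> (\<forall>s<0. r s = 0)}"

definition G_invertible :: "(real \<Rightarrow> complex) \<Rightarrow> bool" where
  "G_invertible a \<longleftrightarrow> a \<in> G \<and> (\<exists>x\<in>G. \<forall>t. a t * x t = 1)"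

definition refl_fun :: "(real \<Rightarrow> complex) \<Rightarrow> real \<Rightarrow> complex" where
  "refl_fun f = (\<lambda>t. f (- t))"

definition recip :: "(real \<Rightarrow> complex) \<Rightarrow> real \<Rightarrow> complex" where
  "recip f = (\<lambda>t. inverse (f t))"

definition fmult :: "(real \<Rightarrow> complex) \<Rightarrow> (real \<Rightarrow> complex) \<Rightarrow> real \<Rightarrow> complex"  (infixl "\<odot>" 70) where
  "f \<odot> g = (\<lambda>t. f t * g t)"

definition vfun :: "real \<Rightarrow> complex" where
  "vfun t = (of_real t - \<i>) / (of_real t + \<i>)"

definition vpow :: "int \<Rightarrow> real \<Rightarrow> complex" where
  "vpow n = (\<lambda>t. vfun t powi n)"

text \<open>The expansion of an element of \<open>G\<close> is unique up to zero coefficients, the order of the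
  summands and null sets. So any expansion determines the almost periodic part, and (below)
  the convolution operator.\<close>

definition G_choice :: "(real \<Rightarrow> complex) \<Rightarrow> (int \<Rightarrow> real) \<times> (int \<Rightarrow> complex) \<times> (real \<Rightarrow> complex)" where
  "G_choice a = (SOME (\<delta>, \<alpha>, r). G_expansion a \<delta> \<alpha> r)"

definition ap_part :: "(real \<Rightarrow> complex) \<Rightarrow> real \<Rightarrow> complex" where
  "ap_part a = (case G_choice a of (\<delta>, \<alpha>, r) \<Rightarrow> (\<lambda>t. infsum (\<lambda>j. \<alpha> j * cis (\<delta> j * t)) UNIV))"

definition continuous_arg :: "(real \<Rightarrow> complex) \<Rightarrow> (real \<Rightarrow> real) \<Rightarrow> bool" where
  "continuous_arg f \<theta> \<longleftrightarrow>
     continuous_on UNIV \<theta> \<and> (\<forall>t. f t = of_real (cmod (f t)) * cis (\<theta> t))"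

text \<open>Two continuous arguments of a nonvanishing function differ by a constant, so the
  increments below do not depend on the choice.\<close>

definition nu :: "(real \<Rightarrow> complex) \<Rightarrow> real" where
  "nu a = (let \<theta> = (SOME \<theta>. continuous_arg (ap_part a) \<theta>)
           in Lim at_top (\<lambda>l. (\<theta> l - \<theta> (- l)) / (2 * l)))"


section \<open>Measurable functions modulo equality almost everywhere\<close>

definition ae_equal :: "(real \<Rightarrow> complex) \<Rightarrow> (real \<Rightarrow> complex) \<Rightarrow> bool" where
  "ae_equal f g \<longleftrightarrow>
     f \<in> borel_measurable lborel \<and> g \<in> borel_measurable lborel \<and> (AE t in lborel. f t = g t)"

quotient_type lfun = "real \<Rightarrow> complex" / partial: ae_equal
proof (rule part_equivpI)
  show "\<exists>f. ae_equal f f"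
    by (rule exI[of _ "\<lambda>_. 0"]) (simp add: ae_equal_def)
  show "symp ae_equal"
    by (auto simp: symp_def ae_equal_def elim!: AE_mp)
  show "transp ae_equal"
    unfolding transp_def ae_equal_def by (auto elim: eventually_elim2)
qed

instantiation lfun :: ab_group_add
begin

lift_definition zero_lfun :: lfun is "\<lambda>_. 0"
  by (simp add: ae_equal_def)

lift_definition plus_lfun :: "lfun \<Rightarrow> lfun \<Rightarrow> lfun" is "\<lambda>f g t. f t + g t"
  unfolding ae_equal_def by (auto elim: eventually_elim2)

lift_definition minus_lfun :: "lfun \<Rightarrow> lfun \<Rightarrow> lfun" is "\<lambda>f g t. f t - g t"
  unfolding ae_equal_def by (auto elim: eventually_elim2)

lift_definition uminus_lfun :: "lfun \<Rightarrow> lfun" is "\<lambda>f t. - f t"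
  unfolding ae_equal_def by (auto elim: eventually_mono)

instance
  by standard (transfer; simp add: ae_equal_def algebra_simps)+

end

lift_definition scaleC :: "complex \<Rightarrow> lfun \<Rightarrow> lfun"  (infixr "*\<^sub>C" 75) is "\<lambda>z f t. z * f t"
  unfolding ae_equal_def by (auto elim: eventually_mono)

interpretation lfun: vector_space scaleC
  by standard (transfer; simp add: ae_equal_def algebra_simps)+

text \<open>\<open>lfun_of f\<close> is the class of \<open>f\<close> (for measurable \<open>f\<close>); \<open>rep u\<close> is a representative of \<open>u\<close>.\<close>

abbreviation lfun_of :: "(real \<Rightarrow> complex) \<Rightarrow> lfun" where
  "lfun_of \<equiv> abs_lfun"

abbreviation rep :: "lfun \<Rightarrow> real \<Rightarrow> complex" where
  "rep \<equiv> rep_lfun"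

definition Lp :: "real \<Rightarrow> lfun set" where
  "Lp p = {u. integrable lborel (\<lambda>t. cmod (rep u t) powr p)}"

definition Lp_norm :: "real \<Rightarrow> lfun \<Rightarrow> real" where
  "Lp_norm p u = (\<integral>t. cmod (rep u t) powr p \<partial>lborel) powr (1 / p)"

definition LpR :: "real \<Rightarrow> lfun set" where
  "LpR p = {u \<in> Lp p. AE t in lborel. t < 0 \<longrightarrow> rep u t = 0}"


section \<open>Convolution, Wiener-Hopf and Hankel operators\<close>

definition projP :: "lfun \<Rightarrow> lfun" where
  "projP u = lfun_of (\<lambda>t. indicator {0<..} t * rep u t)"

definition projQ :: "lfun \<Rightarrow> lfun" where
  "projQ u = u - projP u"

definition flip :: "lfun \<Rightarrow> lfun" where
  "flip u = lfun_of (\<lambda>t. rep u (- t))"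

definition W0 :: "(real \<Rightarrow> complex) \<Rightarrow> lfun \<Rightarrow> lfun" where
  "W0 a u = (case G_choice a of (\<delta>, \<alpha>, r) \<Rightarrow>
     lfun_of (\<lambda>t. infsum (\<lambda>j. \<alpha> j * rep u (t - \<delta> j)) UNIV + (\<integral>s. r (t - s) * rep u s \<partial>lborel)))"

definition W :: "(real \<Rightarrow> complex) \<Rightarrow> lfun \<Rightarrow> lfun" where
  "W a u = projP (W0 a u)"

definition H :: "(real \<Rightarrow> complex) \<Rightarrow> lfun \<Rightarrow> lfun" where
  "H a u = projP (W0 a (projQ (flip u)))"

definition ker_on :: "real \<Rightarrow> (lfun \<Rightarrow> lfun) \<Rightarrow> lfun set" where
  "ker_on p A = {u \<in> LpR p. A u = 0}"

definition im_on :: "real \<Rightarrow> (lfun \<Rightarrow> lfun) \<Rightarrow> lfun set" where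
  "im_on p A = A ` LpR p"

text \<open>The dimension of \<open>V / U\<close>, as the number of elements of a finite linearly independent
  \<open>B \<subseteq> V\<close> whose span is a complement of \<open>U\<close> in \<open>V\<close>, that is, whose cosets form a basis of
  \<open>V / U\<close>. Unspecified if \<open>V / U\<close> is infinite-dimensional.\<close>

definition quotient_dim :: "lfun set \<Rightarrow> lfun set \<Rightarrow> nat" where
  "quotient_dim V U = (THE n. \<exists>B. B \<subseteq> V \<and> finite B \<and> card B = n \<and> lfun.independent B \<and>
     lfun.span B \<inter> U = {0} \<and> (\<forall>x\<in>V. \<exists>y\<in>lfun.span B. x - y \<in> U))"

definition ind :: "real \<Rightarrow> (lfun \<Rightarrow> lfun) \<Rightarrow> int" where
  "ind p A = int (lfun.dim (ker_on p A)) - int (quotient_dim (LpR p) (im_on p A))"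

definition bounded_operator :: "real \<Rightarrow> (lfun \<Rightarrow> lfun) \<Rightarrow> bool" where
  "bounded_operator p A \<longleftrightarrow>
     (\<forall>u\<in>LpR p. A u \<in> LpR p) \<and>
     (\<forall>u\<in>LpR p. \<forall>w\<in>LpR p. A (u + w) = A u + A w) \<and>
     (\<forall>z. \<forall>u\<in>LpR p. A (z *\<^sub>C u) = z *\<^sub>C A u) \<and>
     (\<exists>C. \<forall>u\<in>LpR p. Lp_norm p (A u) \<le> C * Lp_norm p u)"

definition right_inverse :: "real \<Rightarrow> (lfun \<Rightarrow> lfun) \<Rightarrow> (lfun \<Rightarrow> lfun) \<Rightarrow> bool" where
  "right_inverse p A R \<longleftrightarrow> bounded_operator p R \<and> (\<forall>u\<in>LpR p. A (R u) = u)"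


section \<open>Matching functions\<close>

definition PP :: "(real \<Rightarrow> complex) \<Rightarrow> lfun \<Rightarrow> lfun" where
  "PP g u = flip (projQ (W0 g (projP u)))"

text \<open>In the following definitions \<open>e = 1\<close> encodes the upper and \<open>e = - 1\<close> the lower sign.\<close>

definition PPsign :: "complex \<Rightarrow> (real \<Rightarrow> complex) \<Rightarrow> lfun \<Rightarrow> lfun" where
  "PPsign e g u = (1 / 2) *\<^sub>C (u + e *\<^sub>C PP g u)"

definition im_PPsign :: "real \<Rightarrow> complex \<Rightarrow> (real \<Rightarrow> complex) \<Rightarrow> lfun set" where
  "im_PPsign p e g = PPsign e g ` ker_on p (W g)"

text \<open>\<open>R\<close> is the chosen right inverse of \<open>W \<gamma>\<close> for \<open>\<gamma> = refl_fun \<beta> \<odot> recip (refl_fun \<alpha>)\<close>.\<close>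

definition phi :: "complex \<Rightarrow> (real \<Rightarrow> complex) \<Rightarrow> (real \<Rightarrow> complex) \<Rightarrow> (lfun \<Rightarrow> lfun) \<Rightarrow> lfun \<Rightarrow> lfun" where
  "phi e \<alpha> \<beta> R s =
     (let \<gamma> = refl_fun \<beta> \<odot> recip (refl_fun \<alpha>);
          x = R (W (recip (refl_fun \<alpha>)) s)
      in (1 / 2) *\<^sub>C
         (x - e *\<^sub>C flip (projQ (W0 \<gamma> (projP x)))
            + e *\<^sub>C flip (projQ (W0 (recip (refl_fun \<alpha>)) s))))"

definition fsig :: "int \<Rightarrow> (real \<Rightarrow> complex) \<Rightarrow> complex" where
  "fsig \<kappa> c = (- 1) powi \<kappa> * c 0"

definition wh_factor :: "int \<Rightarrow> (real \<Rightarrow> complex) \<Rightarrow> (real \<Rightarrow> complex) \<Rightarrow> bool" where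
  "wh_factor \<kappa> c cp \<longleftrightarrow>
     (\<forall>t. cp t \<noteq> 0) \<and> cp \<in> Gplus \<and> recip cp \<in> Gplus \<and>
     (\<forall>t. c t = fsig \<kappa> c * inverse (cp (- t)) * vfun t powi (- \<kappa>) * cp t) \<and>
     fsig \<kappa> c * inverse (cp 0) = 1"

definition psi0 :: lfun where
  "psi0 = lfun_of (\<lambda>t. if t > 0 then of_real (sqrt 2 * exp (- t)) else 0)"

text \<open>The line \<open>(1 \<plusminus> \<sigma>) / 2 \<cdot> W(c\<^sub>+\<^sup>-\<^sup>1) {\<complex> \<psi>\<^sub>0}\<close>. The sign of \<open>\<sigma>\<close> agrees with \<open>e\<close>: if \<open>c\<close> has
  factor \<open>c\<^sub>+\<close> and odd index \<open>\<kappa> = 1 - 2 k\<close>, then \<open>w = W(c\<^sub>+\<^sup>-\<^sup>1) \<psi>\<^sub>0\<close> spans the kernel of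
  \<open>W(c v\<^sup>-\<^sup>2\<^sup>k)\<close>, and since \<open>W\<^sup>0(v\<^sup>-\<^sup>1) \<psi>\<^sub>0\<close> equals \<open>- J \<psi>\<^sub>0\<close> one has \<open>PP (c v\<^sup>-\<^sup>2\<^sup>k) w = - \<sigma> w\<close>.
  So this line is the image of the complementary projection \<open>PPsign (- e) (c v\<^sup>-\<^sup>2\<^sup>k)\<close>, the
  contribution of \<open>c\<close> to the kernel of \<open>W(a) + e H(b)\<close>. With \<open>1 \<minusplus> \<sigma>\<close> in its place the
  kernel formula fails, for instance for \<open>a = v\<^sup>-\<^sup>1 f\<close>, \<open>b = v\<^sup>-\<^sup>2 f\<close>,
  \<open>f = (1 + v\<^sup>2 / 2) (1 + v\<^sup>-\<^sup>2 / 2)\<close> and \<open>e = - 1\<close>.\<close>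

definition psi_line :: "complex \<Rightarrow> complex \<Rightarrow> (real \<Rightarrow> complex) \<Rightarrow> lfun set" where
  "psi_line e \<sigma> cp = (\<lambda>u. ((1 + e * \<sigma>) / 2) *\<^sub>C W (recip cp) u) ` lfun.span {psi0}"

definition half_line_moment :: "lfun \<Rightarrow> nat \<Rightarrow> complex" where
  "half_line_moment u j = (LINT t:{0<..}|lborel. rep u t * of_real (exp (- t) * t ^ j))"

definition sum_of_sets :: "lfun set \<Rightarrow> lfun set \<Rightarrow> lfun set" where
  "sum_of_sets X Y = {x + y |x y. x \<in> X \<and> y \<in> Y}"

end

theory Submission
  imports "HOL-Probability.Levy" Defs
begin

text \<open>The kernel formula is a consequence of the algebra of symbols alone. On \<open>L\<^sup>p\<close> of the
  line the operators \<open>W0 g\<close> multiply like their symbols (\<open>W0_fmult\<close>), the reflection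
  \<open>J = flip\<close> satisfies \<open>J (W0 g) = W0 (refl_fun g) J\<close> (\<open>flip_W0\<close>), and \<open>W0 g\<close> keeps the
  functions supported on the right half-line if \<open>g\<close> is in \<open>Gplus\<close> (\<open>W0_Gplus_LpR\<close>).

  Since \<open>v\<close> is in \<open>Gplus\<close> and \<open>v(-t) = 1 / v(t)\<close>, with \<open>\<alpha> = a v\<^sup>-\<^sup>k\<close> and \<open>\<beta> = b v\<^sup>k\<close> one has
  \<open>W(a) + e H(b) = (W(\<alpha>) + e H(\<beta>)) W(v\<^sup>k)\<close>, and \<open>W(v\<^sup>-\<^sup>k)\<close> is a left inverse of \<open>W(v\<^sup>k)\<close>. So the
  kernel of \<open>W(a) + e H(b)\<close> is the image under \<open>W(v\<^sup>-\<^sup>k)\<close> of the part of the kernel of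
  \<open>W(\<alpha>) + e H(\<beta>)\<close> that lies in the range of \<open>W(v\<^sup>k)\<close> (\<open>kernel_shift\<close>). The range is described
  by moments (\<open>im_W_vpow_iff_moments\<close>): on the left half-line \<open>W0(v\<^sup>-\<^sup>1) u\<close> is a multiple of
  \<open>e\<^sup>t\<close> whose factor is the moment of \<open>u\<close> of order 0, and \<open>W0(v\<^sup>-\<^sup>1)\<close> acts on moments by a
  two-term recursion, so that one can divide by \<open>v\<close> repeatedly.

  The kernel of \<open>W(\<alpha>) + e H(\<beta>)\<close> is found as follows. For \<open>x\<close> on the half-line, \<open>x\<close> is in the
  kernel if and only if \<open>e s = J(\<alpha> x + e \<beta> J x)\<close> is again a function on the half-line. Dividing by
  \<open>\<alpha>(-t)\<close> turns this into \<open>J x + e \<gamma> x = e \<alpha>(-t)\<^sup>-\<^sup>1 s\<close>, and \<open>\<alpha>(t) \<alpha>(-t) = \<beta>(t) \<beta>(-t)\<close> forces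
  \<open>\<delta> s = e J s\<close>, which says that \<open>s\<close> is in the image of the projection of sign \<open>e\<close> for \<open>\<delta>\<close>
  (\<open>kernel_iff\<close>, \<open>im_PPsign_eq\<close>). The map \<open>phi\<close> produces one solution \<open>x\<close> for each such \<open>s\<close>
  (\<open>phi_identity\<close>), and the solutions for \<open>s = 0\<close> form the image of the projection of sign
  \<open>- e\<close> for \<open>\<gamma>\<close>. This gives the direct sum (\<open>kernel_decomposition\<close>).

  Finally the factorization of \<open>c\<close> shows that \<open>\<gamma> = c v\<^sup>-\<^sup>2\<^sup>k\<close> equals
  \<open>\<sigma> c\<^sub>+(-t)\<^sup>-\<^sup>1 v\<^sup>-\<^sup>\<kappa> c\<^sub>+\<close> with \<open>\<kappa> = 0\<close> or \<open>\<kappa> = 1\<close>. For \<open>\<kappa> = 0\<close> the equation \<open>\<gamma> z = - e J z\<close>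
  has only the solution 0, and for \<open>\<kappa> = 1\<close> it reduces to the case of \<open>v\<^sup>-\<^sup>1\<close>, where all
  solutions are multiples of \<open>psi0\<close> (\<open>im_PPsign_index_0\<close>, \<open>im_PPsign_index_1\<close>).

  The analytic part is to make \<open>W0\<close> available as a homomorphism, although it is defined by an
  arbitrary choice of an expansion of the symbol. For this a symbol is written as
  \<open>a(t) = \<integral> w(y) exp(i \<tau>(y) t) dN(y)\<close> over some \<open>\<sigma>\<close>-finite measure space, and the operator becomes
  \<open>f \<mapsto> \<integral> w(y) f(x - \<tau>(y)) dN(y)\<close>. Products of symbols then correspond to product measures, and
  composition to Fubini's theorem; that the operator depends on \<open>a\<close> only is Levy's uniqueness
  theorem for characteristic functions (\<open>represents_unique\<close>, \<open>W0_eq_conv\<close>).\<close>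

section \<open>Weighted measures are determined by their symbols\<close>

lemma cis_borel_measurable [measurable]: "cis \<in> borel_measurable borel"
  by (intro borel_measurable_continuous_onI continuous_on_cis continuous_on_id)

lemma integrable_mult_cis:
  assumes [measurable]: "integrable N w" "\<tau> \<in> borel_measurable N"
  shows "integrable N (\<lambda>x. w x * cis (\<tau> x * t))"
  by (rule Bochner_Integration.integrable_bound[OF assms(1)]) (auto simp: norm_mult)

lemma
  fixes f g :: "_ \<Rightarrow> complex"
  assumes "sigma_finite_measure N" "sigma_finite_measure N'"
    and int [measurable]: "integrable N f" "integrable N' g"
  shows integrable_prod_mult: "integrable (N \<Otimes>\<^sub>M N') (\<lambda>(x, y). f x * g y)"
    and integral_prod_mult: "(\<integral>(x, y). f x * g y \<partial>(N \<Otimes>\<^sub>M N')) = (\<integral>x. f x \<partial>N) * (\<integral>y. g y \<partial>N')"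
proof -
  interpret N: sigma_finite_measure N by fact
  interpret N': sigma_finite_measure N' by fact
  interpret pair_sigma_finite N N' ..
  show *: "integrable (N \<Otimes>\<^sub>M N') (\<lambda>(x, y). f x * g y)"
    using int by (intro Fubini_integrable) (auto simp: norm_mult)
  show "(\<integral>(x, y). f x * g y \<partial>(N \<Otimes>\<^sub>M N')) = (\<integral>x. f x \<partial>N) * (\<integral>y. g y \<partial>N')"
    by (subst integral_fst'[OF *, symmetric]) simp
qed

text \<open>The positive and the negative part of \<open>w\<close> have the same total mass, by \<open>t = 0\<close>. If it is positive, then,
  normalized by that mass and transported to the line by \<open>\<tau>\<close>, they become probability measures with the same
  characteristic function, so Levy's theorem identifies them.\<close>

lemma real_charge_eq_0:
  fixes w :: "'a \<Rightarrow> real" and f :: "real \<Rightarrow> complex"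
  assumes [measurable]: "integrable N w" "\<tau> \<in> borel_measurable N" "f \<in> borel_measurable borel"
    and zero: "\<And>t. (\<integral>x. of_real (w x) * cis (\<tau> x * t) \<partial>N) = 0"
    and int: "integrable N (\<lambda>x. of_real (w x) * f (\<tau> x))"
  shows "(\<integral>x. of_real (w x) * f (\<tau> x) \<partial>N) = 0"
proof -
  define wp wn where "wp = (\<lambda>x. max (w x) 0)" and "wn = (\<lambda>x. max (- w x) 0)"
  have wint [measurable]: "integrable N wp" "integrable N wn"
    unfolding wp_def wn_def using assms(1) by auto
  have w_eq: "w x = wp x - wn x" "wp x \<ge> 0" "wn x \<ge> 0" "wp x \<le> \<bar>w x\<bar>" "wn x \<le> \<bar>w x\<bar>" for x
    by (auto simp: wp_def wn_def)
  define m where "m = (\<integral>x. wp x \<partial>N)"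
  have "(\<integral>x. complex_of_real (w x) \<partial>N) = 0" using zero[of 0] by simp
  then have "(\<integral>x. w x \<partial>N) = 0" by simp
  then have mn: "m = (\<integral>x. wn x \<partial>N)"
    using wint by (simp add: w_eq(1) m_def)
  show ?thesis
  proof (cases "m = 0")
    case True
    have "AE x in N. wp x = 0"
      using True by (subst integral_nonneg_eq_0_iff_AE[symmetric]) (auto simp: w_eq m_def wint)
    moreover have "AE x in N. wn x = 0"
      using True mn by (subst integral_nonneg_eq_0_iff_AE[symmetric]) (auto simp: w_eq wint)
    ultimately have "AE x in N. of_real (w x) * f (\<tau> x) = 0"
      by eventually_elim (simp add: w_eq)
    then show ?thesis
      by (rule integral_eq_zero_AE)
  next
    case False
    then have m: "m > 0" by (simp add: m_def w_eq less_le)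
    have "integrable N (\<lambda>x. of_real (wp x) * f (\<tau> x))" "integrable N (\<lambda>x. of_real (wn x) * f (\<tau> x))"
      by (rule Bochner_Integration.integrable_bound[OF int]; simp add: w_eq(2-) norm_mult mult_right_mono)+
    note fint = this
    have cint: "integrable N (\<lambda>x. of_real (u x) * cis (\<tau> x * t))" if "integrable N u" for u :: "'a \<Rightarrow> real" and t
      using that by (intro integrable_mult_cis) auto
    define D where "D u = distr (density N (\<lambda>x. ennreal (u x / m))) borel \<tau>" for u
    have D_int: "(\<integral>x. h x \<partial>D u) = (\<integral>x. of_real (u x) * h (\<tau> x) \<partial>N) / m"
      if [measurable]: "h \<in> borel_measurable borel" "u \<in> borel_measurable N" and "\<And>x. u x \<ge> 0"
      for h :: "real \<Rightarrow> complex" and u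
    proof -
      have "(\<integral>x. h x \<partial>D u) = (\<integral>x. (u x / m) *\<^sub>R h (\<tau> x) \<partial>N)"
        unfolding D_def using m that(3)
        by (subst integral_distr, simp, simp, subst integral_density) auto
      also have "\<dots> = (\<integral>x. (of_real (u x) * h (\<tau> x)) / m \<partial>N)"
        by (simp add: scaleR_conv_of_real)
      finally show ?thesis by simp
    qed
    have D_dist: "real_distribution (D u)" if [measurable]: "integrable N u" and u: "\<And>x. u x \<ge> 0" "(\<integral>x. u x \<partial>N) = m" for u
    proof -
      have "emeasure (density N (\<lambda>x. ennreal (u x / m))) (space N) = (\<integral>\<^sup>+x. ennreal (u x / m) \<partial>N)"
        by (subst emeasure_density) (auto intro!: nn_integral_cong)
      also have "\<dots> = ennreal (\<integral>x. u x / m \<partial>N)"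
        using m u that by (intro nn_integral_eq_integral) auto
      also have "\<dots> = 1" using u m by simp
      finally have "prob_space (density N (\<lambda>x. ennreal (u x / m)))"
        by (intro prob_spaceI) simp
      then have "prob_space (D u)"
        unfolding D_def by (intro prob_space.prob_space_distr) auto
      then show ?thesis
        unfolding real_distribution_def real_distribution_axioms_def by (simp add: D_def)
    qed
    have "D wp = D wn"
    proof (rule Levy_uniqueness)
      show "real_distribution (D wp)" "real_distribution (D wn)"
        using mn by (auto intro!: D_dist simp: w_eq m_def wint)
      show "char (D wp) = char (D wn)"
      proof
        fix t
        have "(\<integral>x. of_real (wp x) * cis (\<tau> x * t) \<partial>N) - (\<integral>x. of_real (wn x) * cis (\<tau> x * t) \<partial>N) = 0"
          using zero[of t]
          unfolding Bochner_Integration.integral_diff[OF cint[OF wint(1)] cint[OF wint(2)], symmetric]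
          by (simp add: w_eq(1) algebra_simps)
        then have "(\<integral>x. of_real (wp x) * cis (\<tau> x * t) \<partial>N) = (\<integral>x. of_real (wn x) * cis (\<tau> x * t) \<partial>N)" by simp
        then show "char (D wp) t = char (D wn) t"
          unfolding char_def
            using D_int[of "\<lambda>x. cis (x * t)" wp] D_int[of "\<lambda>x. cis (x * t)" wn]
            by (simp add: w_eq(2,3) cis_conv_exp mult_ac)
      qed
    qed
    then have "(\<integral>x. f x \<partial>D wp) = (\<integral>x. f x \<partial>D wn)" by simp
    then have "(\<integral>x. of_real (wp x) * f (\<tau> x) \<partial>N) = (\<integral>x. of_real (wn x) * f (\<tau> x) \<partial>N)"
      using m D_int[of f wp] D_int[of f wn] by (simp add: w_eq(2,3))
    moreover have "(\<integral>x. of_real (w x) * f (\<tau> x) \<partial>N)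
      = (\<integral>x. of_real (wp x) * f (\<tau> x) \<partial>N) - (\<integral>x. of_real (wn x) * f (\<tau> x) \<partial>N)"
      by (subst Bochner_Integration.integral_diff[symmetric, OF fint]) (simp add: w_eq algebra_simps)
    ultimately show ?thesis by simp
  qed
qed

text \<open>Conjugation turns \<open>w\<close> into a weight whose transform at \<open>t\<close> is the conjugate of the transform of
  \<open>w\<close> at \<open>- t\<close>. So the real and the imaginary part of \<open>w\<close> have vanishing transforms as well.\<close>

lemma charge_eq_0:
  fixes w :: "'a \<Rightarrow> complex" and f :: "real \<Rightarrow> complex"
  assumes w [measurable]: "integrable N w" and [measurable]: "\<tau> \<in> borel_measurable N" "f \<in> borel_measurable borel"
    and zero: "\<And>t. (\<integral>x. w x * cis (\<tau> x * t) \<partial>N) = 0"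
    and int: "integrable N (\<lambda>x. w x * f (\<tau> x))"
  shows "(\<integral>x. w x * f (\<tau> x) \<partial>N) = 0"
proof -
  have wint [measurable]: "integrable N (\<lambda>x. Re (w x))" "integrable N (\<lambda>x. Im (w x))"
    using w by auto
  have re: "of_real (Re z) * u = (z * u + cnj (z * cnj u)) / 2"
    and im: "of_real (Im z) * u = (z * u - cnj (z * cnj u)) / (2 * \<i>)" for z u
    by (auto simp: complex_eq_iff Re_divide Im_divide algebra_simps power2_eq_square)
  have cint: "integrable N (\<lambda>x. w x * cis (\<tau> x * t))" for t
    by (rule integrable_mult_cis[OF w]) auto
  have zero': "(\<integral>x. cnj (w x * cnj (cis (\<tau> x * t))) \<partial>N) = 0" for t
    using zero[of "-t"]
      Bochner_Integration.integral_bounded_linear[OF bounded_linear_cnj cint[of "-t"]]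
    by (simp add: cis_cnj del: complex_cnj_mult)
  have cint': "integrable N (\<lambda>x. cnj (w x * cnj (cis (\<tau> x * t))))" for t
    using cint[of "-t"] by (simp add: cis_cnj del: complex_cnj_mult)
  have R: "(\<integral>x. of_real (Re (w x)) * f (\<tau> x) \<partial>N) = 0"
  proof (rule real_charge_eq_0)
    show "(\<integral>x. of_real (Re (w x)) * cis (\<tau> x * t) \<partial>N) = 0" for t
      unfolding re using Bochner_Integration.integral_add[OF cint[of t] cint'[of t]] zero[of t] zero'[of t]
      by simp
    show "integrable N (\<lambda>x. complex_of_real (Re (w x)) * f (\<tau> x))"
      by (rule Bochner_Integration.integrable_bound[OF int]) (auto simp: norm_mult abs_Re_le_cmod mult_right_mono)
  qed (auto simp: wint)
  have I: "(\<integral>x. of_real (Im (w x)) * f (\<tau> x) \<partial>N) = 0"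
  proof (rule real_charge_eq_0)
    show "(\<integral>x. of_real (Im (w x)) * cis (\<tau> x * t) \<partial>N) = 0" for t
      unfolding im using Bochner_Integration.integral_diff[OF cint[of t] cint'[of t]] zero[of t] zero'[of t]
      by simp
    show "integrable N (\<lambda>x. complex_of_real (Im (w x)) * f (\<tau> x))"
      by (rule Bochner_Integration.integrable_bound[OF int]) (auto simp: norm_mult abs_Im_le_cmod mult_right_mono)
  qed (auto simp: wint)
  have ii: "integrable N (\<lambda>x. complex_of_real (Re (w x)) * f (\<tau> x))"
      "integrable N (\<lambda>x. complex_of_real (Im (w x)) * f (\<tau> x))"
      by (rule Bochner_Integration.integrable_bound[OF int];
          auto simp: norm_mult abs_Re_le_cmod abs_Im_le_cmod mult_right_mono)+
  have "(\<integral>x. w x * f (\<tau> x) \<partial>N) = (\<integral>x. of_real (Re (w x)) * f (\<tau> x) + \<i> * (of_real (Im (w x)) * f (\<tau> x)) \<partial>N)"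
    by (intro Bochner_Integration.integral_cong refl) (simp add: complex_eq_iff algebra_simps)
  then show ?thesis
    using ii R I by simp
qed

text \<open>The pair \<open>(\<tau>, w)\<close> encodes the complex measure on the line that is the image of \<open>w dN\<close> under
  \<open>\<tau>\<close>, and \<open>a\<close> is its Fourier transform. An arbitrary space in place of the line makes products of
  symbols correspond to product spaces. The function \<open>q\<close> makes it possible to pull an integral over
  \<open>N\<close> back to a product of \<open>N\<close> with another space; it excludes the zero measure.\<close>

definition represents ::
  "'a measure \<Rightarrow> ('a \<Rightarrow> real) \<Rightarrow> ('a \<Rightarrow> complex) \<Rightarrow> (real \<Rightarrow> complex) \<Rightarrow> bool" where
  "represents N \<tau> w a \<longleftrightarrow>
     sigma_finite_measure N \<and> \<tau> \<in> borel_measurable N \<and> integrable N w \<and>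
     (\<exists>q :: 'a \<Rightarrow> complex. integrable N q \<and> (\<integral>x. q x \<partial>N) = 1) \<and>
     (\<forall>t. a t = (\<integral>x. w x * cis (\<tau> x * t) \<partial>N))"

lemma representsD:
  assumes "represents N \<tau> w a"
  shows "sigma_finite_measure N" "\<tau> \<in> borel_measurable N" "integrable N w"
    "a t = (\<integral>x. w x * cis (\<tau> x * t) \<partial>N)"
  using assms unfolding represents_def by auto

text \<open>Two representations of \<open>a\<close> are joined into one of the symbol 0, on the disjoint union of two
  copies of \<open>N \<times> N'\<close>: the first copy carries \<open>w\<close>, the second \<open>- w'\<close>, and each is multiplied by a
  function of integral 1 in the variable that it does not involve.\<close>

theorem represents_unique:
  fixes f :: "real \<Rightarrow> complex"
  assumes N: "represents N \<tau> w a" and N': "represents N' \<tau>' w' a"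
    and [measurable]: "f \<in> borel_measurable borel"
    and f: "integrable N (\<lambda>x. w x * f (\<tau> x))" and f': "integrable N' (\<lambda>x. w' x * f (\<tau>' x))"
  shows "(\<integral>x. w x * f (\<tau> x) \<partial>N) = (\<integral>x. w' x * f (\<tau>' x) \<partial>N')"
proof -
  note [measurable] = representsD(2,3)[OF N] representsD(2,3)[OF N']
  obtain q where q[measurable]: "integrable N q" "(\<integral>x. q x \<partial>N) = (1 :: complex)"
    using N unfolding represents_def by blast
  obtain q' where q'[measurable]: "integrable N' q'" "(\<integral>x. q' x \<partial>N') = (1 :: complex)"
    using N' unfolding represents_def by blast
  interpret N: sigma_finite_measure N by (rule representsD[OF N])
  interpret N': sigma_finite_measure N' by (rule representsD[OF N'])
  interpret NN: pair_sigma_finite N N' ..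
  interpret B: sigma_finite_measure "count_space (UNIV :: bool set)"
    by (rule sigma_finite_measure_count_space_countable) auto
  interpret BNN: pair_sigma_finite "count_space (UNIV :: bool set)" "N \<Otimes>\<^sub>M N'" ..
  define K where "K = count_space (UNIV :: bool set) \<Otimes>\<^sub>M (N \<Otimes>\<^sub>M N')"
  define \<theta> where "\<theta> = (\<lambda>(b, x, y). if b then \<tau> x else \<tau>' y)"
  define \<omega> where "\<omega> = (\<lambda>(b, x, y). if b then w x * q' y else - (q x * w' y))"
  have \<theta>[measurable]: "\<theta> \<in> borel_measurable K"
    unfolding \<theta>_def K_def by (rule measurable_pair_measure_countable1) auto
  have [measurable]: "\<omega> \<in> borel_measurable K"
    unfolding \<omega>_def K_def by (rule measurable_pair_measure_countable1) auto
  have key: "integrable K (\<lambda>z. \<omega> z * h (\<theta> z)) \<and>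
     (\<integral>z. \<omega> z * h (\<theta> z) \<partial>K) = (\<integral>x. w x * h (\<tau> x) \<partial>N) - (\<integral>x. w' x * h (\<tau>' x) \<partial>N')"
    if h[measurable]: "h \<in> borel_measurable borel" and
      i: "integrable N (\<lambda>x. w x * h (\<tau> x))" "integrable N' (\<lambda>x. w' x * h (\<tau>' x))" for h
  proof -
    let ?A = "\<lambda>(x, y). (w x * h (\<tau> x)) * q' y" and ?B = "\<lambda>(x, y). q x * (w' y * h (\<tau>' y))"
    note sf = N.sigma_finite_measure_axioms N'.sigma_finite_measure_axioms
    note A = integrable_prod_mult[OF sf i(1) q'(1)] integral_prod_mult[OF sf i(1) q'(1)]
    note B = integrable_prod_mult[OF sf q(1) i(2)] integral_prod_mult[OF sf q(1) i(2)]
    have eq: "(\<lambda>y. \<omega> (b, y) * h (\<theta> (b, y))) = (if b then ?A else (\<lambda>z. - ?B z))" for b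
      by (auto simp: \<omega>_def \<theta>_def fun_eq_iff)
    have int: "integrable K (\<lambda>z. \<omega> z * h (\<theta> z))"
      unfolding K_def
    proof (rule BNN.Fubini_integrable)
      show "(\<lambda>z. \<omega> z * h (\<theta> z)) \<in> borel_measurable (count_space UNIV \<Otimes>\<^sub>M (N \<Otimes>\<^sub>M N'))"
        unfolding K_def[symmetric] by measurable
      show "integrable (count_space UNIV) (\<lambda>x. \<integral>y. norm (\<omega> (x, y) * h (\<theta> (x, y))) \<partial>(N \<Otimes>\<^sub>M N'))"
        by (rule integrable_count_space) auto
      show "AE x in count_space UNIV. integrable (N \<Otimes>\<^sub>M N') (\<lambda>y. \<omega> (x, y) * h (\<theta> (x, y)))"
        unfolding eq using A B by (auto simp: AE_count_space)
    qed
    have "(\<integral>z. \<omega> z * h (\<theta> z) \<partial>K) = (\<integral>b. (\<integral>y. \<omega> (b, y) * h (\<theta> (b, y)) \<partial>(N \<Otimes>\<^sub>M N')) \<partial>count_space UNIV)"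
      unfolding K_def by (rule BNN.integral_fst'[symmetric, OF int[unfolded K_def]])
    also have "\<dots> = (\<integral>y. ?A y \<partial>(N \<Otimes>\<^sub>M N')) - (\<integral>y. ?B y \<partial>(N \<Otimes>\<^sub>M N'))"
      unfolding eq by (subst lebesgue_integral_count_space_finite) (auto simp: UNIV_bool)
    finally show ?thesis using int A B q q' by simp
  qed
  have c: "integrable N (\<lambda>x. w x * cis (\<tau> x * t))" "integrable N' (\<lambda>x. w' x * cis (\<tau>' x * t))" for t
    using N N' by (auto intro!: integrable_mult_cis dest: representsD)
  have "(\<integral>z. \<omega> z * f (\<theta> z) \<partial>K) = 0"
  proof (rule charge_eq_0)
    show "integrable K \<omega>" using key[of "\<lambda>_. 1"] by (simp add: representsD(3)[OF N] representsD(3)[OF N'])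
    show "(\<integral>z. \<omega> z * cis (\<theta> z * t) \<partial>K) = 0" for t
      using key[of "\<lambda>s. cis (s * t)"] c representsD(4)[OF N, of t] representsD(4)[OF N', of t] by simp
    show "integrable K (\<lambda>x. \<omega> x * f (\<theta> x))" using key[of f] f f' by simp
  qed auto
  then show ?thesis using key[of f] f f' by simp
qed

section \<open>Convolution with a weighted measure\<close>

definition conv ::
  "'a measure \<Rightarrow> ('a \<Rightarrow> real) \<Rightarrow> ('a \<Rightarrow> complex) \<Rightarrow> (real \<Rightarrow> complex) \<Rightarrow> real \<Rightarrow> complex" where
  "conv N \<tau> w f x = (\<integral>y. w y * f (x - \<tau> y) \<partial>N)"

lemma integrable_shifted_product:
  fixes w :: "_ \<Rightarrow> complex" and h :: "real \<Rightarrow> complex"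
  assumes N: "sigma_finite_measure N" and [measurable]: "\<tau> \<in> borel_measurable N"
    and w [measurable]: "integrable N w" and h [measurable]: "integrable lborel h"
  shows "integrable (lborel \<Otimes>\<^sub>M N) (\<lambda>(x, y). w y * h (x - \<tau> y))"
proof -
  interpret N: sigma_finite_measure N by fact
  interpret NL: pair_sigma_finite N "lborel :: real measure" ..
  have shift: "integrable lborel (\<lambda>x. h (x - s))" for s
    using lborel_integrable_real_affine[OF h, of 1 "-s"] by simp
  have shiftn: "(\<integral>x. cmod (h (x - s)) \<partial>lborel) = (\<integral>x. cmod (h x) \<partial>lborel)" for s
    using lborel_integral_real_affine[of 1 "\<lambda>x. cmod (h x)" "-s"] by simp
  have "integrable (N \<Otimes>\<^sub>M lborel) (\<lambda>(y, x). w y * h (x - \<tau> y))"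
  proof (rule NL.Fubini_integrable)
    show "(\<lambda>(y, x). w y * h (x - \<tau> y)) \<in> borel_measurable (N \<Otimes>\<^sub>M lborel)" by measurable
    show "integrable N (\<lambda>y. \<integral>x. norm (case (y, x) of (y, x) \<Rightarrow> w y * h (x - \<tau> y)) \<partial>lborel)"
      using w by (simp add: norm_mult shiftn)
    show "AE y in N. integrable lborel (\<lambda>x. case (y, x) of (y, x) \<Rightarrow> w y * h (x - \<tau> y))"
      using shift by simp
  qed
  from NL.integrable_product_swap[OF this] show ?thesis
    by simp
qed

lemma conv_measurable [measurable]:
  assumes N: "sigma_finite_measure N" and [measurable]: "\<tau> \<in> borel_measurable N"
    "w \<in> borel_measurable N" "f \<in> borel_measurable borel"
  shows "conv N \<tau> w f \<in> borel_measurable borel"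
proof -
  interpret N: sigma_finite_measure N by fact
  show ?thesis unfolding conv_def by measurable
qed

text \<open>The tangent of the convex function \<open>x powr p\<close> at 1 lies below the graph.\<close>

lemma powr_tangent:
  fixes x p :: real
  assumes "x \<ge> 0" "p \<ge> 1"
  shows "1 + p * (x - 1) \<le> x powr p"
proof (cases "x = 0")
  case False
  then have "x \<le> 1 / p * x powr p + (1 - 1 / p) * 1"
    using Youngs_inequality_0[of "1/p" "1 - 1/p" "x powr p" 1] assms by (simp add: powr_powr)
  then have "p * x \<le> p * (1 / p * x powr p + (1 - 1 / p) * 1)"
    using assms by (intro mult_left_mono) auto
  then show ?thesis using assms by (simp add: algebra_simps)
qed (use assms in auto)

text \<open>Jensen's inequality for \<open>x powr p\<close> and the weight \<open>g\<close>, which need not have mass 1. Proof: integrate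
  the tangent inequality at the weighted mean \<open>c\<close> of \<open>h\<close>.\<close>

lemma weighted_power_mean:
  fixes g h :: "'a \<Rightarrow> real"
  assumes p: "p \<ge> 1" and pos: "\<And>x. g x \<ge> 0" "\<And>x. h x \<ge> 0"
    and int: "integrable N g" "integrable N (\<lambda>x. g x * h x)" "integrable N (\<lambda>x. g x * h x powr p)"
  shows "(\<integral>x. g x * h x \<partial>N) powr p \<le> (\<integral>x. g x \<partial>N) powr (p - 1) * (\<integral>x. g x * h x powr p \<partial>N)"
proof -
  define m A B where "m = (\<integral>x. g x \<partial>N)" and "A = (\<integral>x. g x * h x \<partial>N)" and "B = (\<integral>x. g x * h x powr p \<partial>N)"
  have nn: "m \<ge> 0" "A \<ge> 0" "B \<ge> 0"
    unfolding m_def A_def B_def by (auto intro!: integral_nonneg_AE simp: pos)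
  show ?thesis
  proof (cases "A = 0")
    case True
    then show ?thesis using nn by (simp add: A_def[symmetric] B_def[symmetric])
  next
    case False
    have "m \<noteq> 0"
    proof
      assume "m = 0"
      then have "AE x in N. g x = 0"
        using int pos by (subst integral_nonneg_eq_0_iff_AE[symmetric]) (auto simp: m_def)
      then have "A = 0" unfolding A_def by (intro integral_eq_zero_AE) auto
      then show False using False by simp
    qed
    then have m: "m > 0" and A: "A > 0" using False nn by auto
    \<comment> \<open>the point of tangency is the mean of h\<close>
    define c where "c = A / m"
    have c: "c > 0" using m A by (simp add: c_def)
    have tang: "c powr p * (g x + p * (g x * h x / c - g x)) \<le> g x * h x powr p" for x
    proof -
      have "c powr p * (1 + p * (h x / c - 1)) \<le> c powr p * (h x / c) powr p"
        using c p pos by (intro mult_left_mono powr_tangent) auto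
      also have "\<dots> = h x powr p" using c pos by (simp add: powr_divide)
      finally have "g x * (c powr p * (1 + p * (h x / c - 1))) \<le> g x * h x powr p"
        using pos by (intro mult_left_mono) auto
      then show ?thesis by (simp add: algebra_simps)
    qed
    \<comment> \<open>the linear term vanishes since c is the mean\<close>
    have "(\<integral>x. c powr p * (g x + p * (g x * h x / c - g x)) \<partial>N) \<le> B"
      unfolding B_def using int by (intro integral_mono tang) auto
    also have "(\<integral>x. c powr p * (g x + p * (g x * h x / c - g x)) \<partial>N) = c powr p * (m + p * (A / c - m))"
      using int by (simp add: m_def A_def)
    also have "\<dots> = c powr p * m" using m A by (simp add: c_def)
    finally have "c powr p * m \<le> B" .
    then have "m powr (p - 1) * (c powr p * m) \<le> m powr (p - 1) * B" by (intro mult_left_mono) auto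
    moreover have "m powr (p - 1) * (c powr p * m) = A powr p"
      using m A by (simp add: c_def powr_divide powr_diff)
    ultimately show ?thesis by (simp add: m_def A_def B_def)
  qed
qed

lemma le_one_plus_powr: "x \<ge> 0 \<Longrightarrow> p \<ge> 1 \<Longrightarrow> x \<le> 1 + x powr p" for x p :: real
  using powr_mono[of 1 p x] by (cases "x \<le> 1") (auto simp: add_increasing2)

text \<open>By Tonelli's theorem the integral of \<open>cmod (w y) * cmod (f (x - \<tau> y)) powr p\<close> over \<open>y\<close> is finite
  for almost every \<open>x\<close> and integrable in \<open>x\<close>. It dominates the convolution integral because
  \<open>r \<le> 1 + r powr p\<close>, and by Jensen's inequality also the \<open>p\<close>-th power of the convolution.\<close>

lemma
  fixes w :: "_ \<Rightarrow> complex" and f :: "real \<Rightarrow> complex"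
  assumes N: "sigma_finite_measure N" and [measurable]: "\<tau> \<in> borel_measurable N"
    and w [measurable]: "integrable N w" and f [measurable]: "f \<in> borel_measurable borel"
    and p: "p \<ge> 1" and fp: "integrable lborel (\<lambda>x. cmod (f x) powr p)"
  shows conv_AE_integrable: "AE x in lborel. integrable N (\<lambda>y. w y * f (x - \<tau> y))"
    and integrable_conv_powr: "integrable lborel (\<lambda>x. cmod (conv N \<tau> w f x) powr p)"
proof -
  interpret N: sigma_finite_measure N by fact
  interpret LN: pair_sigma_finite "lborel :: real measure" N ..
  let ?F = "\<lambda>(x, y). of_real (cmod (w y)) * complex_of_real (cmod (f (x - \<tau> y)) powr p)"
  have "integrable (lborel \<Otimes>\<^sub>M N) ?F"
    using w fp by (intro integrable_shifted_product[OF N]) auto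
  from integrable_norm[OF this] have I: "integrable (lborel \<Otimes>\<^sub>M N) (\<lambda>(x, y). cmod (w y) * cmod (f (x - \<tau> y)) powr p)"
    by (simp add: case_prod_beta' norm_mult)
  have wn: "integrable N (\<lambda>y. cmod (w y))" using w by simp
  have aeI: "AE x in lborel. integrable N (\<lambda>y. cmod (w y) * cmod (f (x - \<tau> y)) powr p)"
    using LN.AE_integrable_fst'[OF I] by simp
  have *: "integrable N (\<lambda>y. w y * f (x - \<tau> y))"
    if "integrable N (\<lambda>y. cmod (w y) * cmod (f (x - \<tau> y)) powr p)" for x
  proof (rule Bochner_Integration.integrable_bound[OF Bochner_Integration.integrable_add[OF wn that]])
    show "AE y in N. norm (w y * f (x - \<tau> y)) \<le> norm (cmod (w y) + cmod (w y) * cmod (f (x - \<tau> y)) powr p)"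
    proof (rule AE_I2)
      fix y
      have "cmod (w y) * cmod (f (x - \<tau> y)) \<le> cmod (w y) * (1 + cmod (f (x - \<tau> y)) powr p)"
        using p by (intro mult_left_mono le_one_plus_powr) auto
      then show "norm (w y * f (x - \<tau> y)) \<le> norm (cmod (w y) + cmod (w y) * cmod (f (x - \<tau> y)) powr p)"
        by (simp add: norm_mult algebra_simps)
    qed
  qed auto
  show "AE x in lborel. integrable N (\<lambda>y. w y * f (x - \<tau> y))"
    using aeI by eventually_elim (rule *)
  define C where "C = (\<integral>y. cmod (w y) \<partial>N) powr (p - 1)"
  have [measurable]: "conv N \<tau> w f \<in> borel_measurable borel" by (rule conv_measurable[OF N]) auto
  have Iint: "integrable lborel (\<lambda>x. C * (\<integral>y. cmod (w y) * cmod (f (x - \<tau> y)) powr p \<partial>N))"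
    using LN.integrable_fst'[OF I] by simp
  show "integrable lborel (\<lambda>x. cmod (conv N \<tau> w f x) powr p)"
  proof (rule Bochner_Integration.integrable_bound[OF Iint])
    show "AE x in lborel. norm (cmod (conv N \<tau> w f x) powr p)
         \<le> norm (C * (\<integral>y. cmod (w y) * cmod (f (x - \<tau> y)) powr p \<partial>N))"
      using aeI
    proof eventually_elim
      case (elim x)
      have i: "integrable N (\<lambda>y. cmod (w y) * cmod (f (x - \<tau> y)))"
        using integrable_norm[OF *[OF elim]] by (simp add: norm_mult)
      have "cmod (conv N \<tau> w f x) \<le> (\<integral>y. cmod (w y) * cmod (f (x - \<tau> y)) \<partial>N)"
        unfolding conv_def using integral_norm_bound[of N "\<lambda>y. w y * f (x - \<tau> y)"] by (simp add: norm_mult)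
      then have "cmod (conv N \<tau> w f x) powr p \<le> (\<integral>y. cmod (w y) * cmod (f (x - \<tau> y)) \<partial>N) powr p"
        using p by (intro powr_mono2) auto
      also have "\<dots> \<le> C * (\<integral>y. cmod (w y) * cmod (f (x - \<tau> y)) powr p \<partial>N)"
        unfolding C_def using wn i elim p by (intro weighted_power_mean) auto
      finally show ?case by simp
    qed
  qed auto
qed

lemma AE_shift:
  fixes P :: "real \<Rightarrow> bool"
  assumes [measurable]: "Measurable.pred borel P" and P: "AE x in lborel. P x"
  shows "AE x in lborel. P (x - s)"
  using AE_borel_affine[of 1 P "-s"] assms by simp

text \<open>The exceptional set may fail to be measurable, so a null set that contains it is reflected.\<close>

lemma AE_reflect:
  fixes P :: "real \<Rightarrow> bool"
  assumes "AE x in lborel. P x"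
  shows "AE x in lborel. P (- x)"
proof -
  obtain N where N: "{x. \<not> P x} \<subseteq> N" "N \<in> null_sets lborel"
    using assms by (auto elim!: AE_E simp: null_sets_def)
  then have [measurable]: "N \<in> sets borel" by auto
  have "AE x in lborel. 0 + (-1) * x \<notin> N"
    by (rule AE_borel_affine) (use N in \<open>auto intro: AE_not_in\<close>)
  then show ?thesis
    by eventually_elim (use N in auto)
qed

text \<open>Each translate of a null set is a null set, so by Fubini's theorem for almost every \<open>x\<close> the
  integrands agree almost everywhere. Hence convolution is well defined on classes of functions.\<close>

lemma conv_cong_AE:
  assumes N: "sigma_finite_measure N" and [measurable]: "\<tau> \<in> borel_measurable N"
    "w \<in> borel_measurable N" "f \<in> borel_measurable borel" "g \<in> borel_measurable borel"
    and ae: "AE x in lborel. f x = g x"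
  shows "AE x in lborel. conv N \<tau> w f x = conv N \<tau> w g x"
proof -
  interpret N: sigma_finite_measure N by fact
  interpret LN: pair_sigma_finite "lborel :: real measure" N ..
  have "AE y in N. AE x in lborel. f (x - \<tau> y) = g (x - \<tau> y)"
    by (intro AE_I2 AE_shift[OF _ ae]) auto
  then have "AE x in lborel. AE y in N. f (x - \<tau> y) = g (x - \<tau> y)"
    by (subst LN.AE_commute) (auto intro!: borel_measurable_eq simp del: sets_lborel)
  then show ?thesis
  proof eventually_elim
    case (elim x)
    show ?case unfolding conv_def
      by (rule integral_cong_AE) (use elim in \<open>auto\<close>)
  qed
qed

lemma represents_mult:
  assumes N: "represents N \<tau> w a" and N': "represents N' \<tau>' w' b"
  shows "represents (N \<Otimes>\<^sub>M N') (\<lambda>(x, y). \<tau> x + \<tau>' y) (\<lambda>(x, y). w x * w' y) (\<lambda>t. a t * b t)"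
proof -
  note R = representsD[OF N] and R' = representsD[OF N']
  note [measurable] = R(2,3) R'(2,3)
  interpret N: sigma_finite_measure N by (rule R)
  interpret N': sigma_finite_measure N' by (rule R')
  interpret NN: pair_sigma_finite N N' ..
  note sf = R(1) R'(1)
  obtain q where q[measurable]: "integrable N q" "(\<integral>x. q x \<partial>N) = (1 :: complex)"
    using N unfolding represents_def by blast
  obtain q' where q'[measurable]: "integrable N' q'" "(\<integral>x. q' x \<partial>N') = (1 :: complex)"
    using N' unfolding represents_def by blast
  have c: "integrable N (\<lambda>x. w x * cis (\<tau> x * t))" "integrable N' (\<lambda>x. w' x * cis (\<tau>' x * t))" for t
    using R R' by (auto intro!: integrable_mult_cis)
  show ?thesis unfolding represents_def
  proof (intro conjI allI)
    show "sigma_finite_measure (N \<Otimes>\<^sub>M N')" ..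
    show "(\<lambda>(x, y). \<tau> x + \<tau>' y) \<in> borel_measurable (N \<Otimes>\<^sub>M N')" by measurable
    show "integrable (N \<Otimes>\<^sub>M N') (\<lambda>(x, y). w x * w' y)" by (rule integrable_prod_mult[OF sf R(3) R'(3)])
    show "\<exists>q :: 'a \<times> 'b \<Rightarrow> complex. integrable (N \<Otimes>\<^sub>M N') q \<and> integral\<^sup>L (N \<Otimes>\<^sub>M N') q = 1"
      using integrable_prod_mult[OF sf q(1) q'(1)] integral_prod_mult[OF sf q(1) q'(1)] q q'
      by (metis mult_1)
    show "a t * b t = (\<integral>x. (case x of (x, y) \<Rightarrow> w x * w' y) * cis ((case x of (x, y) \<Rightarrow> \<tau> x + \<tau>' y) * t) \<partial>(N \<Otimes>\<^sub>M N'))" for t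
      unfolding R R' integral_prod_mult[OF sf c, symmetric]
      by (intro Bochner_Integration.integral_cong refl) (auto simp: distrib_right cis_mult[symmetric])
  qed
qed

lemma conv_conv:
  assumes N: "represents N \<tau> w a" and N': "represents N' \<tau>' w' b"
    and [measurable]: "f \<in> borel_measurable borel"
    and p: "p \<ge> 1" and fp: "integrable lborel (\<lambda>x. cmod (f x) powr p)"
  shows "AE x in lborel. conv (N \<Otimes>\<^sub>M N') (\<lambda>(x, y). \<tau> x + \<tau>' y) (\<lambda>(x, y). w x * w' y) f x =
            conv N \<tau> w (conv N' \<tau>' w' f) x"
proof -
  note R = representsD[OF N] and R' = representsD[OF N']
  interpret N: sigma_finite_measure N by (rule R)
  interpret N': sigma_finite_measure N' by (rule R')
  interpret NN: pair_sigma_finite N N' ..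
  note RR = representsD(1-3)[OF represents_mult[OF N N']]
  from conv_AE_integrable[OF RR _ p fp]
  have "AE x in lborel. integrable (N \<Otimes>\<^sub>M N') (\<lambda>y. (case y of (x, y) \<Rightarrow> w x * w' y) * f (x - (case y of (x, y) \<Rightarrow> \<tau> x + \<tau>' y)))"
    by simp
  then show ?thesis
  proof eventually_elim
    case (elim x)
    have "conv (N \<Otimes>\<^sub>M N') (\<lambda>(x, y). \<tau> x + \<tau>' y) (\<lambda>(x, y). w x * w' y) f x
      = (\<integral>y. (\<integral>z. w y * (w' z * f (x - \<tau> y - \<tau>' z)) \<partial>N') \<partial>N)"
      unfolding conv_def by (subst NN.integral_fst'[OF elim, symmetric]) (simp add: mult_ac algebra_simps)
    then show ?case unfolding conv_def by simp
  qed
qed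

text \<open>The convolution theorem. It shows that the Fourier transforms of integrable functions absorb
  multiplication by any represented symbol.\<close>

lemma
  assumes N: "represents N \<tau> w a" and r [measurable]: "integrable lborel r"
  shows integrable_conv: "integrable lborel (conv N \<tau> w r)"
    and fourier_conv: "(\<integral>x. conv N \<tau> w r x * cis (x * t) \<partial>lborel) = a t * (\<integral>s. r s * cis (s * t) \<partial>lborel)"
proof -
  note R = representsD[OF N]
  note [measurable] = R(2,3)
  interpret N: sigma_finite_measure N by (rule R)
  interpret LN: pair_sigma_finite "lborel :: real measure" N ..
  have I: "integrable (lborel \<Otimes>\<^sub>M N) (\<lambda>(x, y). w y * r (x - \<tau> y))"
    by (rule integrable_shifted_product[OF R(1-3) r])
  show "integrable lborel (conv N \<tau> w r)"
    using LN.integrable_fst'[OF I] by (simp add: conv_def[abs_def])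
  have I': "integrable (lborel \<Otimes>\<^sub>M N) (\<lambda>(x, y). w y * r (x - \<tau> y) * cis (x * t))"
    by (rule Bochner_Integration.integrable_bound[OF I]) (auto simp: norm_mult)
  have "(\<integral>x. conv N \<tau> w r x * cis (x * t) \<partial>lborel) = (\<integral>x. (\<integral>y. w y * r (x - \<tau> y) * cis (x * t) \<partial>N) \<partial>lborel)"
    unfolding conv_def by simp
  also have "\<dots> = (\<integral>y. (\<integral>x. w y * r (x - \<tau> y) * cis (x * t) \<partial>lborel) \<partial>N)"
    by (rule LN.Fubini_integral[symmetric]) (use I' in simp)
  also have "\<dots> = (\<integral>y. w y * cis (\<tau> y * t) * (\<integral>s. r s * cis (s * t) \<partial>lborel) \<partial>N)"
  proof (rule Bochner_Integration.integral_cong[OF refl])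
    fix y
    have "(\<integral>x. w y * r (x - \<tau> y) * cis (x * t) \<partial>lborel) = (\<integral>x. w y * cis (\<tau> y * t) * (r x * cis (x * t)) \<partial>lborel)"
      by (subst lborel_integral_real_affine[of 1 _ "\<tau> y"])
        (auto simp: algebra_simps cis_mult intro!: Bochner_Integration.integral_cong)
    then show "(\<integral>x. w y * r (x - \<tau> y) * cis (x * t) \<partial>lborel) = w y * cis (\<tau> y * t) * (\<integral>s. r s * cis (s * t) \<partial>lborel)"
      by simp
  qed
  also have "\<dots> = a t * (\<integral>s. r s * cis (s * t) \<partial>lborel)"
    by (simp add: R(4))
  finally show "(\<integral>x. conv N \<tau> w r x * cis (x * t) \<partial>lborel) = a t * (\<integral>s. r s * cis (s * t) \<partial>lborel)" .
qed

section \<open>Expansions as weighted measures, and products in the algebra\<close>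

lemma integrable_count_space_iff_summable:
  "integrable (count_space A) (f :: 'i \<Rightarrow> complex) \<longleftrightarrow> (\<lambda>i. cmod (f i)) summable_on A"
  using abs_summable_equivalent[of f A] unfolding abs_summable_on_def by simp

lemma integral_count_space_eq_infsum:
  "(\<integral>i. f i \<partial>count_space A) = infsum (f :: 'i \<Rightarrow> complex) A"
proof (cases "integrable (count_space A) f")
  case True
  then show ?thesis
    using infsetsum_infsum[of f A] by (simp add: infsetsum_def abs_summable_on_def)
next
  case False
  then show ?thesis
    using summable_on_iff_abs_summable_on_complex[of f A]
    by (simp add: not_integrable_integral_eq integrable_count_space_iff_summable infsum_not_exists)
qed

lemma sigma_finite_count_space: "sigma_finite_measure (count_space (UNIV :: 'i :: countable set))"
  by (rule sigma_finite_measure_count_space_countable) auto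

text \<open>One space serves all expansions. The fibre over \<open>None\<close> is the line with the density \<open>r\<close>. The fibre
  over \<open>Some j\<close> carries the point mass \<open>\<alpha> j\<close> at \<open>\<delta> j\<close>, spread over the unit interval on which the
  shift is constant; so no atoms are needed and the space is a product.\<close>

definition expansion_space :: "(int option \<times> real) measure" where
  "expansion_space = count_space UNIV \<Otimes>\<^sub>M lborel"

definition expansion_shift :: "(int \<Rightarrow> real) \<Rightarrow> int option \<times> real \<Rightarrow> real" where
  "expansion_shift \<delta> = (\<lambda>(j, s). case j of None \<Rightarrow> s | Some i \<Rightarrow> \<delta> i)"

definition expansion_weight :: "(int \<Rightarrow> complex) \<Rightarrow> (real \<Rightarrow> complex) \<Rightarrow> int option \<times> real \<Rightarrow> complex" where
  "expansion_weight \<alpha> r = (\<lambda>(j, s). case j of None \<Rightarrow> r s | Some i \<Rightarrow> \<alpha> i * indicator {0..1} s)"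

lemma infsum_option:
  fixes f :: "'i option \<Rightarrow> complex"
  assumes "(\<lambda>i. f (Some i)) summable_on UNIV"
  shows "infsum f UNIV = f None + infsum (\<lambda>i. f (Some i)) UNIV"
proof -
  have "infsum f UNIV = infsum f (insert None (range Some))"
    by (simp add: UNIV_option_conv)
  also have "\<dots> = f None + infsum f (range Some)"
    using assms by (intro infsum_insert) (auto simp: summable_on_reindex o_def)
  finally show ?thesis by (simp add: infsum_reindex o_def)
qed

lemma summable_on_option:
  fixes f :: "'i option \<Rightarrow> real"
  shows "f summable_on UNIV \<longleftrightarrow> (\<lambda>i. f (Some i)) summable_on UNIV"
proof -
  have "f summable_on UNIV \<longleftrightarrow> f summable_on (insert None (range Some))"
    by (simp add: UNIV_option_conv)
  then show ?thesis
    by (simp add: summable_on_insert_iff summable_on_reindex o_def)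
qed

lemma expansion_shift_measurable [measurable]: "expansion_shift \<delta> \<in> borel_measurable expansion_space"
  unfolding expansion_shift_def expansion_space_def
proof (rule measurable_pair_measure_countable1)
  fix j :: "int option"
  show "(\<lambda>y. case (j, y) of (j, s) \<Rightarrow> case j of None \<Rightarrow> s | Some i \<Rightarrow> \<delta> i) \<in> borel_measurable lborel"
    by (cases j) auto
qed auto

lemma expansion_weight_measurable [measurable]:
  assumes [measurable]: "r \<in> borel_measurable borel"
  shows "expansion_weight \<alpha> r \<in> borel_measurable expansion_space"
  unfolding expansion_weight_def expansion_space_def
proof (rule measurable_pair_measure_countable1)
  fix j :: "int option"
  show "(\<lambda>y. case (j, y) of (j, s) \<Rightarrow> case j of None \<Rightarrow> r s | Some i \<Rightarrow> \<alpha> i * indicator {0..1} s) \<in> borel_measurable lborel"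
    by (cases j) auto
qed auto

lemma pair_sigma_finite_expansion: "pair_sigma_finite (count_space (UNIV :: int option set)) (lborel :: real measure)"
  by (intro pair_sigma_finite.intro sigma_finite_count_space lborel.sigma_finite_measure_axioms)

lemma expansion_space_sigma_finite: "sigma_finite_measure expansion_space"
proof -
  interpret pair_sigma_finite "count_space (UNIV :: int option set)" "lborel :: real measure"
    by (rule pair_sigma_finite_expansion)
  show ?thesis unfolding expansion_space_def by (rule sigma_finite_measure_axioms)
qed

lemma expansion_weight_integrable:
  assumes a: "(\<lambda>j. cmod (\<alpha> j)) summable_on UNIV" and r [measurable]: "integrable lborel r"
  shows "integrable expansion_space (expansion_weight \<alpha> r)"
  unfolding expansion_space_def
proof (rule pair_sigma_finite.Fubini_integrable[OF pair_sigma_finite_expansion])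
  have "r \<in> borel_measurable borel" by simp
  from expansion_weight_measurable[OF this]
  show "expansion_weight \<alpha> r \<in> borel_measurable (count_space UNIV \<Otimes>\<^sub>M lborel)"
    unfolding expansion_space_def .
  have eq: "(\<integral>y. norm (expansion_weight \<alpha> r (Some j, y)) \<partial>lborel) = cmod (\<alpha> j)" for j
  proof -
    have "(\<integral>y. norm (expansion_weight \<alpha> r (Some j, y)) \<partial>lborel) = (\<integral>y. cmod (\<alpha> j) * indicator {0..1 :: real} y \<partial>lborel)"
      by (intro Bochner_Integration.integral_cong refl) (auto simp: expansion_weight_def norm_mult indicator_def)
    then show ?thesis by simp
  qed
  have "integrable (count_space UNIV) (\<lambda>j. complex_of_real (\<integral>y. norm (expansion_weight \<alpha> r (j, y)) \<partial>lborel))"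
    unfolding integrable_count_space_iff_summable by (subst summable_on_option) (simp add: eq a)
  then show "integrable (count_space UNIV) (\<lambda>j. \<integral>y. norm (expansion_weight \<alpha> r (j, y)) \<partial>lborel)"
    using integrable_Re by fastforce
  show "AE j in count_space UNIV. integrable lborel (\<lambda>y. expansion_weight \<alpha> r (j, y))"
  proof (rule AE_I2)
    have "(\<lambda>y :: real. z * indicator {0..1} y) = (\<lambda>y. indicator {0..1} y *\<^sub>R z)" for z :: complex
      by (auto simp: indicator_def)
    then have "integrable lborel (\<lambda>y :: real. z * indicator {0..1} y)" for z :: complex
      by simp
    then show "integrable lborel (\<lambda>y. expansion_weight \<alpha> r (j, y))" for j
      by (cases j) (auto simp: expansion_weight_def r)
  qed
qed

lemma expansion_integral:
  fixes f :: "real \<Rightarrow> complex"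
  assumes "integrable expansion_space (\<lambda>z. expansion_weight \<alpha> r z * f (expansion_shift \<delta> z))"
  shows "(\<integral>z. expansion_weight \<alpha> r z * f (expansion_shift \<delta> z) \<partial>expansion_space) =
           infsum (\<lambda>j. \<alpha> j * f (\<delta> j)) UNIV + (\<integral>s. r s * f s \<partial>lborel)"
proof -
  interpret pair_sigma_finite "count_space (UNIV :: int option set)" "lborel :: real measure"
    by (rule pair_sigma_finite_expansion)
  define g where "g j = (\<integral>s. expansion_weight \<alpha> r (j, s) * f (expansion_shift \<delta> (j, s)) \<partial>lborel)" for j
  have g_None: "g None = (\<integral>s. r s * f s \<partial>lborel)"
    by (simp add: g_def expansion_weight_def expansion_shift_def)
  have g_Some: "g (Some j) = \<alpha> j * f (\<delta> j)" for j
  proof -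
    have "g (Some j) = (\<integral>s. indicator {0..1 :: real} s *\<^sub>R (\<alpha> j * f (\<delta> j)) \<partial>lborel)"
      unfolding g_def
      by (intro Bochner_Integration.integral_cong refl) (auto simp: expansion_weight_def expansion_shift_def indicator_def)
    then show ?thesis by simp
  qed
  have "integrable (count_space UNIV) g"
    unfolding g_def by (rule integrable_fst'[OF assms[unfolded expansion_space_def]])
  then have "(\<lambda>j. cmod (\<alpha> j * f (\<delta> j))) summable_on UNIV"
    unfolding integrable_count_space_iff_summable summable_on_option by (simp add: g_Some)
  then have s: "(\<lambda>j. g (Some j)) summable_on UNIV"
    unfolding summable_on_iff_abs_summable_on_complex by (simp add: g_Some)
  have "(\<integral>z. expansion_weight \<alpha> r z * f (expansion_shift \<delta> z) \<partial>expansion_space) = (\<integral>j. g j \<partial>count_space UNIV)"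
    unfolding g_def expansion_space_def by (rule integral_fst'[OF assms[unfolded expansion_space_def], symmetric])
  also have "\<dots> = g None + infsum (\<lambda>j. g (Some j)) UNIV"
    unfolding integral_count_space_eq_infsum by (rule infsum_option[OF s])
  finally show ?thesis by (simp add: g_None g_Some)
qed

abbreviation expansion_represents where
  "expansion_represents \<delta> \<alpha> r \<equiv> represents expansion_space (expansion_shift \<delta>) (expansion_weight \<alpha> r)"

lemma expansion_represents:
  assumes a: "(\<lambda>j. cmod (\<alpha> j)) summable_on UNIV" and r: "integrable lborel r"
  shows "expansion_represents \<delta> \<alpha> r (\<lambda>t. infsum (\<lambda>j. \<alpha> j * cis (\<delta> j * t)) UNIV + (\<integral>s. r s * cis (s * t) \<partial>lborel))"
  unfolding represents_def
proof (intro conjI allI)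
  show w: "integrable expansion_space (expansion_weight \<alpha> r)" by (rule expansion_weight_integrable[OF a r])
  show "\<exists>q :: int option \<times> real \<Rightarrow> complex. integrable expansion_space q \<and> integral\<^sup>L expansion_space q = 1"
  proof (intro exI conjI)
    let ?r = "\<lambda>s :: real. complex_of_real (indicator {0..1} s)"
    let ?q = "expansion_weight (\<lambda>_. 0) ?r"
    have q: "integrable expansion_space ?q"
      by (intro expansion_weight_integrable integrable_of_real) auto
    then show "integrable expansion_space ?q" .
    show "integral\<^sup>L expansion_space ?q = 1"
      using expansion_integral[of "\<lambda>_. 0" ?r "\<lambda>_. 1"] q by simp
  qed
  show "infsum (\<lambda>j. \<alpha> j * cis (\<delta> j * t)) UNIV + (\<integral>s. r s * cis (s * t) \<partial>lborel)
      = (\<integral>x. expansion_weight \<alpha> r x * cis (expansion_shift \<delta> x * t) \<partial>expansion_space)" for t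
    by (rule expansion_integral[symmetric]) (intro integrable_mult_cis w expansion_shift_measurable)
qed (use expansion_space_sigma_finite in auto)

lemma G_expansion_represents: "G_expansion a \<delta> \<alpha> r \<Longrightarrow> expansion_represents \<delta> \<alpha> r a"
  using expansion_represents[of \<alpha> r \<delta>] unfolding G_expansion_def by (auto simp: fun_eq_iff[symmetric])

text \<open>Frequencies may coincide here and the index type is arbitrary. Coinciding frequencies are collected
  into one coefficient, and the integers are added to the set of frequencies so that it is infinite and
  can be enumerated without repetition.\<close>

lemma in_G_if_series_plus_fourier:
  fixes \<beta> :: "'i :: countable \<Rightarrow> complex" and \<epsilon> :: "'i \<Rightarrow> real"
  assumes \<beta>: "(\<lambda>i. cmod (\<beta> i)) summable_on UNIV" and r: "integrable lborel r"
    and a: "\<And>t. a t = infsum (\<lambda>i. \<beta> i * cis (\<epsilon> i * t)) UNIV + (\<integral>s. r s * cis (s * t) \<partial>lborel)"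
  shows "a \<in> G"
proof -
  define D where "D = range \<epsilon> \<union> range real_of_int"
  have D: "countable D" "infinite D"
    unfolding D_def by (auto simp: finite_image_iff inj_on_def dest!: finite_imageD)
  define \<delta> where "\<delta> = from_nat_into D \<circ> int_encode"
  have "bij_betw \<delta> UNIV D"
    unfolding \<delta>_def using bij_int_encode by (intro bij_betw_trans[OF _ bij_betw_from_nat_into[OF D]])
  then have \<delta>: "inj \<delta>" "range \<delta> = D" by (auto simp: bij_betw_def)
  define I where "I j = {i. \<epsilon> i = \<delta> j}" for j
  define \<alpha> where "\<alpha> j = infsum \<beta> (I j)" for j
  have bij: "bij_betw snd (Sigma UNIV I) UNIV"
  proof (rule bij_betwI')
    show "\<And>x y. x \<in> Sigma UNIV I \<Longrightarrow> y \<in> Sigma UNIV I \<Longrightarrow> (snd x = snd y) = (x = y)"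
      using \<delta>(1) by (auto simp: I_def dest: injD)
    fix i
    have "\<epsilon> i \<in> range \<delta>" unfolding \<delta>(2) by (simp add: D_def)
    then show "\<exists>x\<in>Sigma UNIV I. i = snd x" by (auto simp: I_def)
  qed auto
  have S: "(\<lambda>x. cmod (\<beta> (snd x))) summable_on Sigma UNIV I"
    using summable_on_reindex_bij_betw[OF bij, of "\<lambda>i. cmod (\<beta> i)"] \<beta> by simp
  have \<beta>I: "(\<lambda>i. cmod (\<beta> i)) summable_on I j" for j
    using \<beta> by (rule summable_on_subset) auto
  have "(\<lambda>j. infsum (\<lambda>i. cmod (\<beta> i)) (I j)) summable_on UNIV"
    using summable_on_Sigma_banach[of "\<lambda>x i. cmod (\<beta> i)" UNIV I] S by (simp add: case_prod_beta')
  then have \<alpha>: "(\<lambda>j. cmod (\<alpha> j)) summable_on UNIV"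
    by (rule summable_on_comparison_test) (auto simp: \<alpha>_def intro!: norm_infsum_bound \<beta>I)
  have "infsum (\<lambda>i. \<beta> i * cis (\<epsilon> i * t)) UNIV = infsum (\<lambda>j. \<alpha> j * cis (\<delta> j * t)) UNIV" for t
  proof -
    have s: "(\<lambda>x. \<beta> (snd x) * cis (\<epsilon> (snd x) * t)) summable_on Sigma UNIV I"
      unfolding summable_on_iff_abs_summable_on_complex using S by (simp add: norm_mult)
    have "infsum (\<lambda>i. \<beta> i * cis (\<epsilon> i * t)) UNIV = infsum (\<lambda>x. \<beta> (snd x) * cis (\<epsilon> (snd x) * t)) (Sigma UNIV I)"
      using infsum_reindex_bij_betw[OF bij, of "\<lambda>i. \<beta> i * cis (\<epsilon> i * t)"] by simp
    also have "\<dots> = infsum (\<lambda>j. infsum (\<lambda>i. \<beta> i * cis (\<epsilon> i * t)) (I j)) UNIV"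
      using infsum_Sigma_banach[OF s] by simp
    also have "\<dots> = infsum (\<lambda>j. infsum (\<lambda>i. \<beta> i * cis (\<delta> j * t)) (I j)) UNIV"
      by (intro infsum_cong) (auto simp: I_def)
    finally show ?thesis by (simp add: infsum_cmult_left' \<alpha>_def)
  qed
  then have "G_expansion a \<delta> \<alpha> r"
    unfolding G_expansion_def using \<alpha> \<delta> r a by auto
  then show ?thesis unfolding G_def by blast
qed

text \<open>The product of the two almost periodic parts is a series over pairs of indices. All other terms
  contain the Fourier transform of an integrable function and are such transforms by the
  convolution theorem.\<close>

lemma fmult_in_G:
  assumes "a \<in> G" "b \<in> G"
  shows "a \<odot> b \<in> G"
proof -
  obtain \<delta> \<alpha> r where a: "G_expansion a \<delta> \<alpha> r" using assms unfolding G_def by blast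
  obtain \<delta>' \<alpha>' r' where b: "G_expansion b \<delta>' \<alpha>' r'" using assms unfolding G_def by blast
  have A: "(\<lambda>j. cmod (\<alpha> j)) summable_on UNIV" and r: "integrable lborel r"
    and at: "\<And>t. a t = infsum (\<lambda>j. \<alpha> j * cis (\<delta> j * t)) UNIV + (\<integral>s. r s * cis (s * t) \<partial>lborel)"
    using a unfolding G_expansion_def by auto
  have A': "(\<lambda>j. cmod (\<alpha>' j)) summable_on UNIV" and r': "integrable lborel r'"
    and bt: "\<And>t. b t = infsum (\<lambda>j. \<alpha>' j * cis (\<delta>' j * t)) UNIV + (\<integral>s. r' s * cis (s * t) \<partial>lborel)"
    using b unfolding G_expansion_def by auto
  note Ra = G_expansion_represents[OF a]
  have Rb: "expansion_represents \<delta>' \<alpha>' (\<lambda>_. 0) (\<lambda>t. infsum (\<lambda>j. \<alpha>' j * cis (\<delta>' j * t)) UNIV)"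
    using expansion_represents[OF A', of "\<lambda>_. 0" \<delta>'] by simp
  define \<rho>1 where "\<rho>1 = conv expansion_space (expansion_shift \<delta>) (expansion_weight \<alpha> r) r'"
  define \<rho>2 where "\<rho>2 = conv expansion_space (expansion_shift \<delta>') (expansion_weight \<alpha>' (\<lambda>_. 0)) r"
  have \<rho>: "integrable lborel \<rho>1" "integrable lborel \<rho>2"
    unfolding \<rho>1_def \<rho>2_def by (rule integrable_conv[OF Ra r'] integrable_conv[OF Rb r])+
  have \<rho>t: "(\<integral>s. (\<rho>1 s + \<rho>2 s) * cis (s * t) \<partial>lborel) = (\<integral>s. \<rho>1 s * cis (s * t) \<partial>lborel) + (\<integral>s. \<rho>2 s * cis (s * t) \<partial>lborel)" for t
    unfolding distrib_right
    by (intro Bochner_Integration.integral_add integrable_mult_cis \<rho>) auto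
  let ?\<beta> = "\<lambda>(i, j). \<alpha> i * \<alpha>' j" and ?\<epsilon> = "\<lambda>(i, j). \<delta> i + \<delta>' j"
  have cA: "integrable (count_space UNIV) \<alpha>" "integrable (count_space UNIV) \<alpha>'"
    unfolding integrable_count_space_iff_summable using A A' by auto
  have "integrable (count_space UNIV) ?\<beta>"
    using abs_summable_on_product[of UNIV UNIV \<alpha> \<alpha>'] cA by (simp add: abs_summable_on_def)
  then have \<beta>: "(\<lambda>i. cmod (?\<beta> i)) summable_on UNIV"
    unfolding integrable_count_space_iff_summable by simp
  have series: "infsum (\<lambda>i. ?\<beta> i * cis (?\<epsilon> i * t)) UNIV =
      infsum (\<lambda>j. \<alpha> j * cis (\<delta> j * t)) UNIV * infsum (\<lambda>j. \<alpha>' j * cis (\<delta>' j * t)) UNIV" for t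
  proof -
    have c: "integrable (count_space UNIV) (\<lambda>j. \<alpha> j * cis (\<delta> j * t))" "integrable (count_space UNIV) (\<lambda>j. \<alpha>' j * cis (\<delta>' j * t))"
      using cA by (auto intro!: integrable_mult_cis)
    have "infsum (\<lambda>i. ?\<beta> i * cis (?\<epsilon> i * t)) UNIV
      = infsum (\<lambda>(i, j). (\<alpha> i * cis (\<delta> i * t)) * (\<alpha>' j * cis (\<delta>' j * t))) UNIV"
      by (intro infsum_cong) (auto simp: distrib_right cis_mult[symmetric])
    also have "\<dots> = infsum (\<lambda>j. \<alpha> j * cis (\<delta> j * t)) UNIV * infsum (\<lambda>j. \<alpha>' j * cis (\<delta>' j * t)) UNIV"
      using infsetsum_product[of UNIV UNIV "\<lambda>j. \<alpha> j * cis (\<delta> j * t)" "\<lambda>j. \<alpha>' j * cis (\<delta>' j * t)"] c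
      unfolding abs_summable_on_def infsetsum_def integral_count_space_eq_infsum by simp
    finally show ?thesis .
  qed
  show ?thesis
  proof (rule in_G_if_series_plus_fourier[OF \<beta> Bochner_Integration.integrable_add[OF \<rho>]])
    show "(a \<odot> b) t = infsum (\<lambda>i. ?\<beta> i * cis (?\<epsilon> i * t)) UNIV + (\<integral>s. (\<rho>1 s + \<rho>2 s) * cis (s * t) \<partial>lborel)" for t
      unfolding \<rho>t series unfolding \<rho>1_def \<rho>2_def fourier_conv[OF Ra r'] fourier_conv[OF Rb r]
      by (simp add: fmult_def at bt algebra_simps)
  qed
qed

section \<open>Functions modulo null sets\<close>

lemma rep_measurable [measurable]: "rep u \<in> borel_measurable borel"
  using Quotient3_rep_reflp[OF Quotient3_lfun, of u] by (simp add: ae_equal_def)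

lemma lfun_of_rep: "lfun_of (rep u) = u"
  by (rule Quotient3_abs_rep[OF Quotient3_lfun])

lemma rep_lfun_of: "f \<in> borel_measurable borel \<Longrightarrow> AE t in lborel. rep (lfun_of f) t = f t"
  using rep_abs_rsp_left[OF Quotient3_lfun, of f f] by (simp add: ae_equal_def)

lemma lfun_of_cong_AE:
  assumes "f \<in> borel_measurable borel" "g \<in> borel_measurable borel" "AE t in lborel. f t = g t"
  shows "lfun_of f = lfun_of g"
  using Quotient3_rel[OF Quotient3_lfun, of f g] assms by (simp add: ae_equal_def)

lemma lfun_eqI: "AE t in lborel. rep u t = rep v t \<Longrightarrow> u = v"
  using lfun_of_cong_AE[of "rep u" "rep v"] by (simp add: lfun_of_rep)

lemma rep_zero: "AE t in lborel. rep 0 t = 0"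
  using rep_lfun_of[of "\<lambda>_. 0"] by (simp add: zero_lfun_def)

lemma rep_plus: "AE t in lborel. rep (u + v) t = rep u t + rep v t"
  using rep_lfun_of[of "\<lambda>t. rep u t + rep v t"] by (simp add: plus_lfun_def)

lemma rep_minus: "AE t in lborel. rep (u - v) t = rep u t - rep v t"
  using rep_lfun_of[of "\<lambda>t. rep u t - rep v t"] by (simp add: minus_lfun_def)

lemma rep_scaleC: "AE t in lborel. rep (z *\<^sub>C u) t = z * rep u t"
  using rep_lfun_of[of "\<lambda>t. z * rep u t"] by (simp add: scaleC_def)

lemma rep_projP: "AE t in lborel. rep (projP u) t = indicator {0<..} t * rep u t"
  unfolding projP_def by (rule rep_lfun_of) simp

lemma rep_flip: "AE t in lborel. rep (flip u) t = rep u (- t)"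
  unfolding flip_def by (rule rep_lfun_of) simp

lemma projP_add: "projP (u + v) = projP u + projP v"
  using rep_projP[of "u + v"] rep_projP[of u] rep_projP[of v] rep_plus[of "projP u" "projP v"] rep_plus[of u v]
  by (intro lfun_eqI, eventually_elim) (simp add: algebra_simps)

lemma projP_diff: "projP (u - v) = projP u - projP v"
  using rep_projP[of "u - v"] rep_projP[of u] rep_projP[of v] rep_minus[of "projP u" "projP v"] rep_minus[of u v]
  by (intro lfun_eqI, eventually_elim) (simp add: right_diff_distrib)

lemma projP_scaleC: "projP (z *\<^sub>C u) = z *\<^sub>C projP u"
  using rep_projP[of "z *\<^sub>C u"] rep_projP[of u] rep_scaleC[of z "projP u"] rep_scaleC[of z u]
  by (intro lfun_eqI, eventually_elim) (simp add: algebra_simps)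

lemma projP_idem: "projP (projP u) = projP u"
  using rep_projP[of "projP u"] rep_projP[of u]
  by (intro lfun_eqI, eventually_elim) (simp add: indicator_def)

lemma flip_add: "flip (u + v) = flip u + flip v"
  using rep_flip[of "u + v"] rep_flip[of u] rep_flip[of v] rep_plus[of "flip u" "flip v"]
    AE_reflect[OF rep_plus[of u v]]
  by (intro lfun_eqI, eventually_elim) simp

lemma flip_diff: "flip (u - v) = flip u - flip v"
  using rep_flip[of "u - v"] rep_flip[of u] rep_flip[of v] rep_minus[of "flip u" "flip v"]
    AE_reflect[OF rep_minus[of u v]]
  by (intro lfun_eqI, eventually_elim) simp

lemma flip_scaleC: "flip (z *\<^sub>C u) = z *\<^sub>C flip u"
  using rep_flip[of "z *\<^sub>C u"] rep_flip[of u] rep_scaleC[of z "flip u"]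
    AE_reflect[OF rep_scaleC[of z u]]
  by (intro lfun_eqI, eventually_elim) simp

lemma flip_flip: "flip (flip u) = u"
  using rep_flip[of "flip u"] AE_reflect[OF rep_flip[of u]]
  by (intro lfun_eqI, eventually_elim) simp

text \<open>Reflection exchanges the half-lines up to the point 0, which is a null set.\<close>

lemma flip_projP: "flip (projP u) = projQ (flip u)"
  unfolding projQ_def
  using rep_flip[of "projP u"] AE_reflect[OF rep_projP[of u]] rep_minus[of "flip u" "projP (flip u)"]
    rep_projP[of "flip u"] rep_flip[of u] AE_lborel_singleton[of 0]
  by (intro lfun_eqI, eventually_elim) (auto simp: indicator_def)

lemma Lp_lfun_of:
  assumes [measurable]: "f \<in> borel_measurable borel"
  shows "lfun_of f \<in> Lp p \<longleftrightarrow> integrable lborel (\<lambda>t. cmod (f t) powr p)"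
  unfolding Lp_def mem_Collect_eq
  by (rule integrable_cong_AE) (use rep_lfun_of[OF assms] in \<open>auto elim: eventually_mono\<close>)

lemma Lp_add:
  assumes p: "p \<ge> 1" and "u \<in> Lp p" "v \<in> Lp p"
  shows "u + v \<in> Lp p"
proof -
  have i: "integrable lborel (\<lambda>t. 2 powr p * (cmod (rep u t) powr p + cmod (rep v t) powr p))"
    using assms unfolding Lp_def by auto
  have "integrable lborel (\<lambda>t. cmod (rep u t + rep v t) powr p)"
  proof (rule Bochner_Integration.integrable_bound[OF i])
    have "cmod (x + y) powr p \<le> 2 powr p * (cmod x powr p + cmod y powr p)" for x y :: complex
    proof -
      have "cmod (x + y) \<le> 2 * max (cmod x) (cmod y)" using norm_triangle_ineq[of x y] by linarith
      then have "cmod (x + y) powr p \<le> (2 * max (cmod x) (cmod y)) powr p"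
        using p by (intro powr_mono2) auto
      also have "\<dots> = 2 powr p * max (cmod x) (cmod y) powr p" by (simp add: powr_mult)
      also have "\<dots> \<le> 2 powr p * (cmod x powr p + cmod y powr p)"
        by (intro mult_left_mono) (auto simp: max_def)
      finally show ?thesis .
    qed
    then show "AE t in lborel. norm (cmod (rep u t + rep v t) powr p)
      \<le> norm (2 powr p * (cmod (rep u t) powr p + cmod (rep v t) powr p))" by simp
  qed auto
  then show ?thesis
    using Lp_lfun_of[of "\<lambda>t. rep u t + rep v t"] by (simp add: plus_lfun_def)
qed

lemma Lp_scaleC: "u \<in> Lp p \<Longrightarrow> z *\<^sub>C u \<in> Lp p"
  using Lp_lfun_of[of "\<lambda>t. z * rep u t" p] by (simp add: scaleC_def norm_mult powr_mult Lp_def)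

lemma Lp_diff: "p \<ge> 1 \<Longrightarrow> u \<in> Lp p \<Longrightarrow> v \<in> Lp p \<Longrightarrow> u - v \<in> Lp p"
  using Lp_add[of p u "(-1) *\<^sub>C v"] Lp_scaleC[of v p "-1"] by simp

lemma Lp_projP:
  assumes "u \<in> Lp p" shows "projP u \<in> Lp p"
  unfolding projP_def
proof (subst Lp_lfun_of)
  have i: "integrable lborel (\<lambda>t. cmod (rep u t) powr p)" using assms by (simp add: Lp_def)
  show "integrable lborel (\<lambda>t. cmod (indicator {0<..} t * rep u t) powr p)"
    by (rule Bochner_Integration.integrable_bound[OF i]) (auto simp: indicator_def)
qed auto

lemma Lp_flip:
  assumes "u \<in> Lp p" shows "flip u \<in> Lp p"
  unfolding flip_def
proof (subst Lp_lfun_of)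
  have i: "integrable lborel (\<lambda>t. cmod (rep u t) powr p)" using assms by (simp add: Lp_def)
  show "integrable lborel (\<lambda>t. cmod (rep u (- t)) powr p)"
    using lborel_integrable_real_affine[OF i, of "-1" 0] by simp
qed auto

lemma LpR_iff: "u \<in> LpR p \<longleftrightarrow> u \<in> Lp p \<and> projP u = u"
proof -
  have "(AE t in lborel. t < 0 \<longrightarrow> rep u t = 0) \<longleftrightarrow> projP u = u"
  proof
    assume "AE t in lborel. t < 0 \<longrightarrow> rep u t = 0"
    then show "projP u = u"
      using rep_projP[of u] AE_lborel_singleton[of 0]
      by (intro lfun_eqI, eventually_elim) (auto simp: indicator_def)
  next
    assume "projP u = u"
    then show "AE t in lborel. t < 0 \<longrightarrow> rep u t = 0"
      using rep_projP[of u] by (auto elim!: eventually_mono simp: indicator_def)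
  qed
  then show ?thesis by (simp add: LpR_def)
qed

section \<open>The convolution operators form a representation of the algebra\<close>

lemma G_choice_expansion:
  assumes "a \<in> G"
  obtains \<delta> \<alpha> r where "G_choice a = (\<delta>, \<alpha>, r)" "G_expansion a \<delta> \<alpha> r"
proof -
  have "\<exists>x. case x of (\<delta>, \<alpha>, r) \<Rightarrow> G_expansion a \<delta> \<alpha> r"
    using assms unfolding G_def by auto
  from someI_ex[OF this] have "case G_choice a of (\<delta>, \<alpha>, r) \<Rightarrow> G_expansion a \<delta> \<alpha> r"
    unfolding G_choice_def by simp
  then show thesis using that by (cases "G_choice a") auto
qed

text \<open>Both \<open>infsum\<close> and the integral over the counting measure are 0 where the series diverges, so the
  series is a parameter integral for every \<open>t\<close>.\<close>

lemma borel_measurable_infsum_shift: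
  fixes f :: "real \<Rightarrow> complex" and \<alpha> :: "int \<Rightarrow> complex"
  assumes [measurable]: "f \<in> borel_measurable borel"
  shows "(\<lambda>t. infsum (\<lambda>j. \<alpha> j * f (t - \<delta> j)) UNIV) \<in> borel_measurable borel"
proof -
  interpret C: sigma_finite_measure "count_space (UNIV :: int set)" by (rule sigma_finite_count_space)
  have "(\<lambda>(j, t). \<alpha> j * f (t - \<delta> j)) \<in> borel_measurable (count_space UNIV \<Otimes>\<^sub>M borel)"
    by (rule measurable_pair_measure_countable1) auto
  from measurable_pair_swap[OF this]
  have [measurable]: "(\<lambda>(t, j). \<alpha> j * f (t - \<delta> j)) \<in> borel_measurable (borel \<Otimes>\<^sub>M count_space UNIV)"
    by (simp add: case_prod_beta')
  show ?thesis unfolding integral_count_space_eq_infsum[symmetric]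
    by (rule C.borel_measurable_lebesgue_integral) measurable
qed

text \<open>This removes the choice from the definition of \<open>W0\<close>. At almost every point both the chosen
  expansion and the given representation integrate \<open>rep u (t - s)\<close>, and then \<open>represents_unique\<close>
  applies to this function of \<open>s\<close>.\<close>

lemma W0_eq_conv:
  assumes a: "a \<in> G" and N: "represents N \<tau> w a" and p: "p \<ge> 1" and u: "u \<in> Lp p"
  shows "W0 a u = lfun_of (conv N \<tau> w (rep u))"
proof -
  obtain \<delta> \<alpha> r where c: "G_choice a = (\<delta>, \<alpha>, r)" and E: "G_expansion a \<delta> \<alpha> r"
    using G_choice_expansion[OF a] by blast
  have r [measurable]: "integrable lborel r" using E by (simp add: G_expansion_def)
  then have [measurable]: "r \<in> borel_measurable borel" by simp
  note RE = G_expansion_represents[OF E]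
  have up: "integrable lborel (\<lambda>t. cmod (rep u t) powr p)" using u by (simp add: Lp_def)
  note [measurable] = borel_measurable_infsum_shift
  have "AE t in lborel. infsum (\<lambda>j. \<alpha> j * rep u (t - \<delta> j)) UNIV + (\<integral>s. r (t - s) * rep u s \<partial>lborel) = conv N \<tau> w (rep u) t"
    using conv_AE_integrable[OF representsD(1-3)[OF RE] rep_measurable p up]
      conv_AE_integrable[OF representsD(1-3)[OF N] rep_measurable p up]
  proof eventually_elim
    case (elim t)
    have "(\<integral>s. r (t - s) * rep u s \<partial>lborel) = (\<integral>s. r s * rep u (t - s) \<partial>lborel)"
      using lborel_integral_real_affine[of "-1" "\<lambda>s. r (t - s) * rep u s" t] by simp
    then have "infsum (\<lambda>j. \<alpha> j * rep u (t - \<delta> j)) UNIV + (\<integral>s. r (t - s) * rep u s \<partial>lborel)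
      = (\<integral>z. expansion_weight \<alpha> r z * rep u (t - expansion_shift \<delta> z) \<partial>expansion_space)"
      using expansion_integral[OF elim(1)] by simp
    also have "\<dots> = (\<integral>y. w y * rep u (t - \<tau> y) \<partial>N)"
      by (rule represents_unique[OF RE N, of "\<lambda>s. rep u (t - s)"]) (use elim in auto)
    finally show ?case by (simp add: conv_def)
  qed
  then show ?thesis
    unfolding W0_def c prod.case using representsD(1-3)[OF N]
    by (intro lfun_of_cong_AE) (auto intro!: conv_measurable)
qed

lemma G_represents:
  assumes "a \<in> G"
  obtains \<tau> w where "represents expansion_space \<tau> w a"
  using assms G_expansion_represents unfolding G_def by blast

lemma rep_W0:
  assumes a: "a \<in> G" and N: "represents N \<tau> w a" and p: "p \<ge> 1" and u: "u \<in> Lp p"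
  shows "AE t in lborel. rep (W0 a u) t = conv N \<tau> w (rep u) t"
  unfolding W0_eq_conv[OF assms] using representsD(1-3)[OF N]
  by (intro rep_lfun_of conv_measurable) auto

lemma W0_Lp:
  assumes a: "a \<in> G" and p: "p \<ge> 1" and u: "u \<in> Lp p"
  shows "W0 a u \<in> Lp p"
proof -
  obtain \<tau> w where N: "represents expansion_space \<tau> w a" using G_represents[OF a] .
  have "integrable lborel (\<lambda>t. cmod (rep u t) powr p)" using u by (simp add: Lp_def)
  from integrable_conv_powr[OF representsD(1-3)[OF N] rep_measurable p this]
  show ?thesis
    unfolding W0_eq_conv[OF a N p u] using representsD(1-3)[OF N]
    by (subst Lp_lfun_of) (auto intro!: conv_measurable)
qed

lemma W0_add:
  assumes a: "a \<in> G" and p: "p \<ge> 1" and u: "u \<in> Lp p" and v: "v \<in> Lp p"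
  shows "W0 a (u + v) = W0 a u + W0 a v"
proof -
  obtain \<tau> w where N: "represents expansion_space \<tau> w a" using G_represents[OF a] .
  note R = representsD(1-3)[OF N]
  have up: "integrable lborel (\<lambda>t. cmod (rep u t) powr p)" using u by (simp add: Lp_def)
  have vp: "integrable lborel (\<lambda>t. cmod (rep v t) powr p)" using v by (simp add: Lp_def)
  have "AE t in lborel. conv expansion_space \<tau> w (rep (u + v)) t = conv expansion_space \<tau> w (\<lambda>t. rep u t + rep v t) t"
    by (rule conv_cong_AE) (use R rep_plus in auto)
  then show ?thesis
    using rep_W0[OF a N p u] rep_W0[OF a N p v] rep_W0[OF a N p Lp_add[OF p u v]] rep_plus[of "W0 a u" "W0 a v"]
      conv_AE_integrable[OF R rep_measurable p up] conv_AE_integrable[OF R rep_measurable p vp]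
    by (intro lfun_eqI, eventually_elim) (simp add: conv_def distrib_left)
qed

lemma W0_scaleC:
  assumes a: "a \<in> G" and p: "p \<ge> 1" and u: "u \<in> Lp p"
  shows "W0 a (z *\<^sub>C u) = z *\<^sub>C W0 a u"
proof -
  obtain \<tau> w where N: "represents expansion_space \<tau> w a" using G_represents[OF a] .
  note R = representsD(1-3)[OF N]
  have "AE t in lborel. conv expansion_space \<tau> w (rep (z *\<^sub>C u)) t = conv expansion_space \<tau> w (\<lambda>t. z * rep u t) t"
    by (rule conv_cong_AE) (use R rep_scaleC in auto)
  then show ?thesis
    using rep_W0[OF a N p u] rep_W0[OF a N p Lp_scaleC[OF u, of z]] rep_scaleC[of z "W0 a u"]
    by (intro lfun_eqI, eventually_elim) (simp add: conv_def mult.left_commute)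
qed

lemma W0_diff:
  assumes a: "a \<in> G" and p: "p \<ge> 1" and u: "u \<in> Lp p" and v: "v \<in> Lp p"
  shows "W0 a (u - v) = W0 a u - W0 a v"
  using W0_add[OF a p u Lp_scaleC[OF v, of "-1"]] W0_scaleC[OF a p v, of "-1"] by simp

lemma W0_fmult:
  assumes a: "a \<in> G" and b: "b \<in> G" and p: "p \<ge> 1" and u: "u \<in> Lp p"
  shows "W0 (a \<odot> b) u = W0 a (W0 b u)"
proof -
  obtain \<tau> w where N: "represents expansion_space \<tau> w a" using G_represents[OF a] .
  obtain \<tau>' w' where N': "represents expansion_space \<tau>' w' b" using G_represents[OF b] .
  have up: "integrable lborel (\<lambda>t. cmod (rep u t) powr p)" using u by (simp add: Lp_def)
  note R = representsD(1-3)[OF N] and R' = representsD(1-3)[OF N']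
  have [measurable]: "conv expansion_space \<tau>' w' (rep u) \<in> borel_measurable borel"
    using R' by (intro conv_measurable) auto
  have "AE t in lborel. conv expansion_space \<tau> w (rep (W0 b u)) t = conv expansion_space \<tau> w (conv expansion_space \<tau>' w' (rep u)) t"
    by (rule conv_cong_AE) (use R rep_W0[OF b N' p u] in auto)
  then show ?thesis
    using rep_W0[OF a N p W0_Lp[OF b p u]] conv_conv[OF N N' rep_measurable p up]
      rep_W0[OF fmult_in_G[OF a b] represents_mult[OF N N', folded fmult_def] p u]
    by (intro lfun_eqI, eventually_elim) simp
qed

lemma represents_const: "represents (count_space (UNIV :: unit set)) (\<lambda>_. 0) (\<lambda>_. z) (\<lambda>_. z)"
  unfolding represents_def
  by (auto intro!: sigma_finite_count_space exI[of _ "\<lambda>_. 1"] integrable_count_space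
    simp: lebesgue_integral_count_space_finite)

lemma const_in_G: "(\<lambda>_. z) \<in> G"
  by (rule in_G_if_series_plus_fourier[of "\<lambda>_ :: unit. z" "\<lambda>_. 0" _ "\<lambda>_. 0"])
     (auto simp: UNIV_unit)

lemma W0_const:
  assumes p: "p \<ge> 1" and u: "u \<in> Lp p"
  shows "W0 (\<lambda>_. z) u = z *\<^sub>C u"
proof -
  have "conv (count_space (UNIV :: unit set)) (\<lambda>_. 0) (\<lambda>_. z) (rep u) = (\<lambda>t. z * rep u t)"
    by (auto simp: conv_def lebesgue_integral_count_space_finite fun_eq_iff)
  then show ?thesis
    using W0_eq_conv[OF const_in_G represents_const p u] by (simp add: scaleC_def)
qed

lemma represents_refl_fun:
  "represents N \<tau> w a \<Longrightarrow> represents N (\<lambda>x. - \<tau> x) w (refl_fun a)"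
  unfolding represents_def refl_fun_def by auto

lemma refl_fun_in_G:
  assumes "a \<in> G" shows "refl_fun a \<in> G"
proof -
  obtain \<delta> \<alpha> r where a: "G_expansion a \<delta> \<alpha> r" using assms unfolding G_def by blast
  then have r: "integrable lborel r" by (simp add: G_expansion_def)
  have "(\<integral>s. r (- s) * cis (s * t) \<partial>lborel) = (\<integral>s. r s * cis (s * - t) \<partial>lborel)" for t
    using lborel_integral_real_affine[of "-1" "\<lambda>s. r s * cis (s * - t)" 0] by simp
  then show ?thesis
    using a lborel_integrable_real_affine[OF r, of "-1" 0]
    by (intro in_G_if_series_plus_fourier[of \<alpha> "\<lambda>s. r (- s)" _ "\<lambda>j. - \<delta> j"]) (auto simp: G_expansion_def refl_fun_def)
qed

lemma flip_W0:
  assumes a: "a \<in> G" and p: "p \<ge> 1" and u: "u \<in> Lp p"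
  shows "flip (W0 a u) = W0 (refl_fun a) (flip u)"
proof -
  obtain \<tau> w where N: "represents expansion_space \<tau> w a" using G_represents[OF a] .
  note R = representsD(1-3)[OF N]
  note N' = represents_refl_fun[OF N]
  note R' = representsD(1-3)[OF N']
  have "AE t in lborel. conv expansion_space (\<lambda>x. - \<tau> x) w (rep (flip u)) t = conv expansion_space (\<lambda>x. - \<tau> x) w (\<lambda>t. rep u (- t)) t"
    by (rule conv_cong_AE) (use R' rep_flip in auto)
  moreover have "AE t in lborel. rep (W0 a u) (- t) = conv expansion_space \<tau> w (rep u) (- t)"
    by (rule AE_reflect[OF rep_W0[OF a N p u]])
  ultimately show ?thesis
    using rep_W0[OF refl_fun_in_G[OF a] N' p Lp_flip[OF u]] rep_flip[of "W0 a u"]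
    by (intro lfun_eqI, eventually_elim) (simp add: conv_def algebra_simps)
qed

lemma Gplus_subset_G: "a \<in> Gplus \<Longrightarrow> a \<in> G"
  unfolding Gplus_def G_def by blast

text \<open>All shifts in an expansion with nonnegative frequencies go to the right.\<close>

lemma W0_Gplus_LpR:
  assumes a: "a \<in> Gplus" and p: "p \<ge> 1" and u: "u \<in> LpR p"
  shows "W0 a u \<in> LpR p"
proof -
  obtain \<delta> \<alpha> r where E: "G_expansion a \<delta> \<alpha> r" and pos: "\<And>j. \<delta> j \<ge> 0" "\<And>s. s < 0 \<Longrightarrow> r s = 0"
    using a unfolding Gplus_def by blast
  note N = G_expansion_represents[OF E]
  have uL: "u \<in> Lp p" using u by (simp add: LpR_def)
  let ?f = "\<lambda>t. if t < 0 then 0 else rep u t"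
  have [measurable]: "?f \<in> borel_measurable borel" by measurable
  have cut: "AE t in lborel. conv expansion_space (expansion_shift \<delta>) (expansion_weight \<alpha> r) (rep u) t =
     conv expansion_space (expansion_shift \<delta>) (expansion_weight \<alpha> r) ?f t"
  proof (rule conv_cong_AE)
    show "AE t in lborel. rep u t = ?f t"
      using u unfolding LpR_def by (auto elim: eventually_mono)
  qed (use representsD(1-3)[OF N] in auto)
  have zero: "conv expansion_space (expansion_shift \<delta>) (expansion_weight \<alpha> r) ?f t = 0" if "t < 0" for t
  proof -
    have "expansion_weight \<alpha> r z * ?f (t - expansion_shift \<delta> z) = 0" for z
    proof (cases z)
      case (Pair j s)
      show ?thesis
      proof (cases j)
        case None
        then show ?thesis using Pair that pos(2)[of s] by (auto simp: expansion_weight_def expansion_shift_def)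
      next
        case (Some i)
        then show ?thesis using Pair that pos(1)[of i] by (auto simp: expansion_weight_def expansion_shift_def)
      qed
    qed
    then show ?thesis unfolding conv_def by (intro integral_eq_zero_AE AE_I2)
  qed
  have "AE t in lborel. t < 0 \<longrightarrow> rep (W0 a u) t = 0"
    using cut rep_W0[OF Gplus_subset_G[OF a] N p uL] by eventually_elim (simp add: zero)
  then show ?thesis
    using W0_Lp[OF Gplus_subset_G[OF a] p uL] by (simp add: LpR_def)
qed

section \<open>Powers of v\<close>

lemma integrable_power_times_exp:
  "integrable lborel (\<lambda>t :: real. indicator {0..} t * (t ^ j * exp (- t)))"
proof (rule integrableI_nonneg)
  have "(\<integral>\<^sup>+t. ennreal (indicator {0..} t * (t ^ j * exp (- t))) \<partial>lborel) =
      (\<integral>\<^sup>+t. ennreal (t ^ j * exp (- t)) * indicator {0..} t \<partial>lborel)"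
    by (intro nn_integral_cong) (auto simp: indicator_def)
  then show "(\<integral>\<^sup>+t. ennreal (indicator {0..} t * (t ^ j * exp (- t))) \<partial>lborel) < \<infinity>"
    by (simp add: nn_intergal_power_times_exp_Ici)
qed (auto simp: indicator_def)

lemma integrable_exp_half_line:
  assumes "Re z \<ge> 1"
  shows "integrable lborel (\<lambda>s :: real. indicator {0..} s *\<^sub>R exp (- of_real s * z))"
proof (rule Bochner_Integration.integrable_bound[OF integrable_power_times_exp[of 0]])
  show "AE s in lborel. norm (indicator {0..} s *\<^sub>R exp (- complex_of_real s * z)) \<le> norm (indicator {0..} s * (s ^ 0 * exp (- s)))"
    using mult_left_mono[OF assms] by (auto simp: indicator_def)
qed auto

lemma integral_exp_half_line:
  assumes z: "Re z \<ge> 1"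
  shows "(\<integral>s. indicator {0..} s *\<^sub>R exp (- complex_of_real s * z) \<partial>lborel) = 1 / z"
proof -
  let ?f = "\<lambda>s. exp (- complex_of_real s * z)"
  have z0: "z \<noteq> 0" using z by auto
  \<comment> \<open>the fundamental theorem is applied on the open half-line\<close>
  have AE: "AE s in lborel. indicator {0..} s *\<^sub>R ?f s = indicator {0<..} s *\<^sub>R ?f s"
    using AE_lborel_singleton[of 0] by eventually_elim (auto simp: indicator_def)
  have e: "einterval 0 \<infinity> = {0<..}" by (auto simp: einterval_def zero_ereal_def)
  have int: "set_integrable lborel (einterval 0 \<infinity>) ?f"
    unfolding set_integrable_def e using integrable_exp_half_line[OF z] AE
    by (subst (asm) integrable_cong_AE[OF _ _ AE]) auto
  have "((\<lambda>s :: real. exp (- s)) \<longlongrightarrow> 0) at_top"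
    by (rule filterlim_compose[OF exp_at_bot filterlim_uminus_at_bot_at_top])
  then have lim0: "((\<lambda>s. - ?f s / z) \<longlongrightarrow> 0) at_top"
  proof (rule Lim_null_comparison[rotated])
    have "1 \<le> cmod z" using z complex_Re_le_cmod[of z] by linarith
    then have "norm (- ?f s / z) \<le> exp (- s)" if "s > 0" for s
      using z that mult_mono[of "exp (- (s * Re z))" "exp (-s)" "1 / cmod z" 1]
      by (simp add: norm_divide mult_left_le divide_simps split: if_splits)
    then show "\<forall>\<^sub>F s in at_top. norm (- ?f s / z) \<le> exp (- s)"
      by (meson eventually_gt_at_top eventually_mono)
  qed
  have "((\<lambda>s. - ?f s / z) \<longlongrightarrow> - ?f 0 / z) (at_right 0)"
    using z0 by (intro tendsto_intros) auto
  then have lim1: "((\<lambda>s. - ?f s / z) \<longlongrightarrow> - 1 / z) (at_right 0)" by simp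
  have "(LBINT s=0..\<infinity>. ?f s) = 0 - (- 1 / z)"
  proof (rule interval_integral_FTC_integrable[where F = "\<lambda>s. - ?f s / z"])
    show "((\<lambda>s. - ?f s / z) has_vector_derivative ?f x) (at x)" for x
    proof -
      have "((\<lambda>w. - exp (- w * z) / z) has_field_derivative ?f x) (at (of_real x))"
        using z0 by (auto intro!: derivative_eq_intros)
      then show ?thesis
        by (rule has_vector_derivative_real_field)
    qed
    show "isCont ?f x" for x by (intro continuous_intros)
    show "(((\<lambda>s. - ?f s / z) \<circ> real_of_ereal) \<longlongrightarrow> - 1 / z) (at_right 0)"
      using lim1 unfolding zero_ereal_def by (simp add: ereal_tendsto_simps)
    show "(((\<lambda>s. - ?f s / z) \<circ> real_of_ereal) \<longlongrightarrow> 0) (at_left \<infinity>)"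
      using lim0 by (simp add: ereal_tendsto_simps)
  qed (use int in auto)
  then have "(\<integral>s. indicator {0<..} s *\<^sub>R ?f s \<partial>lborel) = 1 / z"
    by (simp add: interval_lebesgue_integral_def set_lebesgue_integral_def e)
  then show ?thesis
    by (subst integral_cong_AE[OF _ _ AE]) auto
qed

lemma of_real_plus_minus_i_nonzero: "complex_of_real t + \<i> \<noteq> 0" "complex_of_real t - \<i> \<noteq> 0"
  by (auto simp: complex_eq_iff)

lemma vfun_nonzero: "vfun t \<noteq> 0"
  using of_real_plus_minus_i_nonzero[of t] by (simp add: vfun_def)

lemma vpow_add: "vpow (m + n) = vpow m \<odot> vpow n"
  by (simp add: vpow_def fmult_def power_int_add vfun_nonzero)

lemma vpow_0: "vpow 0 = (\<lambda>_. 1)"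
  by (simp add: vpow_def)

lemma refl_vpow: "refl_fun (vpow n) = vpow (- n)"
proof -
  have "vfun (- t) = inverse (vfun t)" for t
  proof -
    have "complex_of_real (- t) - \<i> = - (of_real t + \<i>)" "complex_of_real (- t) + \<i> = - (of_real t - \<i>)"
      by simp_all
    then show ?thesis by (simp only: vfun_def minus_divide_divide inverse_divide)
  qed
  then show ?thesis
    by (simp add: refl_fun_def vpow_def power_int_inverse power_int_minus)
qed

text \<open>The function \<open>v = 1 - 2 / (1 - i t)\<close> is the transform of the unit mass at 0 minus twice the
  exponential density. For \<open>Gplus\<close> the frequencies must be distinct and nonnegative, so the remaining
  ones, with coefficient 0, are the positive integers; \<open>int_decode 0\<close> is the index of the frequency 0.\<close>

definition unit_mass :: "int \<Rightarrow> complex" where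
  "unit_mass j = (if j = int_decode 0 then 1 else 0)"

definition exp_kernel :: "real \<Rightarrow> complex" where
  "exp_kernel s = indicator {0..} s *\<^sub>R of_real (exp (- s))"

lemma infsum_unit_mass: "infsum (\<lambda>j. unit_mass j * f (real (int_encode j))) UNIV = f 0"
proof -
  have "infsum (\<lambda>j. unit_mass j * f (real (int_encode j))) UNIV = infsum (\<lambda>j. unit_mass j * f (real (int_encode j))) {int_decode 0}"
    by (rule infsum_cong_neutral) (auto simp: unit_mass_def)
  then show ?thesis by (simp add: unit_mass_def)
qed

lemma G_expansion_vpow_1:
  "G_expansion (vpow 1) (\<lambda>j. real (int_encode j)) unit_mass (\<lambda>s. - 2 * exp_kernel s)"
  unfolding G_expansion_def
proof (intro conjI allI)
  show "inj (\<lambda>j. real (int_encode j))" by (auto simp: inj_def int_encode_eq)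
  have "(\<lambda>j. cmod (unit_mass j)) summable_on UNIV \<longleftrightarrow> (\<lambda>j. cmod (unit_mass j)) summable_on {int_decode 0}"
    by (rule summable_on_cong_neutral) (auto simp: unit_mass_def)
  then show "(\<lambda>j. cmod (unit_mass j)) summable_on UNIV" by simp
  show "integrable lborel (\<lambda>s. - 2 * exp_kernel s)"
  proof -
    have "exp (- complex_of_real s * 1) = of_real (exp (- s))" for s
      by (simp add: exp_of_real[symmetric] del: exp_of_real)
    then have "integrable lborel exp_kernel"
      using integrable_exp_half_line[of 1] unfolding exp_kernel_def[abs_def] by simp
    then show ?thesis by simp
  qed
  fix t
  have t: "complex_of_real t + \<i> \<noteq> 0" "1 - \<i> * of_real t \<noteq> 0" by (auto simp: complex_eq_iff)
  have "exp (- of_real s * (1 - \<i> * of_real t)) = of_real (exp (- s)) * cis (s * t)" for s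
    by (simp add: cis_conv_exp exp_of_real[symmetric] exp_add[symmetric] algebra_simps del: exp_of_real)
  then have "(\<integral>s. exp_kernel s * cis (s * t) \<partial>lborel) = 1 / (1 - \<i> * of_real t)"
    using integral_exp_half_line[of "1 - \<i> * of_real t"] by (simp add: exp_kernel_def)
  then have "(\<integral>s. - 2 * exp_kernel s * cis (s * t) \<partial>lborel) = - 2 / (1 - \<i> * of_real t)"
    by (simp add: mult.assoc)
  moreover have "vpow 1 t = 1 - 2 / (1 - \<i> * of_real t)"
    using t by (simp add: vpow_def vfun_def field_simps)
  ultimately show "vpow 1 t = infsum (\<lambda>j. unit_mass j * cis (real (int_encode j) * t)) UNIV + (\<integral>s. - 2 * exp_kernel s * cis (s * t) \<partial>lborel)"
    using infsum_unit_mass[of "\<lambda>s. cis (s * t)"] by simp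
qed

lemma vpow_1_in_Gplus: "vpow 1 \<in> Gplus"
proof -
  have "\<forall>j. 0 \<le> real (int_encode j)" "\<forall>s<0. - 2 * exp_kernel s = 0"
    by (auto simp: exp_kernel_def)
  then show ?thesis unfolding Gplus_def using G_expansion_vpow_1 by blast
qed

lemma vpow_in_G: "vpow n \<in> G"
proof -
  have "vpow (int k) \<in> G" for k
  proof (induction k)
    case 0
    then show ?case by (simp add: vpow_0 const_in_G)
  next
    case (Suc k)
    then show ?case
      using fmult_in_G[OF Gplus_subset_G[OF vpow_1_in_Gplus]] by (simp add: vpow_add)
  qed
  from this[of "nat n"] refl_fun_in_G[OF this[of "nat (-n)"]] show ?thesis
    by (cases "n \<ge> 0") (auto simp: refl_vpow)
qed

lemma W0_vpow_add:
  "p \<ge> 1 \<Longrightarrow> u \<in> Lp p \<Longrightarrow> W0 (vpow (m + n)) u = W0 (vpow m) (W0 (vpow n) u)"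
  by (simp add: vpow_add W0_fmult vpow_in_G)

lemma W0_vpow_0: "p \<ge> 1 \<Longrightarrow> u \<in> Lp p \<Longrightarrow> W0 (vpow 0) u = u"
  by (simp add: vpow_0 W0_const)

lemma W0_vpow_cancel:
  "p \<ge> 1 \<Longrightarrow> u \<in> Lp p \<Longrightarrow> W0 (vpow n) (W0 (vpow (- n)) u) = u"
  "p \<ge> 1 \<Longrightarrow> u \<in> Lp p \<Longrightarrow> W0 (vpow (- n)) (W0 (vpow n) u) = u"
  using W0_vpow_add[of p u n "-n"] W0_vpow_add[of p u "-n" n] W0_vpow_0 by auto

lemma W0_vpow_LpR: "p \<ge> 1 \<Longrightarrow> u \<in> LpR p \<Longrightarrow> W0 (vpow (int k)) u \<in> LpR p"
proof (induction k)
  case 0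
  then show ?case by (simp add: W0_vpow_0 LpR_def)
next
  case (Suc k)
  then have "W0 (vpow 1) (W0 (vpow (int k)) u) \<in> LpR p"
    using W0_Gplus_LpR[OF vpow_1_in_Gplus] by blast
  then show ?case using Suc.prems W0_vpow_add[of p u 1 "int k"] by (simp add: LpR_def)
qed

lemma rep_W0_vpow_minus_1:
  assumes p: "p \<ge> 1" and u: "u \<in> Lp p"
  shows "AE t in lborel. rep (W0 (vpow (- 1)) u) t = rep u t - 2 * (\<integral>s. exp_kernel s * rep u (t + s) \<partial>lborel)"
proof -
  note N = represents_refl_fun[OF G_expansion_represents[OF G_expansion_vpow_1], unfolded refl_vpow]
  have up: "integrable lborel (\<lambda>t. cmod (rep u t) powr p)" using u by (simp add: Lp_def)
  show ?thesis
    using rep_W0[OF vpow_in_G N p u] conv_AE_integrable[OF representsD(1-3)[OF N] rep_measurable p up]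
  proof eventually_elim
    case (elim t)
    have "rep (W0 (vpow (- 1)) u) t = infsum (\<lambda>j. unit_mass j * rep u (t + real (int_encode j))) UNIV + (\<integral>s. - 2 * exp_kernel s * rep u (t + s) \<partial>lborel)"
      using elim(1) expansion_integral[of unit_mass "\<lambda>s. - 2 * exp_kernel s" "\<lambda>s. rep u (t + s)" "\<lambda>j. real (int_encode j)"] elim(2)
      by (simp add: conv_def)
    then show ?case
      using infsum_unit_mass[of "\<lambda>s. rep u (t + s)"] by (simp add: mult.assoc)
  qed
qed

section \<open>Half-line moments and the range of W(v^k)\<close>

lemma power_le_fact_exp: "t \<ge> 0 \<Longrightarrow> t ^ j * exp (- t) \<le> fact j" for t :: real
proof -
  assume t: "t \<ge> 0"
  have "(\<Sum>n\<in>{j}. inverse (fact n) *\<^sub>R t ^ n) \<le> (\<Sum>n. inverse (fact n) *\<^sub>R t ^ n)"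
    by (rule sum_le_suminf[OF summable_exp_generic]) (use t in auto)
  then have "t ^ j / fact j \<le> exp t" by (simp add: exp_def divide_inverse mult.commute)
  then show ?thesis by (simp add: exp_minus field_simps)
qed

text \<open>Since \<open>r \<le> 1 + r powr p\<close>, the integrand is bounded by the sum of an exponentially decaying function
  and a multiple of the integrable function \<open>cmod (rep u t) powr p\<close>. The same bound serves all
  exponents \<open>p \<ge> 1\<close>.\<close>

lemma moment_integrable:
  assumes p: "p \<ge> 1" and u: "u \<in> Lp p"
  shows "integrable lborel (\<lambda>t. indicator {0<..} t *\<^sub>R (rep u t * of_real (exp (- t) * t ^ j)))"
proof (rule Bochner_Integration.integrable_bound)
  show "integrable lborel (\<lambda>t :: real. indicator {0..} t * (t ^ j * exp (- t)) + fact j * cmod (rep u t) powr p)"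
    using u by (intro Bochner_Integration.integrable_add integrable_power_times_exp) (auto simp: Lp_def)
  show "AE t in lborel. norm (indicator {0<..} t *\<^sub>R (rep u t * of_real (exp (- t) * t ^ j)))
     \<le> norm (indicator {0..} t * (t ^ j * exp (- t)) + fact j * cmod (rep u t) powr p)"
  proof (rule AE_I2)
    fix t :: real
    show "norm (indicator {0<..} t *\<^sub>R (rep u t * of_real (exp (- t) * t ^ j)))
     \<le> norm (indicator {0..} t * (t ^ j * exp (- t)) + fact j * cmod (rep u t) powr p)"
    proof (cases "t > 0")
      case True
      have "cmod (rep u t) * (t ^ j * exp (- t)) \<le> (1 + cmod (rep u t) powr p) * (t ^ j * exp (- t))"
        using p True by (intro mult_right_mono le_one_plus_powr) auto
      also have "\<dots> = t ^ j * exp (- t) + cmod (rep u t) powr p * (t ^ j * exp (- t))" by (simp add: algebra_simps)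
      also have "\<dots> \<le> t ^ j * exp (- t) + cmod (rep u t) powr p * fact j"
        using True by (intro add_left_mono mult_left_mono power_le_fact_exp) auto
      finally show ?thesis using True
        by (simp add: indicator_def norm_mult norm_power mult_ac)
    qed (simp add: indicator_def)
  qed
qed auto

lemma half_line_moment_eq:
  "half_line_moment u j = (\<integral>t. indicator {0<..} t *\<^sub>R (rep u t * of_real (exp (- t) * t ^ j)) \<partial>lborel)"
  by (simp add: half_line_moment_def set_lebesgue_integral_def)

lemma rep_psi0: "AE t in lborel. rep psi0 t = (if t > 0 then of_real (sqrt 2 * exp (- t)) else 0)"
  unfolding psi0_def by (rule rep_lfun_of) measurable

text \<open>For \<open>t < 0\<close> the kernel \<open>e\<^sup>t\<^sup>-\<^sup>x\<close> factors and the integral over \<open>x > t\<close> is an integral over the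
  half-line on which \<open>u\<close> lives. The factor \<open>sqrt 2\<close> comes from the normalization of \<open>psi0\<close>.\<close>

lemma projQ_W0_vpow_minus_1:
  assumes p: "p \<ge> 1" and u: "u \<in> LpR p"
  shows "projQ (W0 (vpow (- 1)) u) = (- of_real (sqrt 2) * half_line_moment u 0) *\<^sub>C flip psi0"
proof (rule lfun_eqI)
  let ?y = "W0 (vpow (- 1)) u" and ?z = "- of_real (sqrt 2) * half_line_moment u 0"
  have uL: "u \<in> Lp p" and u0: "AE t in lborel. t < 0 \<longrightarrow> rep u t = 0" using u by (auto simp: LpR_def)
  have kernel: "(\<integral>s. exp_kernel s * rep u (t + s) \<partial>lborel) = of_real (exp t) * half_line_moment u 0" if t: "t < 0" for t
  proof -
    have "(\<integral>s. exp_kernel s * rep u (t + s) \<partial>lborel) = (\<integral>x. exp_kernel (x - t) * rep u x \<partial>lborel)"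
      using lborel_integral_real_affine[of 1 "\<lambda>x. exp_kernel (x - t) * rep u x" t] by simp
    also have "\<dots> = (\<integral>x. of_real (exp t) * (indicator {0<..} x *\<^sub>R (rep u x * of_real (exp (- x) * x ^ 0))) \<partial>lborel)"
    proof (rule integral_cong_AE)
      show "AE x in lborel. exp_kernel (x - t) * rep u x
        = of_real (exp t) * (indicator {0<..} x *\<^sub>R (rep u x * of_real (exp (- x) * x ^ 0)))"
        using u0 AE_lborel_singleton[of 0]
        by eventually_elim (use t in \<open>auto simp: exp_kernel_def indicator_def exp_diff exp_minus field_simps\<close>)
    qed (auto simp: exp_kernel_def)
    finally show ?thesis unfolding half_line_moment_eq integral_mult_right_zero .
  qed
  show "AE t in lborel. rep (projQ ?y) t = rep (?z *\<^sub>C flip psi0) t"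
    unfolding projQ_def
    using rep_W0_vpow_minus_1[OF p uL] rep_minus[of ?y "projP ?y"] rep_projP[of ?y] rep_scaleC[of ?z "flip psi0"]
      rep_flip[of psi0] AE_reflect[OF rep_psi0] u0 AE_lborel_singleton[of 0]
  proof eventually_elim
    case (elim t)
    have s: "complex_of_real (sqrt 2) * of_real (sqrt 2) = 2"
      by (simp flip: of_real_mult)
    show ?case
    proof (cases "t > 0")
      case True
      then show ?thesis using elim by (simp add: indicator_def)
    next
      case False
      then have t: "t < 0" using elim by auto
      have "rep (?y - projP ?y) t = - 2 * (of_real (exp t) * half_line_moment u 0)"
        using elim t kernel[OF t] by (simp add: indicator_def)
      also have "\<dots> = ?z * of_real (sqrt 2 * exp t)" using s by (simp add: algebra_simps)
      finally show ?thesis using elim t by simp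
    qed
  qed
qed

lemma integral_exp_minus_two:
  "(\<integral>s. indicator {0..} s *\<^sub>R complex_of_real (exp (- s) * exp (- s)) \<partial>lborel) = 1 / 2"
proof -
  have "exp (- complex_of_real s * 2) = complex_of_real (exp (- s) * exp (- s))" for s
    by (simp add: exp_of_real[symmetric] exp_add[symmetric] mult.commute del: exp_of_real)
  then show ?thesis using integral_exp_half_line[of 2] by simp
qed

lemma psi0_LpR:
  fixes p :: real
  assumes p: "p \<ge> 1"
  shows "psi0 \<in> LpR p"
proof -
  have [measurable]: "(\<lambda>t. if t > 0 then complex_of_real (sqrt 2 * exp (- t)) else 0) \<in> borel_measurable borel" by measurable
  have "psi0 \<in> Lp p"
    unfolding psi0_def
  proof (subst Lp_lfun_of)
    have i: "integrable lborel (\<lambda>t. sqrt 2 powr p * (indicator {0..} t * (t ^ 0 * exp (- t))))"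
      using integrable_power_times_exp[of 0] by simp
    show "integrable lborel (\<lambda>t. cmod (if t > 0 then complex_of_real (sqrt 2 * exp (- t)) else 0) powr p)"
    proof (rule Bochner_Integration.integrable_bound[OF i])
      show "AE t in lborel. norm (cmod (if t > 0 then complex_of_real (sqrt 2 * exp (- t)) else 0) powr p)
        \<le> norm (sqrt 2 powr p * (indicator {0..} t * (t ^ 0 * exp (- t))))"
      proof (rule AE_I2)
        fix t :: real
        have "exp (- t) powr p \<le> exp (- t)" if "t > 0"
          using p that by (simp add: exp_powr_real)
        then show "norm (cmod (if t > 0 then complex_of_real (sqrt 2 * exp (- t)) else 0) powr p)
          \<le> norm (sqrt 2 powr p * (indicator {0..} t * (t ^ 0 * exp (- t))))"
          by (auto simp: indicator_def powr_mult norm_mult)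
      qed
    qed measurable
  qed measurable
  then show ?thesis
    unfolding LpR_def using rep_psi0 by (auto elim: eventually_mono)
qed

lemma W0_vpow_minus_1_psi0: "W0 (vpow (- 1)) psi0 = - flip psi0"
proof -
  define p :: real where "p = 1"
  then have p: "p \<ge> 1" by simp
  let ?y = "W0 (vpow (- 1)) psi0"
  have L: "psi0 \<in> LpR p" "psi0 \<in> Lp p" using psi0_LpR[OF p] by (auto simp: LpR_def)
  have "half_line_moment psi0 0 = (\<integral>t. of_real (sqrt 2) * (indicator {0..} t *\<^sub>R complex_of_real (exp (- t) * exp (- t))) \<partial>lborel)"
    unfolding half_line_moment_eq
  proof (rule integral_cong_AE)
    show "AE t in lborel. indicator {0<..} t *\<^sub>R (rep psi0 t * of_real (exp (- t) * t ^ 0))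
      = of_real (sqrt 2) * (indicator {0..} t *\<^sub>R complex_of_real (exp (- t) * exp (- t)))"
      using rep_psi0 AE_lborel_singleton[of 0] by eventually_elim (auto simp: indicator_def)
  qed auto
  then have m0: "half_line_moment psi0 0 = of_real (sqrt 2) / 2"
    unfolding integral_mult_right_zero integral_exp_minus_two by simp
  have "complex_of_real (sqrt 2) * of_real (sqrt 2) = 2"
    by (simp flip: of_real_mult)
  then have "- complex_of_real (sqrt 2) * half_line_moment psi0 0 = - 1"
    unfolding m0 by simp
  then have Q: "projQ ?y = (-1) *\<^sub>C flip psi0"
    using projQ_W0_vpow_minus_1[OF p L(1)] by simp
  have "projP ?y = 0"
  proof (rule lfun_eqI)
    have kernel: "(\<integral>s. exp_kernel s * rep psi0 (t + s) \<partial>lborel) = of_real (sqrt 2 * exp (- t)) / 2" if t: "t > 0" for t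
    proof -
      have "(\<integral>s. exp_kernel s * rep psi0 (t + s) \<partial>lborel) =
        (\<integral>s. of_real (sqrt 2 * exp (- t)) * (indicator {0..} s *\<^sub>R complex_of_real (exp (- s) * exp (- s))) \<partial>lborel)"
      proof (rule integral_cong_AE)
        have "AE s in lborel. rep psi0 (t + 1 * s) = (if t + 1 * s > 0 then of_real (sqrt 2 * exp (- (t + 1 * s))) else 0)"
          by (rule AE_borel_affine[OF _ _ rep_psi0]) (auto intro!: borel_measurable_eq simp: pred_def)
        then show "AE s in lborel. exp_kernel s * rep psi0 (t + s)
          = of_real (sqrt 2 * exp (- t)) * (indicator {0..} s *\<^sub>R complex_of_real (exp (- s) * exp (- s)))"
          by eventually_elim (use t in \<open>auto simp: exp_kernel_def indicator_def exp_diff exp_minus field_simps\<close>)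
      qed (auto simp: exp_kernel_def)
      then show ?thesis unfolding integral_mult_right_zero integral_exp_minus_two by simp
    qed
    show "AE t in lborel. rep (projP ?y) t = rep 0 t"
      using rep_projP[of ?y] rep_W0_vpow_minus_1[OF p L(2)] rep_psi0 rep_zero
    proof eventually_elim
      case (elim t)
      then show ?case using kernel[of t] by (cases "t > 0") (auto simp: indicator_def)
    qed
  qed
  then show ?thesis using Q by (simp add: projQ_def)
qed

lemma AE_negative_const:
  assumes "AE t in lborel. (t :: real) < 0 \<longrightarrow> P"
  shows P
proof (rule ccontr)
  assume "\<not> P"
  with assms have "AE t in lborel. \<not> (t :: real) < 0" by auto
  then have "emeasure lborel {..<0 :: real} = 0"
    by (subst (asm) AE_iff_measurable[OF _ refl]) (auto simp: lessThan_def)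
  moreover have "emeasure lborel {-1<..<0 :: real} \<le> emeasure lborel {..<0 :: real}"
    by (rule emeasure_mono) auto
  ultimately show False by simp
qed

lemma flip_psi0_nonzero: "flip psi0 \<noteq> 0"
proof
  assume "flip psi0 = 0"
  have "AE t in lborel. (t :: real) < 0 \<longrightarrow> False"
    using rep_flip[of psi0, unfolded \<open>flip psi0 = 0\<close>] rep_zero AE_reflect[OF rep_psi0]
    by eventually_elim auto
  then show False by (rule AE_negative_const)
qed

text \<open>In the moment of order \<open>j\<close> of \<open>\<integral> e\<^sup>t\<^sup>-\<^sup>x u(x) dx\<close>, taken over \<open>x > t\<close>, the factor \<open>e\<^sup>t\<close> cancels. After
  exchanging the integrals the inner one is \<open>\<integral> t\<^sup>j dt\<close> over \<open>0 < t < x\<close>, which raises the order by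
  one.\<close>

lemma half_line_moment_W0_vpow_minus_1:
  assumes p: "p \<ge> 1" and u: "u \<in> Lp p"
  shows "half_line_moment (W0 (vpow (- 1)) u) j =
    half_line_moment u j - 2 / of_nat (Suc j) * half_line_moment u (Suc j)"
proof -
  let ?y = "W0 (vpow (- 1)) u"
  \<comment> \<open>for positive t the factor indicator {0..x} t is the condition t \<le> x on the kernel\<close>
  define \<phi> :: "real \<Rightarrow> real \<Rightarrow> complex" where
    "\<phi> x t = (indicator {0<..} x *\<^sub>R (rep u x * of_real (exp (- x)))) * of_real (t ^ j * indicator {0..x} t)" for x t
  have [measurable]: "(\<lambda>(x, t). \<phi> x t) \<in> borel_measurable (lborel \<Otimes>\<^sub>M lborel)"
    unfolding \<phi>_def indicator_def atLeastAtMost_iff greaterThan_iff by measurable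
  have pw: "(\<integral>t. t ^ j * indicator {0..x} t \<partial>lborel) = x ^ Suc j / Suc j" if "x > 0" for x :: real
    using integral_power[of 0 x j] that by simp
  have pwi: "integrable lborel (\<lambda>t :: real. t ^ j * indicator {0..x} t)" for x
    by (rule borel_integrable_atLeastAtMost) auto
  have inner: "(\<integral>t. \<phi> x t \<partial>lborel) = (1 / of_nat (Suc j)) * (indicator {0<..} x *\<^sub>R (rep u x * of_real (exp (- x) * x ^ Suc j)))" for x
  proof (cases "x > 0")
    case True
    have "(\<integral>t. \<phi> x t \<partial>lborel) = (rep u x * of_real (exp (- x))) * of_real (\<integral>t. t ^ j * indicator {0..x} t \<partial>lborel)"
      using True unfolding \<phi>_def by (simp add: integral_complex_of_real[symmetric] del: integral_complex_of_real of_real_mult)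
    then show ?thesis using True pw[OF True] by (simp add: field_simps del: power_Suc)
  qed (simp add: \<phi>_def)
  have innern: "(\<integral>t. norm (\<phi> x t) \<partial>lborel) = (1 / real (Suc j)) * norm (indicator {0<..} x *\<^sub>R (rep u x * of_real (exp (- x) * x ^ Suc j)))" for x
  proof (cases "x > 0")
    case True
    have "(\<integral>t. norm (\<phi> x t) \<partial>lborel) = (\<integral>t. (cmod (rep u x) * exp (- x)) * (t ^ j * indicator {0..x} t) \<partial>lborel)"
      using True unfolding \<phi>_def by (intro Bochner_Integration.integral_cong refl) (auto simp: norm_mult norm_power indicator_def)
    also have "\<dots> = (cmod (rep u x) * exp (- x)) * (x ^ Suc j / Suc j)"
      using pw[OF True] by simp
    finally show ?thesis using True by (simp add: norm_mult norm_power field_simps)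
  qed (simp add: \<phi>_def)
  have I: "integrable (lborel \<Otimes>\<^sub>M lborel) (\<lambda>(x, t). \<phi> x t)"
  proof (rule lborel_pair.Fubini_integrable)
    show "integrable lborel (\<lambda>x. \<integral>t. norm (case (x, t) of (x, t) \<Rightarrow> \<phi> x t) \<partial>lborel)"
      unfolding prod.case innern using integrable_norm[OF moment_integrable[OF p u, of "Suc j"]] by simp
    show "AE x in lborel. integrable lborel (\<lambda>t. case (x, t) of (x, t) \<Rightarrow> \<phi> x t)"
      unfolding prod.case \<phi>_def using pwi by (intro AE_I2 integrable_mult_right integrable_of_real)
  qed auto
  have swap: "(\<integral>t. (\<integral>x. \<phi> x t \<partial>lborel) \<partial>lborel) = (\<integral>x. (\<integral>t. \<phi> x t \<partial>lborel) \<partial>lborel)"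
    using lborel_pair.Fubini_integral[OF I] by simp
  have int2: "integrable lborel (\<lambda>t. \<integral>x. \<phi> x t \<partial>lborel)"
    by (rule lborel_pair.integrable_snd[OF I])
  have outer: "indicator {0<..} t *\<^sub>R ((\<integral>s. exp_kernel s * rep u (t + s) \<partial>lborel) * of_real (exp (- t) * t ^ j)) = (\<integral>x. \<phi> x t \<partial>lborel)" if "t \<noteq> 0" for t
  proof (cases "t > 0")
    case True
    have "(\<integral>s. exp_kernel s * rep u (t + s) \<partial>lborel) = (\<integral>x. exp_kernel (x - t) * rep u x \<partial>lborel)"
      using lborel_integral_real_affine[of 1 "\<lambda>x. exp_kernel (x - t) * rep u x" t] by simp
    then have "(\<integral>s. exp_kernel s * rep u (t + s) \<partial>lborel) * of_real (exp (- t) * t ^ j)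
      = (\<integral>x. exp_kernel (x - t) * rep u x * of_real (exp (- t) * t ^ j) \<partial>lborel)" by simp
    also have "\<dots> = (\<integral>x. \<phi> x t \<partial>lborel)"
      using True by (intro Bochner_Integration.integral_cong refl)
        (auto simp: \<phi>_def exp_kernel_def indicator_def exp_diff exp_minus field_simps)
    finally show ?thesis using True by simp
  next
    case False
    then have "\<phi> x t = 0" for x using that by (simp add: \<phi>_def)
    then show ?thesis using False by simp
  qed
  have "half_line_moment ?y j = (\<integral>t. indicator {0<..} t *\<^sub>R (rep u t * of_real (exp (- t) * t ^ j)) - 2 * (\<integral>x. \<phi> x t \<partial>lborel) \<partial>lborel)"
    unfolding half_line_moment_eq
  proof (rule integral_cong_AE)
    show "AE t in lborel. indicator {0<..} t *\<^sub>R (rep ?y t * of_real (exp (- t) * t ^ j))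
      = indicator {0<..} t *\<^sub>R (rep u t * of_real (exp (- t) * t ^ j)) - 2 * (\<integral>x. \<phi> x t \<partial>lborel)"
      using rep_W0_vpow_minus_1[OF p u] AE_lborel_singleton[of 0]
    proof eventually_elim
      case (elim t)
      show ?case unfolding elim(1) outer[OF elim(2), symmetric]
        by (simp add: indicator_def algebra_simps)
    qed
  qed (use int2 in auto)
  also have "\<dots> = half_line_moment u j - 2 * (\<integral>t. (\<integral>x. \<phi> x t \<partial>lborel) \<partial>lborel)"
    using int2 moment_integrable[OF p u, of j] by (simp add: half_line_moment_eq)
  also have "(\<integral>t. (\<integral>x. \<phi> x t \<partial>lborel) \<partial>lborel) = (1 / of_nat (Suc j)) * half_line_moment u (Suc j)"
    unfolding swap inner half_line_moment_eq integral_mult_right_zero ..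
  finally show ?thesis by simp
qed

lemma W0_vpow_minus_1_LpR_iff:
  assumes p: "p \<ge> 1" and u: "u \<in> LpR p"
  shows "W0 (vpow (- 1)) u \<in> LpR p \<longleftrightarrow> half_line_moment u 0 = 0"
proof -
  have uL: "u \<in> Lp p" using u by (simp add: LpR_def)
  have "W0 (vpow (- 1)) u \<in> LpR p \<longleftrightarrow> projQ (W0 (vpow (- 1)) u) = 0"
    using W0_Lp[OF vpow_in_G p uL] by (auto simp: LpR_iff projQ_def)
  then show ?thesis
    unfolding projQ_W0_vpow_minus_1[OF p u] using flip_psi0_nonzero by simp
qed

text \<open>Induction on \<open>k\<close>: \<open>u\<close> is in the range of \<open>W(v\<^sup>k\<^sup>+\<^sup>1)\<close> if and only if \<open>y = W0(v\<^sup>-\<^sup>1) u\<close> lives on the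
  half-line, that is, the moment of order 0 of \<open>u\<close> vanishes, and \<open>y\<close> is in the range of \<open>W(v\<^sup>k)\<close>. The
  recursion for moments then translates the conditions on \<open>y\<close> into conditions on \<open>u\<close>.\<close>

theorem im_W_vpow_iff_moments:
  assumes p: "p \<ge> 1" and u: "u \<in> LpR p"
  shows "u \<in> im_on p (W (vpow (int k))) \<longleftrightarrow> (\<forall>j<k. half_line_moment u j = 0)"
  using u
proof (induction k arbitrary: u)
  case 0
  then show ?case
    using p by (auto simp: im_on_def W_def W0_vpow_0 LpR_iff intro!: image_eqI[of _ _ u])
next
  case (Suc k)
  let ?y = "W0 (vpow (- 1)) u"
  have uL: "u \<in> Lp p" using Suc.prems by (simp add: LpR_def)
  have W_eq: "W (vpow (int n)) x = W0 (vpow (int n)) x" if "x \<in> LpR p" for x n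
    using W0_vpow_LpR[OF p that] by (simp add: W_def LpR_iff)
  have "u \<in> im_on p (W (vpow (int (Suc k)))) \<longleftrightarrow> ?y \<in> LpR p \<and> ?y \<in> im_on p (W (vpow (int k)))"
  proof
    assume "u \<in> im_on p (W (vpow (int (Suc k))))"
    then obtain x where x: "x \<in> LpR p" "u = W0 (vpow (int (Suc k))) x"
      using W_eq[of _ "Suc k"] unfolding im_on_def by blast
    then have "?y = W0 (vpow (int k)) x"
      using W0_vpow_add[OF p, of x "-1" "int (Suc k)"] by (simp add: LpR_def)
    then show "?y \<in> LpR p \<and> ?y \<in> im_on p (W (vpow (int k)))"
      using x W0_vpow_LpR[OF p x(1)] W_eq[OF x(1)] by (auto simp: im_on_def intro!: image_eqI[of _ _ x])
  next
    assume "?y \<in> LpR p \<and> ?y \<in> im_on p (W (vpow (int k)))"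
    then obtain x where x: "x \<in> LpR p" "?y = W0 (vpow (int k)) x"
      using W_eq by (auto simp: im_on_def)
    have "u = W0 (vpow 1) ?y" using W0_vpow_cancel(1)[OF p uL, of 1] by simp
    also have "\<dots> = W0 (vpow (int (Suc k))) x"
      using x W0_vpow_add[OF p, of x 1 "int k"] by (simp add: LpR_def)
    finally show "u \<in> im_on p (W (vpow (int (Suc k))))"
      using x W_eq[OF x(1), of "Suc k"] by (auto simp: im_on_def intro!: image_eqI[of _ _ x])
  qed
  also have "\<dots> \<longleftrightarrow> half_line_moment u 0 = 0 \<and> (\<forall>j<k. half_line_moment ?y j = 0)"
    using Suc.IH W0_vpow_minus_1_LpR_iff[OF p Suc.prems] by auto
  also have "\<dots> \<longleftrightarrow> (\<forall>j<Suc k. half_line_moment u j = 0)"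
  proof
    assume *: "half_line_moment u 0 = 0 \<and> (\<forall>j<k. half_line_moment ?y j = 0)"
    have "j < Suc k \<longrightarrow> half_line_moment u j = 0" for j
    proof (induction j)
      case (Suc j)
      show ?case
      proof
        assume "Suc j < Suc k"
        then have "half_line_moment u j = 0" "half_line_moment ?y j = 0" using * Suc.IH by auto
        then show "half_line_moment u (Suc j) = 0"
          using half_line_moment_W0_vpow_minus_1[OF p uL, of j] by (simp del: of_nat_Suc)
      qed
    qed (use * in simp)
    then show "\<forall>j<Suc k. half_line_moment u j = 0" by blast
  next
    assume "\<forall>j<Suc k. half_line_moment u j = 0"
    then show "half_line_moment u 0 = 0 \<and> (\<forall>j<k. half_line_moment ?y j = 0)"
      using half_line_moment_W0_vpow_minus_1[OF p uL] by auto
  qed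
  finally show ?case .
qed

section \<open>The kernel for a matching pair\<close>

lemma LpR_Lp: "u \<in> LpR p \<Longrightarrow> u \<in> Lp p"
  by (simp add: LpR_iff)

lemma LpR_add: "p \<ge> 1 \<Longrightarrow> u \<in> LpR p \<Longrightarrow> v \<in> LpR p \<Longrightarrow> u + v \<in> LpR p"
  by (simp add: LpR_iff Lp_add projP_add)

lemma LpR_diff: "p \<ge> 1 \<Longrightarrow> u \<in> LpR p \<Longrightarrow> v \<in> LpR p \<Longrightarrow> u - v \<in> LpR p"
  by (simp add: LpR_iff Lp_diff projP_diff)

lemma LpR_scaleC: "u \<in> LpR p \<Longrightarrow> z *\<^sub>C u \<in> LpR p"
  by (simp add: LpR_iff Lp_scaleC projP_scaleC)

lemma projP_0 [simp]: "projP 0 = 0"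
  using projP_scaleC[of 0 0] by simp

lemma projP_uminus: "projP (- u) = - projP u"
  using projP_diff[of 0 u] by simp

lemma flip_0 [simp]: "flip 0 = 0"
  using flip_scaleC[of 0 0] by simp

lemma zero_LpR: "0 \<in> LpR p"
  using LpR_scaleC[of _ p 0] LpR_iff[of 0 p] Lp_lfun_of[of "\<lambda>_. 0" p] by (simp add: zero_lfun_def[symmetric])

lemma projP_LpR: "u \<in> Lp p \<Longrightarrow> projP u \<in> LpR p"
  by (simp add: LpR_iff Lp_projP projP_idem)

lemma projP_flip: "u \<in> LpR p \<Longrightarrow> projP (flip u) = 0"
  using flip_projP[of u] by (simp add: LpR_iff projQ_def)

lemma projQ_flip: "u \<in> LpR p \<Longrightarrow> projQ (flip u) = flip u"
  by (simp add: projQ_def projP_flip)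

lemma flip_LpR:
  assumes "u \<in> Lp p" "projP u = 0" shows "flip u \<in> LpR p"
  using assms flip_projP[of u] by (simp add: LpR_iff Lp_flip projQ_def)

lemma recip_refl: "recip (refl_fun g) = refl_fun (recip g)"
  by (simp add: recip_def refl_fun_def)

lemma W_LpR: "p \<ge> 1 \<Longrightarrow> g \<in> G \<Longrightarrow> u \<in> LpR p \<Longrightarrow> W g u \<in> LpR p"
  unfolding W_def by (intro projP_LpR W0_Lp LpR_Lp)

lemma W0_zero: "g \<in> G \<Longrightarrow> W0 g 0 = 0"
  using W0_scaleC[of g 1 0 0] LpR_Lp[OF zero_LpR] by simp

lemmas scaleC_simps = lfun.scale_right_distrib lfun.scale_right_diff_distrib lfun.scale_scale

lemma half_twice: "(1 / 2) *\<^sub>C (u + u) = u"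
  by (simp add: lfun.scale_right_distrib lfun.scale_left_distrib[symmetric])

text \<open>On the kernel of \<open>W g\<close> the operator \<open>PP g\<close> is the involution \<open>u \<mapsto> J(g u)\<close>, so the image of its
  spectral projection is the eigenspace; the equation \<open>g u = e J u\<close> already contains \<open>W g u = 0\<close>.\<close>

lemma im_PPsign_eq:
  assumes p: "p \<ge> 1" and g: "g \<in> G" and match: "\<And>t. g t * g (- t) = 1" and e: "e * e = 1"
  shows "im_PPsign p e g = {u \<in> LpR p. W0 g u = e *\<^sub>C flip u}"
proof (intro equalityI subsetI)
  fix u assume "u \<in> im_PPsign p e g"
  then obtain s where s: "s \<in> LpR p" "projP (W0 g s) = 0" and u: "u = PPsign e g s"
    by (auto simp: im_PPsign_def ker_on_def W_def)
  define y where "y = W0 g s"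
  have sL: "s \<in> Lp p" and yL: "y \<in> Lp p" using s LpR_Lp W0_Lp[OF g p] by (auto simp: y_def)
  have Jy: "flip y \<in> LpR p" using flip_LpR[OF yL] s by (simp add: y_def)
  have u_eq: "u = (1 / 2) *\<^sub>C (s + e *\<^sub>C flip y)"
    using s u by (simp add: PPsign_def PP_def LpR_iff projQ_def y_def)
  have "W0 g (flip y) = flip (W0 (refl_fun g) y)"
    using flip_W0[OF refl_fun_in_G[OF g] p yL] by (simp add: refl_fun_def)
  also have "W0 (refl_fun g) y = W0 (refl_fun g \<odot> g) s"
    unfolding y_def by (rule W0_fmult[OF refl_fun_in_G[OF g] g p sL, symmetric])
  also have "refl_fun g \<odot> g = (\<lambda>_. 1)"
    using match by (simp add: refl_fun_def fmult_def mult.commute)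
  also have "W0 (\<lambda>_. 1) s = s" using W0_const[OF p sL] by simp
  finally have gy: "W0 g (flip y) = flip s" .
  have "W0 g u = (1 / 2) *\<^sub>C (y + e *\<^sub>C flip s)"
    unfolding u_eq using sL LpR_Lp[OF Jy]
    by (simp add: W0_scaleC[OF g p] W0_add[OF g p] Lp_scaleC Lp_add[OF p] gy[unfolded y_def] y_def)
  also have "\<dots> = e *\<^sub>C flip u"
    unfolding u_eq by (simp add: flip_scaleC flip_add flip_flip scaleC_simps e add.commute mult.left_commute)
  finally show "u \<in> {u \<in> LpR p. W0 g u = e *\<^sub>C flip u}"
    using s Jy p by (auto simp: u_eq intro!: LpR_scaleC LpR_add)
next
  fix u assume "u \<in> {u \<in> LpR p. W0 g u = e *\<^sub>C flip u}"
  then have u: "u \<in> LpR p" "W0 g u = e *\<^sub>C flip u" by auto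
  then have 0: "projP (W0 g u) = 0" by (simp add: projP_scaleC projP_flip)
  have "PPsign e g u = (1 / 2) *\<^sub>C (u + u)"
    using u 0 by (simp add: PPsign_def PP_def LpR_iff projQ_def flip_scaleC flip_flip e)
  then have "u = PPsign e g u" by (simp add: half_twice)
  then show "u \<in> im_PPsign p e g"
    using u 0 by (auto simp: im_PPsign_def ker_on_def W_def)
qed

lemma H_eq: "u \<in> LpR p \<Longrightarrow> H b u = projP (W0 b (flip u))"
  by (simp add: H_def projQ_flip)

text \<open>The sign \<open>e\<close> enters only through \<open>e\<^sup>2 = 1\<close>, which lets both signs be treated at once.\<close>

locale matching_pair =
  fixes p :: real and \<alpha> \<beta> \<gamma> \<delta> :: "real \<Rightarrow> complex" and e :: complex
  assumes p: "p \<ge> 1"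
    and G_mem: "\<alpha> \<in> G" "\<beta> \<in> G" "recip \<alpha> \<in> G"
    and nonzero: "\<And>t. \<alpha> t \<noteq> 0"
    and match: "\<And>t. \<alpha> t * \<alpha> (- t) = \<beta> t * \<beta> (- t)"
    and \<gamma>: "\<gamma> = refl_fun \<beta> \<odot> recip (refl_fun \<alpha>)"
    and \<delta>: "\<delta> = \<beta> \<odot> recip (refl_fun \<alpha>)"
    and e: "e * e = 1"
begin

lemma sub_G: "refl_fun \<alpha> \<in> G" "refl_fun \<beta> \<in> G" "recip (refl_fun \<alpha>) \<in> G" "\<gamma> \<in> G" "\<delta> \<in> G"
  unfolding \<gamma> \<delta> recip_refl by (intro refl_fun_in_G fmult_in_G G_mem)+

lemma e_simps: "e * (e * z) = z"
  using e by (simp add: mult.assoc[symmetric])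

lemma \<beta>_nonzero: "\<beta> t \<noteq> 0"
  using match[of t] nonzero[of t] nonzero[of "-t"] by auto

lemma \<gamma>_matching: "\<gamma> t * \<gamma> (- t) = 1"
  using match[of t] nonzero[of t] nonzero[of "-t"] \<beta>_nonzero[of t] \<beta>_nonzero[of "-t"]
  by (simp add: \<gamma> fmult_def refl_fun_def recip_def field_simps)

lemma \<delta>_matching: "\<delta> t * \<delta> (- t) = 1"
  using match[of t] nonzero[of t] nonzero[of "-t"] \<beta>_nonzero[of t] \<beta>_nonzero[of "-t"]
  by (simp add: \<delta> fmult_def refl_fun_def recip_def field_simps)

lemma im_\<gamma>: "im_PPsign p (- e) \<gamma> = {u \<in> LpR p. W0 \<gamma> u = (- e) *\<^sub>C flip u}"
  by (rule im_PPsign_eq[OF p sub_G(4) \<gamma>_matching]) (simp add: e)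

lemma im_\<delta>: "im_PPsign p e \<delta> = {u \<in> LpR p. W0 \<delta> u = e *\<^sub>C flip u}"
  by (rule im_PPsign_eq[OF p sub_G(5) \<delta>_matching e])

text \<open>Put \<open>y = \<alpha> x + e \<beta> J x\<close>. Then \<open>x\<close> is in the kernel if and only if \<open>y\<close> lives on the left half-line,
  and \<open>s\<close> is \<open>e J y\<close>. The matching condition gives \<open>\<delta> J y = e y\<close>.\<close>

lemma kernel_iff:
  "x \<in> ker_on p (\<lambda>u. W \<alpha> u + e *\<^sub>C H \<beta> u) \<longleftrightarrow>
     x \<in> LpR p \<and> (\<exists>s\<in>im_PPsign p e \<delta>. flip x + e *\<^sub>C W0 \<gamma> x = e *\<^sub>C W0 (recip (refl_fun \<alpha>)) s)"
proof (cases "x \<in> LpR p")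
  case x: True
  have xL: "x \<in> Lp p" "flip x \<in> Lp p" using x by (auto intro: LpR_Lp Lp_flip)
  note W0s = W0_add[OF _ p] W0_scaleC[OF _ p] W0_Lp[OF _ p] Lp_scaleC Lp_add[OF p] Lp_flip xL sub_G G_mem
  define y where "y = W0 \<alpha> x + e *\<^sub>C W0 \<beta> (flip x)"
  have yL: "y \<in> Lp p" unfolding y_def by (intro W0s)
  have Jy: "flip y = W0 (refl_fun \<alpha>) (flip x) + e *\<^sub>C W0 (refl_fun \<beta>) x"
    unfolding y_def by (simp add: flip_add flip_scaleC flip_W0[OF _ p] W0s flip_flip)
  have ker: "x \<in> ker_on p (\<lambda>u. W \<alpha> u + e *\<^sub>C H \<beta> u) \<longleftrightarrow> projP y = 0"
    using x by (simp add: ker_on_def W_def H_eq projP_add projP_scaleC y_def)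
  have prod: "recip (refl_fun \<alpha>) \<odot> refl_fun \<alpha> = (\<lambda>_. 1)" "recip (refl_fun \<alpha>) \<odot> refl_fun \<beta> = \<gamma>"
    "refl_fun \<alpha> \<odot> \<gamma> = refl_fun \<beta>" "refl_fun \<alpha> \<odot> recip (refl_fun \<alpha>) = (\<lambda>_. 1)"
    "\<delta> \<odot> refl_fun \<alpha> = \<beta>" "\<delta> \<odot> refl_fun \<beta> = \<alpha>"
    using nonzero match by (auto simp: fun_eq_iff fmult_def recip_def refl_fun_def \<gamma> \<delta> field_simps)
  show ?thesis
  proof
    assume "x \<in> ker_on p (\<lambda>u. W \<alpha> u + e *\<^sub>C H \<beta> u)"
    then have y0: "projP y = 0" using ker by simp
    define s where "s = e *\<^sub>C flip y"
    have s: "s \<in> LpR p" unfolding s_def by (intro LpR_scaleC flip_LpR yL y0)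
    have "W0 \<delta> (flip y) = W0 \<delta> (W0 (refl_fun \<alpha>) (flip x)) + e *\<^sub>C W0 \<delta> (W0 (refl_fun \<beta>) x)"
      unfolding Jy by (simp add: W0s)
    also have "\<dots> = W0 (\<delta> \<odot> refl_fun \<alpha>) (flip x) + e *\<^sub>C W0 (\<delta> \<odot> refl_fun \<beta>) x"
      using W0s by (simp add: W0_fmult[OF _ _ p])
    also have "\<dots> = e *\<^sub>C y" unfolding prod by (simp add: y_def scaleC_simps e add.commute)
    finally have "W0 \<delta> s = e *\<^sub>C flip s"
      using yL by (simp add: s_def W0s flip_scaleC flip_flip)
    then have "s \<in> im_PPsign p e \<delta>" using s by (simp add: im_\<delta>)
    moreover have "flip x + e *\<^sub>C W0 \<gamma> x = e *\<^sub>C W0 (recip (refl_fun \<alpha>)) s"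
    proof -
      have "e *\<^sub>C W0 (recip (refl_fun \<alpha>)) s = W0 (recip (refl_fun \<alpha>)) (flip y)"
        using yL by (simp add: s_def W0s e)
      also have "\<dots> = W0 (recip (refl_fun \<alpha>) \<odot> refl_fun \<alpha>) (flip x) + e *\<^sub>C W0 (recip (refl_fun \<alpha>) \<odot> refl_fun \<beta>) x"
        unfolding Jy using W0s by (simp add: W0_fmult[OF _ _ p])
      also have "\<dots> = flip x + e *\<^sub>C W0 \<gamma> x"
        unfolding prod using W0_const[OF p xL(2)] by simp
      finally show ?thesis ..
    qed
    ultimately show "x \<in> LpR p \<and> (\<exists>s\<in>im_PPsign p e \<delta>. flip x + e *\<^sub>C W0 \<gamma> x = e *\<^sub>C W0 (recip (refl_fun \<alpha>)) s)"
      using x by blast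
  next
    assume "x \<in> LpR p \<and> (\<exists>s\<in>im_PPsign p e \<delta>. flip x + e *\<^sub>C W0 \<gamma> x = e *\<^sub>C W0 (recip (refl_fun \<alpha>)) s)"
    then obtain s where "s \<in> LpR p" and s: "flip x + e *\<^sub>C W0 \<gamma> x = e *\<^sub>C W0 (recip (refl_fun \<alpha>)) s"
      by (auto simp: im_\<delta>)
    have sL: "s \<in> Lp p" using \<open>s \<in> LpR p\<close> by (rule LpR_Lp)
    have "flip y = W0 (refl_fun \<alpha>) (flip x) + e *\<^sub>C W0 (refl_fun \<alpha> \<odot> \<gamma>) x"
      unfolding prod by (rule Jy)
    also have "\<dots> = W0 (refl_fun \<alpha>) (flip x + e *\<^sub>C W0 \<gamma> x)"
      using W0s by (simp add: W0_fmult[OF _ _ p])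
    also have "\<dots> = e *\<^sub>C W0 (refl_fun \<alpha> \<odot> recip (refl_fun \<alpha>)) s"
      unfolding s using sL W0s by (simp add: W0_fmult[OF _ _ p])
    also have "\<dots> = e *\<^sub>C s" unfolding prod using W0_const[OF p sL] by simp
    finally have "y = e *\<^sub>C flip s" using flip_flip[of y] by (simp add: flip_scaleC)
    then show "x \<in> ker_on p (\<lambda>u. W \<alpha> u + e *\<^sub>C H \<beta> u)"
      using ker \<open>s \<in> LpR p\<close> by (simp add: projP_scaleC projP_flip)
  qed
qed (auto simp: ker_on_def)

text \<open>With \<open>x0\<close> the right inverse applied to \<open>P(\<alpha>(-t)\<^sup>-\<^sup>1 s)\<close>, the function \<open>w = \<gamma> x0 - \<alpha>(-t)\<^sup>-\<^sup>1 s\<close> lives on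
  the left half-line. Therefore the two projected terms of \<open>phi\<close> combine to \<open>- e J w\<close>, and no
  projection is left in \<open>2 x = x0 - e J w\<close>. The identity is then a computation with symbols.\<close>

lemma phi_identity:
  assumes R: "right_inverse p (W \<gamma>) R" and s: "s \<in> im_PPsign p e \<delta>"
  defines "x \<equiv> phi e \<alpha> \<beta> R s"
  shows "x \<in> LpR p" and "flip x + e *\<^sub>C W0 \<gamma> x = e *\<^sub>C W0 (recip (refl_fun \<alpha>)) s"
proof -
  let ?i = "W0 (recip (refl_fun \<alpha>)) s"
  have sR: "s \<in> LpR p" and s\<delta>: "W0 \<delta> s = e *\<^sub>C flip s" using s by (auto simp: im_\<delta>)
  note sL = LpR_Lp[OF sR]
  define x0 where "x0 = R (W (recip (refl_fun \<alpha>)) s)"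
  have Ws: "W (recip (refl_fun \<alpha>)) s \<in> LpR p" by (rule W_LpR[OF p sub_G(3) sR])
  then have x0: "x0 \<in> LpR p" and W\<gamma>: "W \<gamma> x0 = projP ?i"
    using R by (auto simp: right_inverse_def bounded_operator_def x0_def W_def)
  note x0L = LpR_Lp[OF x0]
  note W0s = W0_add[OF _ p] W0_diff[OF _ p] W0_scaleC[OF _ p] W0_Lp[OF _ p] Lp_scaleC Lp_add[OF p] Lp_diff[OF p] Lp_flip sL x0L sub_G G_mem
  \<comment> \<open>w lives on the left half-line, as W \<gamma> x0 is the projection of ?i\<close>
  define w where "w = W0 \<gamma> x0 - ?i"
  have wL: "w \<in> Lp p" unfolding w_def by (intro W0s)
  have w0: "projP w = 0" using W\<gamma> by (simp add: w_def projP_diff W_def)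
  have Jw: "flip w \<in> LpR p" by (rule flip_LpR[OF wL w0])
  have "x = (1 / 2) *\<^sub>C (x0 - e *\<^sub>C flip (projQ (W0 \<gamma> x0)) + e *\<^sub>C flip (projQ ?i))"
    using x0 by (simp add: x_def phi_def Let_def \<gamma> x0_def[symmetric] LpR_iff)
  also have "\<dots> = (1 / 2) *\<^sub>C (x0 - e *\<^sub>C flip (projQ w))"
  proof -
    have "projQ w = projQ (W0 \<gamma> x0) - projQ ?i" by (simp add: w_def projQ_def projP_diff)
    moreover have "x0 - e *\<^sub>C u + e *\<^sub>C v = x0 - e *\<^sub>C (u - v)" for u v
      by (simp add: lfun.scale_right_diff_distrib)
    ultimately show ?thesis by (simp only: flip_diff)
  qed
  finally have x: "x = (1 / 2) *\<^sub>C (x0 - e *\<^sub>C flip w)"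
    by (simp add: projQ_def w0)
  show "x \<in> LpR p" unfolding x by (intro LpR_scaleC LpR_diff p x0 Jw)
  \<comment> \<open>both identities are forms of the matching condition\<close>
  have prod: "\<gamma> \<odot> refl_fun \<gamma> = (\<lambda>_. 1)" "\<gamma> \<odot> recip \<alpha> \<odot> \<delta> = recip (refl_fun \<alpha>)"
  proof -
    show "\<gamma> \<odot> refl_fun \<gamma> = (\<lambda>_. 1)"
      using \<gamma>_matching by (simp add: fmult_def refl_fun_def)
    show "\<gamma> \<odot> recip \<alpha> \<odot> \<delta> = recip (refl_fun \<alpha>)"
    proof
      fix t
      have "\<beta> (- t) * \<beta> t = \<alpha> t * \<alpha> (- t)" using match[of t] by (simp add: mult.commute)
      then show "(\<gamma> \<odot> recip \<alpha> \<odot> \<delta>) t = recip (refl_fun \<alpha>) t"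
        using nonzero[of t] nonzero[of "-t"] by (simp add: fmult_def recip_def refl_fun_def \<gamma> \<delta> field_simps)
    qed
  qed
  have "flip w = W0 (refl_fun \<gamma>) (flip x0) - W0 (recip \<alpha>) (flip s)"
    unfolding w_def using W0s by (simp add: flip_diff flip_W0[OF _ p] recip_refl) (simp add: refl_fun_def)
  also have "flip s = e *\<^sub>C W0 \<delta> s"
    unfolding s\<delta> by (simp add: e)
  finally have "W0 \<gamma> (flip w) = W0 \<gamma> (W0 (refl_fun \<gamma>) (flip x0)) - e *\<^sub>C W0 \<gamma> (W0 (recip \<alpha>) (W0 \<delta> s))"
    using W0s refl_fun_in_G by simp
  also have "\<dots> = W0 (\<gamma> \<odot> refl_fun \<gamma>) (flip x0) - e *\<^sub>C W0 (\<gamma> \<odot> recip \<alpha> \<odot> \<delta>) s"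
    using W0s refl_fun_in_G fmult_in_G by (simp add: W0_fmult[OF _ _ p])
  finally have \<gamma>Jw: "W0 \<gamma> (flip w) = flip x0 - e *\<^sub>C ?i"
    unfolding prod using W0_const[OF p Lp_flip[OF x0L]] by simp
  have "flip x = (1 / 2) *\<^sub>C (flip x0 - e *\<^sub>C (W0 \<gamma> x0 - ?i))"
    unfolding x by (simp add: flip_scaleC flip_diff flip_flip w_def)
  moreover have "W0 \<gamma> x = (1 / 2) *\<^sub>C (W0 \<gamma> x0 - e *\<^sub>C (flip x0 - e *\<^sub>C ?i))"
    unfolding x using W0s LpR_Lp[OF Jw] by (simp add: \<gamma>Jw)
  moreover have "(1 / 2) *\<^sub>C (A - e *\<^sub>C (B - C)) + e *\<^sub>C (1 / 2) *\<^sub>C (B - e *\<^sub>C (A - e *\<^sub>C C)) =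
      (1 / 2) *\<^sub>C (e *\<^sub>C C + e *\<^sub>C C)" for A B C
    by (simp add: scaleC_simps e e_simps mult.left_commute)
  ultimately have "flip x + e *\<^sub>C W0 \<gamma> x = (1 / 2) *\<^sub>C (e *\<^sub>C ?i + e *\<^sub>C ?i)"
    by (simp only:)
  then show "flip x + e *\<^sub>C W0 \<gamma> x = e *\<^sub>C ?i"
    by (simp add: half_twice)
qed

lemma phi_0:
  assumes R: "right_inverse p (W \<gamma>) R"
  shows "phi e \<alpha> \<beta> R 0 = 0"
proof -
  have "R (0 *\<^sub>C 0) = 0 *\<^sub>C R 0"
    using R zero_LpR unfolding right_inverse_def bounded_operator_def by blast
  then have "R 0 = 0" by simp
  then show ?thesis
    using W0_zero[OF sub_G(3)] W0_zero[OF sub_G(4)] by (simp add: phi_def Let_def W_def projQ_def \<gamma>)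
qed

text \<open>Both \<open>x\<close> and \<open>phi e \<alpha> \<beta> R s\<close> solve \<open>J x + e \<gamma> x = e \<alpha>(-t)\<^sup>-\<^sup>1 s\<close>; their difference solves the homogeneous
  equation \<open>\<gamma> z = - e J z\<close>. The sum is direct because \<open>s\<close> can be recovered from \<open>x\<close>.\<close>

theorem kernel_decomposition:
  assumes R: "right_inverse p (W \<gamma>) R"
  shows "ker_on p (\<lambda>u. W \<alpha> u + e *\<^sub>C H \<beta> u) =
      sum_of_sets (im_PPsign p (- e) \<gamma>) (phi e \<alpha> \<beta> R ` im_PPsign p e \<delta>)" (is "?K = ?S")
    and "im_PPsign p (- e) \<gamma> \<inter> phi e \<alpha> \<beta> R ` im_PPsign p e \<delta> = {0}"
proof -
  note W0s = W0_add[OF _ p] W0_diff[OF _ p] LpR_Lp sub_G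
  show "?K = ?S"
  proof (intro equalityI subsetI)
    fix x assume "x \<in> ?K"
    then obtain s where x: "x \<in> LpR p" and s: "s \<in> im_PPsign p e \<delta>"
      and eq: "flip x + e *\<^sub>C W0 \<gamma> x = e *\<^sub>C W0 (recip (refl_fun \<alpha>)) s"
      unfolding kernel_iff by blast
    define z where "z = x - phi e \<alpha> \<beta> R s"
    note phi = phi_identity[OF R s]
    have "z \<in> LpR p" unfolding z_def by (intro LpR_diff p x phi)
    moreover have "flip z + e *\<^sub>C W0 \<gamma> z = 0"
    proof -
      have "W0 \<gamma> z = W0 \<gamma> x - W0 \<gamma> (phi e \<alpha> \<beta> R s)"
        unfolding z_def using W0s x phi(1) by simp
      then have "flip z + e *\<^sub>C W0 \<gamma> z = (flip x + e *\<^sub>C W0 \<gamma> x) -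
        (flip (phi e \<alpha> \<beta> R s) + e *\<^sub>C W0 \<gamma> (phi e \<alpha> \<beta> R s))"
        by (simp add: z_def flip_diff lfun.scale_right_diff_distrib)
      then show ?thesis unfolding eq phi(2) by simp
    qed
    then have "e *\<^sub>C (flip z + e *\<^sub>C W0 \<gamma> z) = 0" by simp
    then have "W0 \<gamma> z = (- e) *\<^sub>C flip z"
      by (simp add: scaleC_simps e add_eq_0_iff)
    ultimately have "z \<in> im_PPsign p (- e) \<gamma>" by (simp add: im_\<gamma>)
    moreover have "x = z + phi e \<alpha> \<beta> R s" by (simp add: z_def)
    ultimately show "x \<in> ?S" using s unfolding sum_of_sets_def by blast
  next
    fix x assume "x \<in> ?S"
    then obtain z s where z: "z \<in> im_PPsign p (- e) \<gamma>" and s: "s \<in> im_PPsign p e \<delta>"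
      and x: "x = z + phi e \<alpha> \<beta> R s" unfolding sum_of_sets_def by blast
    note phi = phi_identity[OF R s]
    have zR: "z \<in> LpR p" and "W0 \<gamma> z = (- e) *\<^sub>C flip z" using z by (auto simp: im_\<gamma>)
    then have "flip z + e *\<^sub>C W0 \<gamma> z = 0" by (simp add: e)
    then have "flip x + e *\<^sub>C W0 \<gamma> x = e *\<^sub>C W0 (recip (refl_fun \<alpha>)) s"
      unfolding x using W0s zR phi by (simp add: flip_add scaleC_simps algebra_simps)
    moreover have "x \<in> LpR p" unfolding x by (intro LpR_add p zR phi)
    ultimately show "x \<in> ?K" unfolding kernel_iff using s by blast
  qed
  show "im_PPsign p (- e) \<gamma> \<inter> phi e \<alpha> \<beta> R ` im_PPsign p e \<delta> = {0}"
  proof (intro equalityI subsetI)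
    fix x assume "x \<in> im_PPsign p (- e) \<gamma> \<inter> phi e \<alpha> \<beta> R ` im_PPsign p e \<delta>"
    then obtain s where x: "W0 \<gamma> x = (- e) *\<^sub>C flip x" and s: "s \<in> im_PPsign p e \<delta>" and xs: "x = phi e \<alpha> \<beta> R s"
      by (auto simp: im_\<gamma>)
    have sL: "s \<in> Lp p" using s by (auto simp: im_\<delta> LpR_Lp)
    have "e *\<^sub>C W0 (recip (refl_fun \<alpha>)) s = 0"
      using phi_identity(2)[OF R s] x unfolding xs by (simp add: e)
    then have "e *\<^sub>C e *\<^sub>C W0 (recip (refl_fun \<alpha>)) s = 0" by simp
    then have "W0 (recip (refl_fun \<alpha>)) s = 0" by (simp add: e)
    then have "W0 (refl_fun \<alpha> \<odot> recip (refl_fun \<alpha>)) s = 0"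
      by (simp add: W0_fmult[OF _ _ p] sL sub_G W0_zero)
    moreover have "refl_fun \<alpha> \<odot> recip (refl_fun \<alpha>) = (\<lambda>_. 1)"
      using nonzero by (simp add: fmult_def recip_def refl_fun_def)
    ultimately have "s = 0" using W0_const[OF p sL, of 1] by simp
    then show "x \<in> {0}" using xs phi_0[OF R] by simp
  next
    fix x :: lfun assume "x \<in> {0}"
    moreover have "0 \<in> im_PPsign p (- e) \<gamma>" "0 \<in> im_PPsign p e \<delta>"
      by (auto simp: im_\<gamma> im_\<delta> zero_LpR W0_zero sub_G)
    ultimately show "x \<in> im_PPsign p (- e) \<gamma> \<inter> phi e \<alpha> \<beta> R ` im_PPsign p e \<delta>"
      using phi_0[OF R] by (auto intro!: image_eqI[of _ _ 0])
  qed
qed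

end

section \<open>The homogeneous equation for index 0 and 1\<close>

lemma fsig_square:
  assumes "c 0 * c 0 = 1"
  shows "fsig \<kappa> c * fsig \<kappa> c = 1"
proof -
  have "((- 1 :: complex) powi \<kappa>) * (- 1) powi \<kappa> = 1"
    by (simp add: power_int_mult_distrib[symmetric])
  then show ?thesis using assms by (simp add: fsig_def algebra_simps)
qed

lemma W_Gplus_eq_W0:
  assumes "p \<ge> 1" "g \<in> Gplus" "u \<in> LpR p"
  shows "W g u = W0 g u"
  using W0_Gplus_LpR[OF assms(2,1,3)] by (simp add: W_def LpR_iff)

text \<open>With \<open>g = c\<^sub>+ z\<close> the equation \<open>\<gamma> z = - e J z\<close> becomes \<open>\<sigma> v\<^sup>-\<^sup>1 g = - e J g\<close>. Its left side is, on the
  left half-line, a multiple of \<open>J psi0\<close>, so \<open>g = m psi0\<close>. Since \<open>v\<^sup>-\<^sup>1 psi0 = - J psi0\<close>, the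
  constant satisfies \<open>m = e \<sigma> m\<close>, which is the factor \<open>(1 + e \<sigma>) / 2\<close> of the line.\<close>

lemma im_PPsign_index_1:
  assumes p: "p \<ge> 1" and \<gamma>: "\<gamma> \<in> G" and match: "\<And>t. \<gamma> t * \<gamma> (- t) = 1"
    and cp: "\<And>t. cp t \<noteq> 0" "cp \<in> Gplus" "recip cp \<in> Gplus"
    and fact: "\<And>t. \<gamma> t = \<sigma> * inverse (cp (- t)) * vpow (- 1) t * cp t"
    and \<sigma>: "\<sigma> * \<sigma> = 1" and e: "e * e = 1"
  shows "im_PPsign p (- e) \<gamma> = psi_line e \<sigma> cp"
proof -
  have cpG: "cp \<in> G" "recip cp \<in> G" "refl_fun cp \<in> G" "recip (refl_fun cp) \<in> G"
    using cp Gplus_subset_G refl_fun_in_G by (auto simp: recip_refl)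
  note G_mem = cpG \<gamma> const_in_G vpow_in_G fmult_in_G
  have im: "im_PPsign p (- e) \<gamma> = {u \<in> LpR p. W0 \<gamma> u = (- e) *\<^sub>C flip u}"
    by (rule im_PPsign_eq[OF p \<gamma> match]) (simp add: e)
  have psi: "psi0 \<in> LpR p" by (rule psi0_LpR[OF p])
  note psiL = LpR_Lp[OF psi]
  have e\<sigma>: "(1 + e * \<sigma>) * \<sigma> = (1 + e * \<sigma>) * e"
    using \<sigma> e by (simp add: algebra_simps)
  have line: "psi_line e \<sigma> cp = {(((1 + e * \<sigma>) / 2) * l) *\<^sub>C W0 (recip cp) psi0 |l. True}"
    unfolding psi_line_def lfun.span_singleton
    using psi psiL by (auto simp: W_Gplus_eq_W0[OF p cp(3)] LpR_scaleC W0_scaleC[OF cpG(2) p] image_iff)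
  show ?thesis
  proof (intro equalityI subsetI)
    fix z assume "z \<in> psi_line e \<sigma> cp"
    then obtain l where z: "z = (((1 + e * \<sigma>) / 2) * l) *\<^sub>C W0 (recip cp) psi0"
      unfolding line by blast
    define w where "w = W0 (recip cp) psi0"
    have w: "w \<in> LpR p" unfolding w_def by (rule W0_Gplus_LpR[OF cp(3) p psi])
    have "W0 \<gamma> w = W0 (\<gamma> \<odot> recip cp) psi0"
      unfolding w_def by (rule W0_fmult[OF \<gamma> cpG(2) p psiL, symmetric])
    also have "\<gamma> \<odot> recip cp = (\<lambda>_. \<sigma>) \<odot> (recip (refl_fun cp) \<odot> vpow (- 1))"
      using cp(1) by (simp add: fun_eq_iff fmult_def recip_def refl_fun_def fact)
    also have "W0 \<dots> psi0 = \<sigma> *\<^sub>C W0 (recip (refl_fun cp)) (W0 (vpow (- 1)) psi0)"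
      using G_mem psiL W0_Lp[OF _ p] W0_const[OF p] by (simp add: W0_fmult[OF _ _ p])
    also have "W0 (vpow (- 1)) psi0 = (- 1) *\<^sub>C flip psi0" using W0_vpow_minus_1_psi0 by simp
    also have "W0 (recip (refl_fun cp)) ((- 1) *\<^sub>C flip psi0) = (- 1) *\<^sub>C flip w"
      unfolding w_def using G_mem psiL by (simp only: W0_scaleC[OF _ p] Lp_flip flip_W0[OF _ p] recip_refl)
    finally have "W0 \<gamma> w = (- \<sigma>) *\<^sub>C flip w" by simp
    then have "W0 \<gamma> z = - (((1 + e * \<sigma>) * \<sigma> * l / 2) *\<^sub>C flip w)"
      unfolding z w_def[symmetric] using \<gamma> LpR_Lp[OF w] by (simp add: W0_scaleC[OF _ p] mult_ac)
    also have "\<dots> = (- e) *\<^sub>C flip z"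
      unfolding e\<sigma> z w_def[symmetric] by (simp add: flip_scaleC mult_ac)
    finally show "z \<in> im_PPsign p (- e) \<gamma>"
      using w by (auto simp: im z w_def[symmetric] intro: LpR_scaleC)
  next
    fix z assume "z \<in> im_PPsign p (- e) \<gamma>"
    then have z: "z \<in> LpR p" "W0 \<gamma> z = (- e) *\<^sub>C flip z" by (auto simp: im)
    note zL = LpR_Lp[OF z(1)]
    define g where "g = W0 cp z"
    have g: "g \<in> LpR p" unfolding g_def by (rule W0_Gplus_LpR[OF cp(2) p z(1)])
    note gL = LpR_Lp[OF g]
    have "W0 (recip cp) g = W0 (recip cp \<odot> cp) z"
      unfolding g_def by (rule W0_fmult[OF cpG(2,1) p zL, symmetric])
    also have "recip cp \<odot> cp = (\<lambda>_. 1)" using cp(1) by (simp add: fun_eq_iff fmult_def recip_def)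
    finally have zg: "z = W0 (recip cp) g" using W0_const[OF p zL] by simp
    have "\<sigma> *\<^sub>C W0 (vpow (- 1)) g = W0 ((\<lambda>_. \<sigma>) \<odot> (vpow (- 1) \<odot> cp)) z"
      using G_mem zL W0_Lp[OF _ p] W0_const[OF p] by (simp add: W0_fmult[OF _ _ p] g_def)
    also have "(\<lambda>_. \<sigma>) \<odot> (vpow (- 1) \<odot> cp) = refl_fun cp \<odot> \<gamma>"
      using cp(1) by (simp add: fun_eq_iff fmult_def refl_fun_def fact)
    also have "W0 (refl_fun cp \<odot> \<gamma>) z = W0 (refl_fun cp) ((- e) *\<^sub>C flip z)"
      unfolding z(2)[symmetric] by (rule W0_fmult[OF cpG(3) \<gamma> p zL])
    also have "\<dots> = (- e) *\<^sub>C flip g"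
      unfolding g_def using G_mem zL by (simp only: W0_scaleC[OF _ p] Lp_flip flip_W0[OF _ p])
    finally have "\<sigma> *\<^sub>C \<sigma> *\<^sub>C W0 (vpow (- 1)) g = \<sigma> *\<^sub>C (- e) *\<^sub>C flip g" by simp
    then have vg: "W0 (vpow (- 1)) g = (- (e * \<sigma>)) *\<^sub>C flip g" by (simp add: \<sigma> mult.commute)
    then have "projQ (W0 (vpow (- 1)) g) = (- (e * \<sigma>)) *\<^sub>C flip g"
      using projP_flip[OF g] by (simp add: projQ_def projP_scaleC projP_uminus)
    then have "(- (e * \<sigma>)) *\<^sub>C (- (e * \<sigma>)) *\<^sub>C flip g =
      (- (e * \<sigma>)) *\<^sub>C ((- of_real (sqrt 2) * half_line_moment g 0) *\<^sub>C flip psi0)"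
      unfolding projQ_W0_vpow_minus_1[OF p g] by simp
    moreover have "e * \<sigma> * (e * \<sigma>) = 1" using e \<sigma> by (metis mult.assoc mult.commute mult.right_neutral)
    ultimately obtain m where "flip g = m *\<^sub>C flip psi0" by (auto simp: mult.assoc)
    then have gm: "g = m *\<^sub>C psi0" by (metis flip_flip flip_scaleC)
    have "(- m) *\<^sub>C flip psi0 = (- (e * \<sigma>) * m) *\<^sub>C flip psi0"
      using vg psiL W0_vpow_minus_1_psi0 unfolding gm
      by (simp add: W0_scaleC[OF vpow_in_G p] flip_scaleC)
    \<comment> \<open>psi0 is an eigenvector, so the eigenvalue e \<sigma> must be 1 unless m vanishes\<close>
    then have "m = e * \<sigma> * m" using flip_psi0_nonzero by (simp add: lfun.scale_cancel_right)
    then have "m = ((1 + e * \<sigma>) / 2) * m" by (simp add: field_simps)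
    then have "z = (((1 + e * \<sigma>) / 2) * m) *\<^sub>C W0 (recip cp) psi0"
      unfolding zg gm using W0_scaleC[OF cpG(2) p psiL] by simp
    then show "z \<in> psi_line e \<sigma> cp" unfolding line by blast
  qed
qed

text \<open>With \<open>g = c\<^sub>+ z\<close> the equation becomes \<open>\<sigma> g = - e J g\<close>, whose two sides live on opposite half-lines.\<close>

lemma im_PPsign_index_0:
  assumes p: "p \<ge> 1" and \<gamma>: "\<gamma> \<in> G" and match: "\<And>t. \<gamma> t * \<gamma> (- t) = 1"
    and cp: "\<And>t. cp t \<noteq> 0" "cp \<in> Gplus" "recip cp \<in> Gplus"
    and fact: "\<And>t. \<gamma> t = \<sigma> * inverse (cp (- t)) * cp t"
    and \<sigma>: "\<sigma> * \<sigma> = 1" and e: "e * e = 1"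
  shows "im_PPsign p (- e) \<gamma> = {0}"
proof -
  have cpG: "cp \<in> G" "recip cp \<in> G" "refl_fun cp \<in> G"
    using cp Gplus_subset_G refl_fun_in_G by auto
  note G_mem = cpG \<gamma> const_in_G fmult_in_G
  have im: "im_PPsign p (- e) \<gamma> = {u \<in> LpR p. W0 \<gamma> u = (- e) *\<^sub>C flip u}"
    by (rule im_PPsign_eq[OF p \<gamma> match]) (simp add: e)
  have "z = 0" if z: "z \<in> LpR p" "W0 \<gamma> z = (- e) *\<^sub>C flip z" for z
  proof -
    note zL = LpR_Lp[OF z(1)]
    define g where "g = W0 cp z"
    have g: "g \<in> LpR p" unfolding g_def by (rule W0_Gplus_LpR[OF cp(2) p z(1)])
    have "W0 (recip cp) g = W0 (recip cp \<odot> cp) z"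
      unfolding g_def by (rule W0_fmult[OF cpG(2,1) p zL, symmetric])
    also have "recip cp \<odot> cp = (\<lambda>_. 1)" using cp(1) by (simp add: fun_eq_iff fmult_def recip_def)
    finally have zg: "z = W0 (recip cp) g" using W0_const[OF p zL] by simp
    have "\<sigma> *\<^sub>C g = W0 ((\<lambda>_. \<sigma>) \<odot> cp) z"
      using G_mem zL W0_Lp[OF _ p] W0_const[OF p] by (simp add: W0_fmult[OF _ _ p] g_def)
    also have "(\<lambda>_. \<sigma>) \<odot> cp = refl_fun cp \<odot> \<gamma>"
      using cp(1) by (simp add: fun_eq_iff fmult_def refl_fun_def fact)
    also have "W0 (refl_fun cp \<odot> \<gamma>) z = W0 (refl_fun cp) ((- e) *\<^sub>C flip z)"
      unfolding z(2)[symmetric] by (rule W0_fmult[OF cpG(3) \<gamma> p zL])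
    also have "\<dots> = (- e) *\<^sub>C flip g"
      unfolding g_def using G_mem zL by (simp only: W0_scaleC[OF _ p] Lp_flip flip_W0[OF _ p])
    finally have "projP (\<sigma> *\<^sub>C g) = projP ((- e) *\<^sub>C flip g)" by simp
    then have "\<sigma> *\<^sub>C g = 0" using g projP_flip[OF g] by (simp only: projP_scaleC LpR_iff) simp
    then have "\<sigma> *\<^sub>C \<sigma> *\<^sub>C g = 0" by simp
    then have "g = 0" by (simp add: \<sigma>)
    then show "z = 0" using zg W0_zero[OF cpG(2)] by simp
  qed
  then show ?thesis by (auto simp: im zero_LpR W0_zero[OF \<gamma>])
qed

section \<open>The kernel of W(a) + e H(b)\<close>

text \<open>On the half-line \<open>W(v\<^sup>k)\<close> is \<open>W0(v\<^sup>k)\<close>, without projection. So \<open>W(\<alpha>) W(v\<^sup>k) = W(a)\<close>, and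
  \<open>J v\<^sup>k = v\<^sup>-\<^sup>k J\<close> gives \<open>H(\<beta>) W(v\<^sup>k) = H(b)\<close>.\<close>

lemma kernel_shift:
  assumes p: "p \<ge> 1" and ab: "a \<in> G" "b \<in> G"
  shows "ker_on p (\<lambda>u. W a u + e *\<^sub>C H b u) =
     W (vpow (- int k)) ` (ker_on p (\<lambda>u. W (a \<odot> vpow (- int k)) u + e *\<^sub>C H (b \<odot> vpow (int k)) u) \<inter> im_on p (W (vpow (int k))))"
proof -
  let ?A = "\<lambda>u. W a u + e *\<^sub>C H b u"
    and ?B = "\<lambda>u. W (a \<odot> vpow (- int k)) u + e *\<^sub>C H (b \<odot> vpow (int k)) u" and ?V = "W0 (vpow (int k))"
  have V: "?V x \<in> LpR p" "W (vpow (int k)) x = ?V x" "W (vpow (- int k)) (?V x) = x" "?B (?V x) = ?A x"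
    if x: "x \<in> LpR p" for x
  proof -
    note xL = LpR_Lp[OF x]
    show VR: "?V x \<in> LpR p" by (rule W0_vpow_LpR[OF p x])
    note VL = LpR_Lp[OF VR]
    show "W (vpow (int k)) x = ?V x" using VR by (simp add: W_def LpR_iff)
    show "W (vpow (- int k)) (?V x) = x" using x W0_vpow_cancel(2)[OF p xL] by (simp add: W_def LpR_iff)
    have "W0 (a \<odot> vpow (- int k)) (?V x) = W0 a x"
      using W0_vpow_cancel(2)[OF p xL] by (simp add: W0_fmult[OF ab(1) vpow_in_G p VL])
    moreover have "W0 (b \<odot> vpow (int k)) (flip (?V x)) = W0 b (flip x)"
      using W0_vpow_cancel(1)[OF p Lp_flip[OF xL]]
      by (simp add: W0_fmult[OF ab(2) vpow_in_G p W0_Lp[OF vpow_in_G p Lp_flip[OF xL]]] flip_W0[OF vpow_in_G p xL] refl_vpow)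
    ultimately show "?B (?V x) = ?A x"
      using x VR by (simp add: W_def H_eq)
  qed
  show ?thesis
  proof (intro equalityI subsetI)
    fix x assume "x \<in> ker_on p ?A"
    then have x: "x \<in> LpR p" "?A x = 0" by (auto simp: ker_on_def)
    then show "x \<in> W (vpow (- int k)) ` (ker_on p ?B \<inter> im_on p (W (vpow (int k))))"
      using V[OF x(1)] by (intro image_eqI[of _ _ "?V x"]) (auto simp: ker_on_def im_on_def intro!: image_eqI[of _ _ x])
  next
    fix x assume "x \<in> W (vpow (- int k)) ` (ker_on p ?B \<inter> im_on p (W (vpow (int k))))"
    then obtain y where "y \<in> LpR p" and x: "x = W (vpow (- int k)) (W (vpow (int k)) y)" and "?B (W (vpow (int k)) y) = 0"
      by (auto simp: ker_on_def im_on_def)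
    then show "x \<in> ker_on p ?A" using V[of y] by (auto simp: ker_on_def)
  qed
qed

theorem theorem3p2:
  fixes a b c d cp :: "real \<Rightarrow> complex"
    and p :: real and k :: nat and \<kappa>\<^sub>1 \<kappa>\<^sub>2 :: int
    and R :: "lfun \<Rightarrow> lfun" and \<phi> :: "complex \<Rightarrow> lfun \<Rightarrow> lfun" and \<sigma> :: complex
  assumes p: "1 \<le> p"
    and ab: "a \<in> G" "b \<in> G" "\<forall>t. a t * a (- t) = b t * b (- t)" "G_invertible a"
    and c: "c = refl_fun b \<odot> recip (refl_fun a)"
    and d: "d = b \<odot> recip (refl_fun a)"
    and nu: "nu c = 0" "nu d = 0"
    and kappa: "\<kappa>\<^sub>1 = ind p (W c)" "\<kappa>\<^sub>2 = ind p (W d)" "\<kappa>\<^sub>1 < 0" "\<kappa>\<^sub>2 > 0"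
    and k: "k \<ge> 1" "0 \<le> 2 * int k + \<kappa>\<^sub>1" "2 * int k + \<kappa>\<^sub>1 \<le> 1"
    and sigma: "\<sigma> = fsig \<kappa>\<^sub>1 c"
    and cp: "wh_factor \<kappa>\<^sub>1 c cp"
    and R: "right_inverse p (W (c \<odot> vpow (- 2 * int k))) R"
    and phi: "\<phi> = (\<lambda>e. phi e (a \<odot> vpow (- int k)) (b \<odot> vpow (int k)) R)"
  shows "\<forall>e\<in>{1, - 1}.
    (odd \<kappa>\<^sub>1 \<longrightarrow>
       psi_line e \<sigma> cp \<inter> \<phi> e ` im_PPsign p e d = {0} \<and>
       ker_on p (\<lambda>u. W a u + e *\<^sub>C H b u) =
         W (vpow (- int k)) `
           (sum_of_sets (psi_line e \<sigma> cp) (\<phi> e ` im_PPsign p e d) \<inter> im_on p (W (vpow (int k)))) \<and>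
       ker_on p (\<lambda>u. W a u + e *\<^sub>C H b u) =
         {W (vpow (- int k)) u |u.
            u \<in> sum_of_sets (psi_line e \<sigma> cp) (\<phi> e ` im_PPsign p e d) \<and>
            (\<forall>j<k. half_line_moment u j = 0)}) \<and>
    (even \<kappa>\<^sub>1 \<longrightarrow>
       ker_on p (\<lambda>u. W a u + e *\<^sub>C H b u) =
         W (vpow (- int k)) `
           (\<phi> e ` im_PPsign p e d \<inter> im_on p (W (vpow (int k)))) \<and>
       ker_on p (\<lambda>u. W a u + e *\<^sub>C H b u) =
         {W (vpow (- int k)) u |u.
            u \<in> \<phi> e ` im_PPsign p e d \<and>
            (\<forall>j<k. half_line_moment u j = 0)})"
proof
  fix e :: complex assume "e \<in> {1, - 1}"
  then have e: "e * e = 1" by auto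
  obtain ai where ai: "ai \<in> G" "\<And>t. a t * ai t = 1"
    using ab(4) unfolding G_invertible_def by blast
  have a0: "a t \<noteq> 0" for t using ai(2)[of t] by auto
  have ai_eq: "recip a = ai"
    using ai(2) a0 by (simp add: recip_def fun_eq_iff field_simps)
  define \<alpha> \<beta> \<gamma> where "\<alpha> = a \<odot> vpow (- int k)" and "\<beta> = b \<odot> vpow (int k)" and "\<gamma> = c \<odot> vpow (- 2 * int k)"
  have vrefl: "vpow n (- t) = vpow (- n) t" for n t
    using refl_vpow[of n] by (simp add: refl_fun_def fun_eq_iff)
  have vinv: "inverse (vpow n t) = vpow (- n) t" for n t
    by (simp add: vpow_def power_int_minus)
  have vmul: "vpow m t * vpow n t = vpow (m + n) t" for m n t
    by (simp add: vpow_add fmult_def)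
  have v0: "vpow n t \<noteq> 0" for n t by (simp add: vpow_def vfun_nonzero)
  interpret M: matching_pair p \<alpha> \<beta> \<gamma> d e
  proof
    show "\<alpha> \<in> G" "\<beta> \<in> G" unfolding \<alpha>_def \<beta>_def using ab by (intro fmult_in_G vpow_in_G; simp)+
    have "recip \<alpha> = ai \<odot> vpow (int k)"
      unfolding \<alpha>_def ai_eq[symmetric] by (simp add: recip_def fmult_def vinv)
    then show "recip \<alpha> \<in> G" using ai by (simp add: fmult_in_G vpow_in_G)
    show "\<alpha> t \<noteq> 0" for t using a0 v0 by (simp add: \<alpha>_def fmult_def)
    show "\<alpha> t * \<alpha> (- t) = \<beta> t * \<beta> (- t)" for t
    proof -
      have "\<alpha> t * \<alpha> (- t) = a t * a (- t) * (vpow (- int k) t * vpow (int k) t)"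
        "\<beta> t * \<beta> (- t) = b t * b (- t) * (vpow (int k) t * vpow (- int k) t)"
        by (simp_all add: \<alpha>_def \<beta>_def fmult_def vrefl)
      then show ?thesis using ab(3) by (simp add: vmul)
    qed
    show "\<gamma> = refl_fun \<beta> \<odot> recip (refl_fun \<alpha>)"
    proof
      fix t
      have "(refl_fun \<beta> \<odot> recip (refl_fun \<alpha>)) t = b (- t) * inverse (a (- t)) * (vpow (- int k) t * vpow (- int k) t)"
        by (simp add: \<alpha>_def \<beta>_def fmult_def refl_fun_def recip_def vrefl vinv)
      then show "\<gamma> t = (refl_fun \<beta> \<odot> recip (refl_fun \<alpha>)) t"
        by (simp add: vmul \<gamma>_def c fmult_def refl_fun_def recip_def)
    qed
    show "d = \<beta> \<odot> recip (refl_fun \<alpha>)"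
    proof
      fix t
      have "(\<beta> \<odot> recip (refl_fun \<alpha>)) t = b t * inverse (a (- t)) * (vpow (int k) t * vpow (- int k) t)"
        by (simp add: \<alpha>_def \<beta>_def fmult_def refl_fun_def recip_def vrefl vinv)
      then show "d t = (\<beta> \<odot> recip (refl_fun \<alpha>)) t"
        by (simp add: vmul vpow_0 d fmult_def refl_fun_def recip_def)
    qed
  qed (use p e in auto)
  have R': "right_inverse p (W \<gamma>) R" using R by (simp add: \<gamma>_def)
  have \<phi>e: "\<phi> e = phi e \<alpha> \<beta> R" by (simp add: phi \<alpha>_def \<beta>_def)
  let ?L = "im_PPsign p (- e) \<gamma>" and ?I = "\<phi> e ` im_PPsign p e d"
  let ?K = "ker_on p (\<lambda>u. W a u + e *\<^sub>C H b u)"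
  have inter: "?L \<inter> ?I = {0}" and K': "ker_on p (\<lambda>u. W \<alpha> u + e *\<^sub>C H \<beta> u) = sum_of_sets ?L ?I"
    using M.kernel_decomposition[OF R'] by (simp_all add: \<phi>e)
  have K: "?K = W (vpow (- int k)) ` (sum_of_sets ?L ?I \<inter> im_on p (W (vpow (int k))))"
    using kernel_shift[OF p ab(1,2), of e k] K' by (simp add: \<alpha>_def \<beta>_def)
  have "sum_of_sets ?L ?I \<subseteq> LpR p" unfolding K'[symmetric] by (auto simp: ker_on_def)
  then have "sum_of_sets ?L ?I \<inter> im_on p (W (vpow (int k))) = {u \<in> sum_of_sets ?L ?I. \<forall>j<k. half_line_moment u j = 0}"
    using im_W_vpow_iff_moments[OF p] by blast
  with K have K2: "?K = {W (vpow (- int k)) u |u. u \<in> sum_of_sets ?L ?I \<and> (\<forall>j<k. half_line_moment u j = 0)}"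
    by auto
  have cp': "\<And>t. cp t \<noteq> 0" "cp \<in> Gplus" "recip cp \<in> Gplus"
    and fact: "\<And>t. c t = \<sigma> * inverse (cp (- t)) * vpow (- \<kappa>\<^sub>1) t * cp t"
    using cp by (auto simp: wh_factor_def sigma vpow_def)
  have "b 0 \<noteq> 0" using ab(3)[rule_format, of 0] a0[of 0] by auto
  then have "c 0 * c 0 = 1"
    using ab(3)[rule_format, of 0] a0[of 0] by (simp add: c fmult_def refl_fun_def recip_def field_simps)
  then have \<sigma>: "\<sigma> * \<sigma> = 1" unfolding sigma by (rule fsig_square)
  have \<gamma>_fact: "\<gamma> t = \<sigma> * inverse (cp (- t)) * vpow (- (2 * int k + \<kappa>\<^sub>1)) t * cp t" for t
  proof -
    have "\<gamma> t = \<sigma> * inverse (cp (- t)) * (vpow (- \<kappa>\<^sub>1) t * vpow (- 2 * int k) t) * cp t"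
      by (simp add: \<gamma>_def fmult_def fact)
    then show ?thesis by (simp add: vmul algebra_simps)
  qed
  have odd_L: "?L = psi_line e \<sigma> cp" if "odd \<kappa>\<^sub>1"
  proof (rule im_PPsign_index_1[OF p M.sub_G(4) M.\<gamma>_matching cp' _ \<sigma> e])
    have "2 * int k + \<kappa>\<^sub>1 \<noteq> 0" using that by presburger
    then have "2 * int k + \<kappa>\<^sub>1 = 1" using k by linarith
    then show "\<gamma> t = \<sigma> * inverse (cp (- t)) * vpow (- 1) t * cp t" for t
      using \<gamma>_fact[of t] by simp
  qed
  have even_L: "?L = {0}" if "even \<kappa>\<^sub>1"
  proof (rule im_PPsign_index_0[OF p M.sub_G(4) M.\<gamma>_matching cp' _ \<sigma> e])
    have "2 * int k + \<kappa>\<^sub>1 \<noteq> 1" using that by presburger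
    then have "2 * int k + \<kappa>\<^sub>1 = 0" using k by linarith
    then show "\<gamma> t = \<sigma> * inverse (cp (- t)) * cp t" for t
      using \<gamma>_fact[of t] by (simp add: vpow_0)
  qed
  have sum0: "sum_of_sets {0} ?I = ?I" by (auto simp: sum_of_sets_def)
  show "(odd \<kappa>\<^sub>1 \<longrightarrow>
       psi_line e \<sigma> cp \<inter> ?I = {0} \<and>
       ?K = W (vpow (- int k)) ` (sum_of_sets (psi_line e \<sigma> cp) ?I \<inter> im_on p (W (vpow (int k)))) \<and>
       ?K = {W (vpow (- int k)) u |u. u \<in> sum_of_sets (psi_line e \<sigma> cp) ?I \<and> (\<forall>j<k. half_line_moment u j = 0)}) \<and>
    (even \<kappa>\<^sub>1 \<longrightarrow>
       ?K = W (vpow (- int k)) ` (?I \<inter> im_on p (W (vpow (int k)))) \<and>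
       ?K = {W (vpow (- int k)) u |u. u \<in> ?I \<and> (\<forall>j<k. half_line_moment u j = 0)})"
  proof (rule conjI; rule impI)
    assume o: "odd \<kappa>\<^sub>1"
    from inter K K2 show "psi_line e \<sigma> cp \<inter> ?I = {0} \<and>
       ?K = W (vpow (- int k)) ` (sum_of_sets (psi_line e \<sigma> cp) ?I \<inter> im_on p (W (vpow (int k)))) \<and>
       ?K = {W (vpow (- int k)) u |u. u \<in> sum_of_sets (psi_line e \<sigma> cp) ?I \<and> (\<forall>j<k. half_line_moment u j = 0)}"
      unfolding odd_L[OF o] by (intro conjI)
  next
    assume ev: "even \<kappa>\<^sub>1"
    from K K2 show "?K = W (vpow (- int k)) ` (?I \<inter> im_on p (W (vpow (int k)))) \<and>
       ?K = {W (vpow (- int k)) u |u. u \<in> ?I \<and> (\<forall>j<k. half_line_moment u j = 0)}"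
      unfolding even_L[OF ev] sum0 by (intro conjI)
  qed
qed

end
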